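(* Let $\alpha,\beta,\gamma,\rho,a\in\mathbb{C}$ with $\operatorname{Re}(\alpha)>0$ and $a\ne0$, put $N=[\operatorname{Re}(\alpha)]+1$, and let $\mu$ be a real number, such that $\mu>0$ and $\operatorname{Re}(\rho)-N>\max\{0,\operatorname{Re}(-\alpha-\beta-\gamma)\}$. Then for every $x>0$, $$\left({}^{c}\mathcal{D}_{0+}^{\alpha,\beta,\gamma}\left(t^{\rho-1}I^{m,n}_{p,q}\left[at^{\mu}\,\middle|\begin{matrix}(a_i,A_i,\alpha_i)_{1,p}\\(b_j,B_j,\beta_j)_{1,q}\end{matrix}\right]\right)\right)(x)=x^{\beta+\rho-1}\,I^{m,n+2}_{p+2,q+2}\left[ax^{\mu}\,\middle|\begin{matrix}(1-\rho,\mu,1),\ (1-\alpha-\beta-\gamma-\rho+N,\mu,1),\ (a_i,A_i,\alpha_i)_{1,p}\\(b_j,B_j,\beta_j)_{1,q},\ (1-\beta-\rho,\mu,1),\ (1-\gamma-\rho+N,\mu,1)\end{matrix}\right].$$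
   Context: **$I$-function.** Let $m,n,p,q$ be integers with $0\le m\le q$, $0\le n\le p$; let $a_i\in\mathbb{C}$, $A_i,\alpha_i>0$ $(1\le i\le p)$ and $b_j\in\mathbb{C}$, $B_j,\beta_j>0$ $(1\le j\le q)$. For $z\neq0$ (with a chosen value of $\arg z$; $z^{-s}=e^{-s(\log|z|+i\arg z)}$), $$I^{m,n}_{p,q}\left[z\,\middle|\begin{matrix}(a_i,A_i,\alpha_i)_{1,p}\\(b_j,B_j,\beta_j)_{1,q}\end{matrix}\right]=\frac{1}{2\pi i}\int_{C}\chi(s)z^{-s}\,ds,\qquad \chi(s)=\frac{\prod_{j=1}^{m}\Gamma^{\beta_j}(b_j+B_js)\prod_{i=1}^{n}\Gamma^{\alpha_i}(1-a_i-A_is)}{\prod_{j=m+1}^{q}\Gamma^{\beta_j}(1-b_j-B_js)\prod_{i=n+1}^{p}\Gamma^{\alpha_i}(a_i+A_is)}.$$ Here $(a_i,A_i,\alpha_i)_{1,p}$ is the ordered list of triples for $i=1,\dots,p$ (the first $n$ upper triples and the first $m$ lower triples enter the numerator), $\Gamma^{\kappa}(w)=(\Gamma(w))^{\kappa}$, with the branch of non-integer powers fixed along $C$ and the same for the same triple in all $I$-functions considered; empty products equal $1$. The singularities of $\Gamma^{\beta_j}(b_j+B_js)$, $j\le m$, lie to the left of $C$ and those of $\Gamma^{\alpha_i}(1-a_i-A_is)$, $i\le n$, to the right. **Standing assumptions.** The contour $C$ is the imaginary axis $\operatorname{Re}(s)=0$, traversed upwards, and for each $I$-function occurring the following conditions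 for absolute convergence hold: with (computed from the parameters of that $I$-function) $\mu^*=\sum_{j=1}^q\beta_jB_j-\sum_{i=1}^p\alpha_iA_i$, $\Omega=\sum_{i=1}^p(\frac12-\operatorname{Re}(a_i))\alpha_i-\sum_{j=1}^q(\frac12-\operatorname{Re}(b_j))\beta_j$, $\Delta=\sum_{j=1}^m\beta_jB_j-\sum_{j=m+1}^q\beta_jB_j+\sum_{i=1}^n\alpha_iA_i-\sum_{i=n+1}^p\alpha_iA_i$, either $\Delta>0$ and $|\arg z|<\frac{\pi}{2}\Delta$, or $\Delta\ge0$, $|\arg z|=\frac{\pi}{2}\Delta$ and one of: $\mu^*=0$ and $\Omega<-1$; or $\mu^*\ne0$ and $\Omega+\sigma\mu^*<-1$ where $\sigma=\operatorname{Re}(s)$ on $C$ (so $\sigma=0$). For $t>0$, $\arg(at^{\pm\mu})=\arg a$. **Operators.** For $\operatorname{Re}(\alpha)>0$, $x>0$, the left-sided Saigo fractional integral is $$\left(\mathcal{I}_{0+}^{\alpha,\beta,\gamma}f\right)(x)=\frac{x^{-\alpha-\beta}}{\Gamma(\alpha)}\int_0^x(x-t)^{\alpha-1}{}_{2}F_1\left(\alpha+\beta,-\gamma;\alpha;1-\tfrac{t}{x}\right)f(t)\,dt,$$ and the left-sided generalized Caputo fractional derivative, applied to functions $f$ that are $N$ times differentiable on $(0,\infty)$, is $$\left({}^{c}\mathcal{D}_{0+}^{\alpha,\beta,\gamma}f\right)(x)=\left(\mathcal{I}_{0+}^{-\alpha+N,-\beta-N,\alpha+\gamma-N}f^{(N)}\right)(x),\qquad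 N=[\operatorname{Re}(\alpha)]+1,$$ with $[\cdot]$ the integer part and $f^{(N)}$ the $N$-th derivative. *)

theory Defs
  imports "HOL-Analysis.Analysis"
begin

subsection \<open>Branches of real powers of the Gamma function\<close>

definition imag_axis :: "complex set" where
  "imag_axis = {s. Re s = 0}"

text \<open>\<open>g\<close> is a branch along \<open>C\<close> of \<open>s \<mapsto> Gamma (w s)\<close> to the power \<open>\<kappa>\<close>: it is
  \<open>exp (\<kappa> * l s)\<close> for a logarithm \<open>l\<close> of \<open>Gamma (w s)\<close> which is continuous on the part of \<open>C\<close>
  free of poles. On \<open>C\<close> poles can occur only for factors in a denominator, where the reciprocal
  vanishes; since \<open>x / 0 = 0\<close>, this is what the value 0 at a pole encodes.\<close>

definition Gamma_power_branch ::
    "complex set \<Rightarrow> real \<Rightarrow> (complex \<Rightarrow> complex) \<Rightarrow> (complex \<Rightarrow> complex) \<Rightarrow> bool" where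
  "Gamma_power_branch C \<kappa> w g \<longleftrightarrow>
     (\<exists>l. continuous_on {s \<in> C. w s \<notin> \<int>\<^sub>\<le>\<^sub>0} l \<and>
          (\<forall>s \<in> C. w s \<notin> \<int>\<^sub>\<le>\<^sub>0 \<longrightarrow>
             exp (l s) = Gamma (w s) \<and> g s = exp (complex_of_real \<kappa> * l s))) \<and>
     (\<forall>s \<in> C. w s \<in> \<int>\<^sub>\<le>\<^sub>0 \<longrightarrow> g s = 0)"

text \<open>\<open>G c d \<kappa> s\<close> is the chosen value of \<open>Gamma (c + d * s)\<close> to the power \<open>\<kappa>\<close>. As the choice
  depends only on \<open>c\<close>, \<open>d\<close>, \<open>\<kappa>\<close>, a factor belonging to a given triple has the same branch in
  every I-function built from \<open>G\<close>.\<close>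

definition Gamma_power_family ::
    "(complex \<Rightarrow> real \<Rightarrow> real \<Rightarrow> complex \<Rightarrow> complex) \<Rightarrow> bool" where
  "Gamma_power_family G \<longleftrightarrow>
     (\<forall>c d \<kappa>. d \<noteq> 0 \<and> \<kappa> > 0 \<longrightarrow>
        Gamma_power_branch imag_axis \<kappa> (\<lambda>s. c + complex_of_real d * s) (G c d \<kappa>))"

subsection \<open>The I-function\<close>

text \<open>\<open>U\<close> is the list of upper triples (length \<open>p\<close>), \<open>L\<close> the list of lower triples (length \<open>q\<close>).
  A triple \<open>(a, A, \<kappa>)\<close> has coefficient \<open>A\<close> and exponent \<open>\<kappa>\<close>.\<close>

type_synonym triple = "complex \<times> real \<times> real"

definition I_chi ::
    "(complex \<Rightarrow> real \<Rightarrow> real \<Rightarrow> complex \<Rightarrow> complex) \<Rightarrow>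
     nat \<Rightarrow> nat \<Rightarrow> triple list \<Rightarrow> triple list \<Rightarrow> complex \<Rightarrow> complex" where
  "I_chi G m n U L s =
     ((\<Prod>(b, B, \<kappa>)\<leftarrow>take m L. G b B \<kappa> s) * (\<Prod>(a, A, \<kappa>)\<leftarrow>take n U. G (1 - a) (- A) \<kappa> s)) /
     ((\<Prod>(b, B, \<kappa>)\<leftarrow>drop m L. G (1 - b) (- B) \<kappa> s) * (\<Prod>(a, A, \<kappa>)\<leftarrow>drop n U. G a A \<kappa> s))"

text \<open>The argument \<open>\<theta>\<close> of \<open>z\<close> is passed separately and need not be principal. The contour is
  parametrized by \<open>s = \<i> * \<tau>\<close>, \<open>ds = \<i> d\<tau>\<close>.\<close>

definition I_fun ::
    "(complex \<Rightarrow> real \<Rightarrow> real \<Rightarrow> complex \<Rightarrow> complex) \<Rightarrow>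
     nat \<Rightarrow> nat \<Rightarrow> triple list \<Rightarrow> triple list \<Rightarrow> real \<Rightarrow> complex \<Rightarrow> complex" where
  "I_fun G m n U L \<theta> z =
     1 / (2 * complex_of_real pi * \<i>) *
     (LINT \<tau>|lborel.
        I_chi G m n U L (\<i> * complex_of_real \<tau>) *
        exp (- (\<i> * complex_of_real \<tau>) *
             (complex_of_real (ln (cmod z)) + \<i> * complex_of_real \<theta>)) * \<i>)"

definition I_mu_star :: "triple list \<Rightarrow> triple list \<Rightarrow> real" where
  "I_mu_star U L = (\<Sum>(b, B, \<kappa>)\<leftarrow>L. \<kappa> * B) - (\<Sum>(a, A, \<kappa>)\<leftarrow>U. \<kappa> * A)"

definition I_Omega :: "triple list \<Rightarrow> triple list \<Rightarrow> real" where
  "I_Omega U L =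
     (\<Sum>(a, A, \<kappa>)\<leftarrow>U. (1/2 - Re a) * \<kappa>) - (\<Sum>(b, B, \<kappa>)\<leftarrow>L. (1/2 - Re b) * \<kappa>)"

definition I_Delta :: "nat \<Rightarrow> nat \<Rightarrow> triple list \<Rightarrow> triple list \<Rightarrow> real" where
  "I_Delta m n U L =
     (\<Sum>(b, B, \<kappa>)\<leftarrow>take m L. \<kappa> * B) - (\<Sum>(b, B, \<kappa>)\<leftarrow>drop m L. \<kappa> * B) +
     (\<Sum>(a, A, \<kappa>)\<leftarrow>take n U. \<kappa> * A) - (\<Sum>(a, A, \<kappa>)\<leftarrow>drop n U. \<kappa> * A)"

definition I_abs_conv ::
    "real \<Rightarrow> nat \<Rightarrow> nat \<Rightarrow> triple list \<Rightarrow> triple list \<Rightarrow> real \<Rightarrow> bool" where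
  "I_abs_conv \<sigma> m n U L \<theta> \<longleftrightarrow>
     (I_Delta m n U L > 0 \<and> \<bar>\<theta>\<bar> < pi / 2 * I_Delta m n U L) \<or>
     (I_Delta m n U L \<ge> 0 \<and> \<bar>\<theta>\<bar> = pi / 2 * I_Delta m n U L \<and>
        ((I_mu_star U L = 0 \<and> I_Omega U L < -1) \<or>
         (I_mu_star U L \<noteq> 0 \<and> I_Omega U L + \<sigma> * I_mu_star U L < -1)))"

definition I_parameters :: "nat \<Rightarrow> nat \<Rightarrow> triple list \<Rightarrow> triple list \<Rightarrow> bool" where
  "I_parameters m n U L \<longleftrightarrow>
     m \<le> length L \<and> n \<le> length U \<and>
     (\<forall>(a, A, \<kappa>) \<in> set U. A > 0 \<and> \<kappa> > 0) \<and> (\<forall>(b, B, \<kappa>) \<in> set L. B > 0 \<and> \<kappa> > 0)"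

text \<open>The vertical line \<open>Re s = \<sigma>\<close> has the singularities of the lower numerator factors on its
  left and those of the upper numerator factors on its right.\<close>

definition I_separated :: "real \<Rightarrow> nat \<Rightarrow> nat \<Rightarrow> triple list \<Rightarrow> triple list \<Rightarrow> bool" where
  "I_separated \<sigma> m n U L \<longleftrightarrow>
     (\<forall>(b, B, \<kappa>) \<in> set (take m L). \<forall>s. b + complex_of_real B * s \<in> \<int>\<^sub>\<le>\<^sub>0 \<longrightarrow> Re s < \<sigma>) \<and>
     (\<forall>(a, A, \<kappa>) \<in> set (take n U). \<forall>s. 1 - a - complex_of_real A * s \<in> \<int>\<^sub>\<le>\<^sub>0 \<longrightarrow> Re s > \<sigma>)"

text \<open>The contour is the line \<open>Re s = 0\<close>.\<close>

definition I_admissible :: "nat \<Rightarrow> nat \<Rightarrow> triple list \<Rightarrow> triple list \<Rightarrow> real \<Rightarrow> bool" where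
  "I_admissible m n U L \<theta> \<longleftrightarrow>
     I_parameters m n U L \<and> I_separated 0 m n U L \<and> I_abs_conv 0 m n U L \<theta>"

subsection \<open>Saigo integral and generalized Caputo derivative\<close>

text \<open>Only arguments \<open>1 - t / x\<close> in \<open>(0, 1)\<close> matter below, where the series converges.\<close>

definition hyp2F1 :: "complex \<Rightarrow> complex \<Rightarrow> complex \<Rightarrow> complex \<Rightarrow> complex" where
  "hyp2F1 a b c z = eval_fps (fps_hypergeo [a, b] [c] 1) z"

definition saigo_integrand ::
    "complex \<Rightarrow> complex \<Rightarrow> complex \<Rightarrow> (real \<Rightarrow> complex) \<Rightarrow> real \<Rightarrow> real \<Rightarrow> complex" where
  "saigo_integrand \<alpha> \<beta> \<gamma> f x t =
     complex_of_real (x - t) powr (\<alpha> - 1) *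
     hyp2F1 (\<alpha> + \<beta>) (- \<gamma>) \<alpha> (1 - complex_of_real (t / x)) * f t"

text \<open>The integral is the gauge integral, which covers both Lebesgue integrals and integrals that
  are improper at the end points.\<close>

definition saigo ::
    "complex \<Rightarrow> complex \<Rightarrow> complex \<Rightarrow> (real \<Rightarrow> complex) \<Rightarrow> real \<Rightarrow> complex" where
  "saigo \<alpha> \<beta> \<gamma> f x =
     complex_of_real x powr (- \<alpha> - \<beta>) / Gamma \<alpha> * integral {0..x} (saigo_integrand \<alpha> \<beta> \<gamma> f x)"

definition nth_deriv :: "nat \<Rightarrow> (real \<Rightarrow> complex) \<Rightarrow> real \<Rightarrow> complex" where
  "nth_deriv k = (\<lambda>g t. vector_derivative g (at t)) ^^ k"

definition times_differentiable_on :: "nat \<Rightarrow> (real \<Rightarrow> complex) \<Rightarrow> real set \<Rightarrow> bool" where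
  "times_differentiable_on N f S \<longleftrightarrow> (\<forall>k<N. \<forall>t\<in>S. nth_deriv k f differentiable (at t))"

definition caputo_order :: "complex \<Rightarrow> nat" where
  "caputo_order \<alpha> = nat \<lfloor>Re \<alpha>\<rfloor> + 1"

definition caputo ::
    "complex \<Rightarrow> complex \<Rightarrow> complex \<Rightarrow> (real \<Rightarrow> complex) \<Rightarrow> real \<Rightarrow> complex" where
  "caputo \<alpha> \<beta> \<gamma> f x =
     (let N = caputo_order \<alpha>
      in saigo (- \<alpha> + of_nat N) (- \<beta> - of_nat N) (\<alpha> + \<gamma> - of_nat N) (nth_deriv N f) x)"

text \<open>Existence of the integral defining \<^term>\<open>caputo \<alpha> \<beta> \<gamma> f x\<close>.\<close>

definition caputo_exists ::
    "complex \<Rightarrow> complex \<Rightarrow> complex \<Rightarrow> (real \<Rightarrow> complex) \<Rightarrow> real \<Rightarrow> bool" where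
  "caputo_exists \<alpha> \<beta> \<gamma> f x \<longleftrightarrow>
     (let N = caputo_order \<alpha>
      in saigo_integrand (- \<alpha> + of_nat N) (- \<beta> - of_nat N) (\<alpha> + \<gamma> - of_nat N)
           (nth_deriv N f) x integrable_on {0..x})"

end

theory Submission
  imports Defs
begin

text \<open>
  On the contour the \<open>I\<close>-function is a superposition of powers: with
  \<open>w \<tau> = \<rho> - N - \<i> \<mu> \<tau>\<close>, which runs over the line \<open>Re w = r\<close> for \<open>r = Re \<rho> - N > 0\<close>,
  the function \<open>f\<close> is \<open>t \<mapsto> \<integral> c \<tau> * t powr (w \<tau> + N - 1) d\<tau>\<close>, where \<open>c\<close> is the integrand \<open>\<chi>\<close> times
  an exponential. For a single power everything is explicit. The \<open>N\<close>-th derivative contributes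
  \<open>\<Gamma> (w + N) / \<Gamma> w\<close>, and the Saigo integral of \<open>t powr (w - 1)\<close> is, term by term in the
  hypergeometric series, a sum of Beta integrals, which Gauss's theorem evaluates as a quotient of
  Gamma functions. The product of the two is the quotient of the two functions \<open>\<chi>\<close>, because the
  adjoined triples have exponent 1 and their branches are therefore the Gamma function itself. What
  has to be justified is that the operator may be applied inside the \<open>\<tau>\<close>-integral.

  This is delicate on the boundary \<open>\<bar>\<theta>\<bar> = \<pi> \<Delta> / 2\<close>. There \<open>\<bar>c \<tau>\<bar>\<close> only has the bound
  \<open>\<bar>\<tau>\<bar> powr \<Omega>\<close>, and absolute convergence of the right-hand side says \<open>\<Omega> + Re \<alpha> < -1\<close>, as the adjoined
  triples raise \<open>\<Omega>\<close> by \<open>Re \<alpha>\<close>. Differentiating \<open>N\<close> times costs \<open>\<bar>\<tau>\<bar> ^ N\<close>, and \<open>N > Re \<alpha>\<close>; the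
  differentiated integral may diverge, so that \<open>f\<close> has an \<open>N\<close>-th derivative by hypothesis only, about
  whose integrability nothing is known. Since \<open>N - 1 \<le> Re \<alpha>\<close>, the derivative of order
  \<open>N - 1\<close> can still be computed under the integral sign. The last derivative is moved to the
  kernel. The derivative of the kernel has the singularity \<open>(1 - u) powr (p - 2)\<close> at \<open>u = 1\<close>, where
  \<open>p = N - Re \<alpha>\<close> lies in \<open>(0, 1]\<close>; this is not integrable, but subtracting from each power
  \<open>u powr w\<close> the power \<open>u powr r\<close> with the real part of the exponent leaves a difference of order
  \<open>\<bar>Im w\<bar> powr \<delta> * (1 - u) powr \<delta>\<close>. A \<open>\<delta>\<close> slightly larger than \<open>1 - p\<close> makes the kernel integrable, and
  the \<open>\<tau>\<close>-integral still converges since \<open>(N - 1) + (1 - p) = Re \<alpha>\<close> and the condition on \<open>\<Omega>\<close> is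
  strict. The fundamental theorem of calculus for the gauge integral asks for nothing but the
  existence of the derivative, so it yields both the existence of the integral and its value
  (\<open>has_integral_kernel_times_derivative\<close>).

  The other ingredients are the size of the Gamma function on vertical lines, which turns the
  conditions on \<open>\<Delta>\<close> and \<open>\<Omega>\<close> into integrability (\<open>rGamma_line_estimate\<close>,
  \<open>I_integrand_weight_integrable\<close>), Gauss's theorem with the resulting Mellin transform of the kernel
  (\<open>Gauss_hypergeometric\<close>, \<open>has_integral_hyp2F1_kernel\<close>), and differentiation under the
  integral sign (\<open>nth_deriv_powr_integral\<close>).
\<close>

section \<open>The Gamma function on vertical lines\<close>

text \<open>Stirling's formula for \<open>1 / \<Gamma>\<close> on the line \<open>Re z = x\<close>, with a bounded error in place of the constant. The
  weight is in \<open>1 + \<bar>y\<bar>\<close> rather than \<open>\<bar>y\<bar>\<close> so that bounds derived from it make sense for all \<open>y\<close>.\<close>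

definition rGamma_line_estimate :: "real \<Rightarrow> bool" where
  "rGamma_line_estimate x \<longleftrightarrow> (\<exists>C. \<forall>y. 1 \<le> \<bar>y\<bar> \<longrightarrow>
     \<bar>ln (cmod (rGamma (Complex x y))) - ((1/2 - x) * ln (1 + \<bar>y\<bar>) + pi * \<bar>y\<bar> / 2)\<bar> \<le> C)"

text \<open>The second derivative of \<open>\<phi> u = ln \<bar>u + \<i> y\<bar>\<close> is at most \<open>M = 1 / (k\<^sup>2 + y\<^sup>2)\<close> in absolute
  value for \<open>u \<ge> k\<close>, so \<open>\<phi>\<close> and \<open>- \<phi>\<close> become convex after adding \<open>M u\<^sup>2 / 2\<close>. Hence \<open>\<phi>\<close> differs
  little from its chord over an interval of length 1.\<close>

lemma ln_cmod_chord_error: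
  fixes k x y :: real
  assumes "0 \<le> k" "0 \<le> x" "x \<le> 1" "y \<noteq> 0"
  shows "\<bar>ln (cmod (Complex (k + x) y)) -
           ((1 - x) * ln (cmod (Complex k y)) + x * ln (cmod (Complex (k + 1) y)))\<bar>
         \<le> 1 / (k\<^sup>2 + y\<^sup>2)"
proof -
  define \<phi> where "\<phi> = (\<lambda>u. ln (u\<^sup>2 + y\<^sup>2) / 2)"
  define M where "M = 1 / (k\<^sup>2 + y\<^sup>2)"
  have pos: "u\<^sup>2 + y\<^sup>2 > 0" for u using assms(4) by (simp add: add_nonneg_pos)
  have ln_eq: "ln (cmod (Complex u y)) = \<phi> u" for u
    using pos[of u] by (simp add: cmod_def \<phi>_def ln_sqrt)
  define d where "d = (\<lambda>u. u / (u\<^sup>2 + y\<^sup>2))"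
  define e where "e = (\<lambda>u. (y\<^sup>2 - u\<^sup>2) / (u\<^sup>2 + y\<^sup>2)\<^sup>2)"
  have d: "(\<phi> has_real_derivative d u) (at u)" for u
    unfolding \<phi>_def d_def using pos[of u]
    by (auto intro!: derivative_eq_intros simp: divide_simps)
  have e: "(d has_real_derivative e u) (at u)" for u
    unfolding d_def e_def using pos[of u]
    by (auto intro!: derivative_eq_intros simp: field_simps power2_eq_square)
  have bnd: "\<bar>e u\<bar> \<le> M" if "u \<in> {k..k+1}" for u
  proof -
    have "\<bar>e u\<bar> = \<bar>y\<^sup>2 - u\<^sup>2\<bar> / (u\<^sup>2 + y\<^sup>2)\<^sup>2" by (simp add: e_def)
    also have "\<dots> \<le> (u\<^sup>2 + y\<^sup>2) / (u\<^sup>2 + y\<^sup>2)\<^sup>2"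
      by (intro divide_right_mono) (auto simp: abs_le_iff)
    also have "\<dots> = 1 / (u\<^sup>2 + y\<^sup>2)" by (simp add: power2_eq_square)
    also have "\<dots> \<le> M" unfolding M_def using that assms pos[of k]
      by (intro divide_left_mono add_right_mono power_mono mult_pos_pos pos) auto
    finally show ?thesis .
  qed
  have cvx: "convex_on {k..k+1} (\<lambda>u. s * \<phi> u + M * u\<^sup>2 / 2)" if s: "s = 1 \<or> s = -1" for s
  proof (rule f''_ge0_imp_convex)
    fix u assume u: "u \<in> {k..k+1}"
    show "((\<lambda>u. s * \<phi> u + M * u\<^sup>2 / 2) has_real_derivative s * d u + M * u) (at u)"
      by (auto intro!: derivative_eq_intros d)
    show "((\<lambda>u. s * d u + M * u) has_real_derivative s * e u + M) (at u)"
      by (auto intro!: derivative_eq_intros e)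
    show "s * e u + M \<ge> 0" using bnd[OF u] s by auto
  qed auto
  have M0: "M \<ge> 0" using pos[of k] by (simp add: M_def)
  have main: "s * \<phi> (k + x) \<le> (1 - x) * (s * \<phi> k) + x * (s * \<phi> (k + 1)) + M" 
    if s: "s = 1 \<or> s = -1" for s
  proof -
    have gen: "A + B \<le> (1 - x) * (P + K) + x * (Q + L) \<Longrightarrow> (1 - x) * K + x * L - B = M * D \<Longrightarrow>
      M * D \<le> M * 1 \<Longrightarrow> A \<le> (1 - x) * P + x * Q + M" for A B P Q K L D :: real
      unfolding distrib_left by linarith
    have kx: "(1 - x) *\<^sub>R k + x *\<^sub>R (k + 1) = k + x" by (simp add: algebra_simps)
    have "s * \<phi> ((1 - x) *\<^sub>R k + x *\<^sub>R (k + 1)) + M * ((1 - x) *\<^sub>R k + x *\<^sub>R (k + 1))\<^sup>2 / 2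
         \<le> (1 - x) * (s * \<phi> k + M * k\<^sup>2 / 2) + x * (s * \<phi> (k+1) + M * (k+1)\<^sup>2 / 2)"
      by (rule convex_onD[OF cvx[OF s]]) (use assms in auto)
    then have 1: "s * \<phi> (k + x) + M * (k + x)\<^sup>2 / 2
         \<le> (1 - x) * (s * \<phi> k + M * k\<^sup>2 / 2) + x * (s * \<phi> (k+1) + M * (k+1)\<^sup>2 / 2)"
      unfolding kx .
    have 2: "(1 - x) * (M * k\<^sup>2 / 2) + x * (M * (k+1)\<^sup>2 / 2) - M * (k + x)\<^sup>2 / 2 = M * ((x * (1 - x)) / 2)"
      by (simp add: field_simps power2_eq_square)
    have 3: "M * ((x * (1 - x)) / 2) \<le> M * 1"
      using assms M0 mult_le_one[of x "1 - x"] by (intro mult_left_mono) auto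
    show ?thesis by (rule gen[OF 1 2 3])
  qed
  show ?thesis
    using main[of 1] main[of "-1"] unfolding ln_eq M_def[symmetric]
    by (simp add: abs_le_iff algebra_simps)
qed

lemma ln_cmod_rGamma_series:
  assumes "y \<noteq> 0" "n > 0"
  shows "ln (cmod (rGamma_series (Complex x y) n)) =
    (\<Sum>k\<le>n. ln (cmod (Complex (real k + x) y))) - ln (fact n) - x * ln (real n)"
proof -
  have eq: "Complex x y + of_nat k = Complex (real k + x) y" for k
    by (simp add: complex_eq_iff)
  have nz: "Complex (real k + x) y \<noteq> 0" for k using assms by (simp add: complex_eq_iff)
  have "cmod (pochhammer (Complex x y) (n+1)) = (\<Prod>k\<le>n. cmod (Complex (real k + x) y))"
    by (simp add: pochhammer_Suc_prod eq prod_norm atMost_atLeast0)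
  moreover have "ln (\<Prod>k\<le>n. cmod (Complex (real k + x) y)) = (\<Sum>k\<le>n. ln (cmod (Complex (real k + x) y)))"
    using nz by (intro ln_prod) auto
  moreover have "(\<Prod>k\<le>n. cmod (Complex (real k + x) y)) > 0"
    using nz by (intro prod_pos) auto
  ultimately show ?thesis using assms nz
    unfolding rGamma_series_def
    by (auto simp: norm_divide norm_mult norm_fact ln_div ln_mult)
qed

text \<open>By Euler's product, \<open>ln \<bar>1 / \<Gamma> (x + \<i> y)\<bar>\<close> is a limit of sums of \<open>ln \<bar>k + x + \<i> y\<bar>\<close> up to a term
  affine in \<open>x\<close>. Linear interpolation between \<open>x = 0\<close> and \<open>x = 1\<close> leaves affine terms alone, and the
  chord errors of the summands add up to at most \<open>\<Sum> 1 / (k\<^sup>2 + 1)\<close>, uniformly in \<open>y\<close>.\<close>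

lemma rGamma_interpolation_error:
  assumes "0 \<le> x" "x \<le> 1" "1 \<le> \<bar>y\<bar>"
  shows "\<bar>ln (cmod (rGamma (Complex x y))) -
           ((1 - x) * ln (cmod (rGamma (Complex 0 y))) + x * ln (cmod (rGamma (Complex 1 y))))\<bar>
         \<le> 1 + pi\<^sup>2 / 6"
proof -
  have y: "y \<noteq> 0" using assms by auto
  have lim: "(\<lambda>n. ln (cmod (rGamma_series (Complex v y) n))) \<longlonglongrightarrow> ln (cmod (rGamma (Complex v y)))" for v
  proof (intro tendsto_ln tendsto_norm rGamma_series_LIMSEQ)
    have "Complex v y \<notin> \<int>\<^sub>\<le>\<^sub>0" using y by (auto simp: complex_eq_iff elim!: nonpos_Ints_cases)
    then show "cmod (rGamma (Complex v y)) \<noteq> 0" by (simp add: rGamma_eq_zero_iff)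
  qed
  define D where "D = (\<lambda>n. ln (cmod (rGamma_series (Complex x y) n)) -
     ((1 - x) * ln (cmod (rGamma_series (Complex 0 y) n)) + x * ln (cmod (rGamma_series (Complex 1 y) n))))"
  \<comment> \<open>\<open>D n\<close> is the interpolation error of the \<open>n\<close>-th partial product\<close>
  have "D \<longlonglongrightarrow> ln (cmod (rGamma (Complex x y))) -
           ((1 - x) * ln (cmod (rGamma (Complex 0 y))) + x * ln (cmod (rGamma (Complex 1 y))))"
    unfolding D_def by (intro tendsto_intros lim)
  then have "(\<lambda>n. \<bar>D n\<bar>) \<longlonglongrightarrow> \<bar>ln (cmod (rGamma (Complex x y))) -
           ((1 - x) * ln (cmod (rGamma (Complex 0 y))) + x * ln (cmod (rGamma (Complex 1 y))))\<bar>"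
    by (rule tendsto_rabs)
  moreover have "\<bar>D n\<bar> \<le> 1 + pi\<^sup>2 / 6" if n: "n > 0" for n
  proof -
    have "D n = (\<Sum>k\<le>n. ln (cmod (Complex (real k + x) y)) -
       ((1 - x) * ln (cmod (Complex (real k) y)) + x * ln (cmod (Complex (real k + 1) y))))"
      unfolding D_def ln_cmod_rGamma_series[OF y n]
      by (simp add: sum_subtractf sum.distrib sum_distrib_left algebra_simps)
    also have "\<bar>\<dots>\<bar> \<le> (\<Sum>k\<le>n. 1 / ((real k)\<^sup>2 + y\<^sup>2))"
      by (intro order.trans[OF sum_abs] sum_mono ln_cmod_chord_error) (use assms y in auto)
    also have "\<dots> \<le> (\<Sum>k\<le>n. if k = 0 then 1 else 1 / (real k)\<^sup>2)"
    proof (intro sum_mono)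
      fix k assume "k \<in> {..n}"
      have "1 \<le> y\<^sup>2" using assms(3) by (metis abs_le_square_iff abs_one one_power2)
      then show "1 / ((real k)\<^sup>2 + y\<^sup>2) \<le> (if k = 0 then 1 else 1 / (real k)\<^sup>2)"
        using frac_le[of 1 1 "(real k)\<^sup>2" "(real k)\<^sup>2 + y\<^sup>2"]
        by (cases "k = 0") (auto simp: divide_le_eq)
    qed
    also have "\<dots> = 1 + (\<Sum>k<n. 1 / (real k + 1)\<^sup>2)"
      using n by (simp add: sum.atMost_shift add.commute)
    also have "(\<Sum>k<n. 1 / (real k + 1)\<^sup>2) \<le> pi\<^sup>2 / 6"
      using sum_le_suminf[OF sums_summable[OF inverse_squares_sums], of "{..<n}"]
        sums_unique[OF inverse_squares_sums] by (simp add: add.commute)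
    finally show ?thesis by simp
  qed
  then have "eventually (\<lambda>n. \<bar>D n\<bar> \<le> 1 + pi\<^sup>2 / 6) sequentially"
    using eventually_gt_at_top[of 0] by (rule eventually_mono[rotated])
  ultimately show ?thesis
    by (rule tendsto_upperbound) simp
qed

text \<open>The reflection formula at \<open>z = \<i> y\<close>, where \<open>\<Gamma> (- z)\<close> is the conjugate of \<open>\<Gamma> z\<close>.\<close>

lemma cmod_rGamma_imaginary:
  assumes "y \<noteq> 0"
  shows "(cmod (rGamma (Complex 0 y)))\<^sup>2 = \<bar>y\<bar> * sinh (pi * \<bar>y\<bar>) / pi"
proof -
  have "(cmod (rGamma (Complex 0 y)))\<^sup>2 = cmod (rGamma (Complex 0 y) * rGamma (- Complex 0 y))"
  proof -
    have "rGamma (- Complex 0 y) = cnj (rGamma (Complex 0 y))"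
      using arg_cong[of "- Complex 0 y" "Complex 0 (- y)" rGamma]
      by (simp add: cnj_rGamma complex_cnj complex_eq_iff)
    then show ?thesis by (simp add: norm_mult power2_eq_square)
  qed
  also have "\<dots> = cmod (Complex 0 y) * cmod (sin (of_real pi * Complex 0 y)) / pi"
    unfolding rGamma_reflection_complex' by (simp add: norm_mult norm_divide)
  also have "of_real pi * Complex 0 y = \<i> * of_real (pi * y)" by (simp add: complex_eq_iff)
  also have "cmod (sin (\<i> * of_real (pi * y))) = \<bar>sinh (pi * y)\<bar>"
  proof -
    have "sin (\<i> * of_real (pi * y)) = \<i> * of_real (sinh (pi * y))"
      unfolding sin_i_times sinh_field_def exp_minus by (simp add: exp_of_real flip: of_real_mult)
    then show ?thesis by (simp add: norm_mult)
  qed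
  also have "\<dots> = sinh (pi * \<bar>y\<bar>)"
    by (cases "y \<ge> 0") (auto simp: mult_nonneg_nonneg abs_of_nonneg abs_of_neg mult_pos_neg)
  also have "cmod (Complex 0 y) = \<bar>y\<bar>" by (simp add: cmod_def)
  finally show ?thesis .
qed

lemma ln_sinh_bounds:
  assumes "t \<ge> (1::real)"
  shows "\<bar>ln (sinh t) - t\<bar> \<le> ln 4"
proof -
  have "1 + 1 \<le> 1 + t" using assms by simp
  also have "\<dots> \<le> exp t" by (rule exp_ge_add_one_self)
  finally have e2: "exp t \<ge> 2" by simp
  have "exp (-t) \<le> exp 0" using assms by (subst exp_le_cancel_iff) simp
  then have "exp (-t) \<le> 1" by (simp only: exp_zero)
  then have e: "exp (-t) \<le> exp t / 2" using e2 by linarith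
  have s: "sinh t = (exp t - exp (-t)) / 2" by (simp add: sinh_field_def)
  have gen: "a / 4 \<le> (a - b) / 2 \<and> (a - b) / 2 \<le> a" if "b \<le> a / 2" "b > 0" "a > 0" for a b :: real
    using that by (simp add: field_simps)
  have lo: "exp t / 4 \<le> sinh t" and up: "sinh t \<le> exp t"
    using gen[OF e] unfolding s by simp_all
  have "sinh t > 0" using lo exp_gt_zero[of t] by linarith
  have "ln (exp t / 4) \<le> ln (sinh t)" using lo \<open>sinh t > 0\<close> by (subst ln_le_cancel_iff) auto
  moreover have "ln (sinh t) \<le> ln (exp t)" using up \<open>sinh t > 0\<close> by (subst ln_le_cancel_iff) auto
  moreover have "ln (exp t / 4) = t - ln 4" by (simp add: ln_div)
  moreover have "ln 4 \<ge> (0::real)" by simp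
  ultimately show ?thesis by (simp add: abs_le_iff)
qed

lemma ln_abs_vs_ln_1_plus_abs:
  assumes "1 \<le> \<bar>y::real\<bar>"
  shows "\<bar>ln \<bar>y\<bar> - ln (1 + \<bar>y\<bar>)\<bar> \<le> ln 2"
proof -
  have "ln (1 + \<bar>y\<bar>) \<le> ln (2 * \<bar>y\<bar>)" using assms by (subst ln_le_cancel_iff) auto
  moreover have "ln (2 * \<bar>y\<bar>) = ln 2 + ln \<bar>y\<bar>" using assms by (subst ln_mult) auto
  moreover have "ln \<bar>y\<bar> \<le> ln (1 + \<bar>y\<bar>)" using assms by (subst ln_le_cancel_iff) auto
  ultimately show ?thesis by (simp add: abs_le_iff)
qed

text \<open>The modulus on \<open>Re z = 0\<close> is known exactly, the functional equation gives it on \<open>Re z = 1\<close>, and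
  interpolation between the two lines has a bounded error.\<close>

lemma rGamma_line_estimate_strip:
  assumes x: "0 \<le> x" "x \<le> 1"
  shows "rGamma_line_estimate x"
  unfolding rGamma_line_estimate_def
proof (intro exI allI impI)
  fix y :: real assume y1: "1 \<le> \<bar>y\<bar>"
  then have y: "y \<noteq> 0" by auto
  define L where "L = ln (cmod (rGamma (Complex 0 y)))"
  have py: "pi * \<bar>y\<bar> \<ge> 1" using mult_mono[of 1 pi 1 "\<bar>y\<bar>"] y1 pi_gt3 by auto
  then have sp: "sinh (pi * \<bar>y\<bar>) > 0" by simp
  have nz: "Complex v y \<notin> \<int>\<^sub>\<le>\<^sub>0" for v using y by (auto simp: complex_eq_iff elim!: nonpos_Ints_cases)
  have "2 * L = ln ((cmod (rGamma (Complex 0 y)))\<^sup>2)"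
    using nz[of 0] unfolding L_def by (simp add: ln_realpow rGamma_eq_zero_iff)
  also have "\<dots> = ln \<bar>y\<bar> + ln (sinh (pi * \<bar>y\<bar>)) - ln pi"
    unfolding cmod_rGamma_imaginary[OF y] using y sp by (simp add: ln_mult ln_div)
  finally have L: "2 * L = ln \<bar>y\<bar> + ln (sinh (pi * \<bar>y\<bar>)) - ln pi" .
  have L1: "ln (cmod (rGamma (Complex 1 y))) = L - ln \<bar>y\<bar>"
  proof -
    have "Complex 0 y * rGamma (Complex 0 y + 1) = rGamma (Complex 0 y)" by (rule rGamma_plus1)
    moreover have "Complex 0 y + 1 = Complex 1 y" by (simp add: complex_eq_iff)
    ultimately have "rGamma (Complex 0 y) = Complex 0 y * rGamma (Complex 1 y)" by simp
    then have "cmod (rGamma (Complex 0 y)) = \<bar>y\<bar> * cmod (rGamma (Complex 1 y))"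
    proof -
      have "cmod (Complex 0 y) = \<bar>y\<bar>" by (simp add: cmod_def)
      then show ?thesis using \<open>rGamma (Complex 0 y) = _\<close> by (simp only: norm_mult)
    qed
    then show ?thesis using y nz[of 1] unfolding L_def by (simp add: ln_mult rGamma_eq_zero_iff)
  qed
  have 1: "\<bar>ln (cmod (rGamma (Complex x y))) - (L - x * ln \<bar>y\<bar>)\<bar> \<le> 1 + pi\<^sup>2 / 6"
    using rGamma_interpolation_error[OF x y1] L1 L_def[symmetric] by (simp add: algebra_simps)
  have 2: "\<bar>ln (sinh (pi * \<bar>y\<bar>)) - pi * \<bar>y\<bar>\<bar> \<le> ln 4" by (rule ln_sinh_bounds[OF py])
  have 3: "\<bar>(1/2 - x) * (ln \<bar>y\<bar> - ln (1 + \<bar>y\<bar>))\<bar> \<le> \<bar>1/2 - x\<bar> * ln 2"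
    unfolding abs_mult by (intro mult_left_mono ln_abs_vs_ln_1_plus_abs y1) auto
  have eq: "ln (cmod (rGamma (Complex x y))) - ((1/2 - x) * ln (1 + \<bar>y\<bar>) + pi * \<bar>y\<bar> / 2) =
    (ln (cmod (rGamma (Complex x y))) - (L - x * ln \<bar>y\<bar>)) +
    (ln (sinh (pi * \<bar>y\<bar>)) - pi * \<bar>y\<bar>) / 2 - ln pi / 2 + (1/2 - x) * (ln \<bar>y\<bar> - ln (1 + \<bar>y\<bar>))"
  proof -
    have "G - ((1/2 - x) * t + P / 2) = (G - (L - x * l)) + (S - P) / 2 - q / 2 + (1/2 - x) * (l - t)"
      if "2 * L = l + S - q" for G t P l S q :: real
    proof -
      have "L = (l + S - q) / 2" using that by simp
      then show ?thesis by (simp add: field_simps)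
    qed
    from this[OF L] show ?thesis .
  qed
  have lnpi: "ln pi \<ge> 0" using pi_gt3 by simp
  show "\<bar>ln (cmod (rGamma (Complex x y))) - ((1/2 - x) * ln (1 + \<bar>y\<bar>) + pi * \<bar>y\<bar> / 2)\<bar>
    \<le> (1 + pi\<^sup>2 / 6) + ln 4 + ln pi + \<bar>1/2 - x\<bar> * ln 2"
  proof -
    have gen: "\<bar>T\<bar> \<le> a + b + l + c" if "T = P + Q / 2 - l / 2 + R" "\<bar>P\<bar> \<le> a" "\<bar>Q\<bar> \<le> b" "\<bar>R\<bar> \<le> c" "l \<ge> 0"
      for T P Q R a b c l :: real
      using that unfolding abs_le_iff by auto
    show ?thesis by (rule gen) (fact eq 1 2 3 lnpi)+
  qed
qed

lemma rGamma_line_estimate_shift: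
  "rGamma_line_estimate x \<longleftrightarrow> rGamma_line_estimate (x + 1)"
proof -
  have key: "\<bar>(ln (cmod (rGamma (Complex x y))) - ((1/2 - x) * ln (1 + \<bar>y\<bar>) + pi * \<bar>y\<bar> / 2)) -
    (ln (cmod (rGamma (Complex (x+1) y))) - ((1/2 - (x+1)) * ln (1 + \<bar>y\<bar>) + pi * \<bar>y\<bar> / 2))\<bar>
    \<le> ln 2 + ln (1 + \<bar>x\<bar>)" if y1: "1 \<le> \<bar>y\<bar>" for y
  proof -
    define z where "z = Complex x y"
    have y: "y \<noteq> 0" using y1 by auto
    have nz: "Complex v y \<notin> \<int>\<^sub>\<le>\<^sub>0" for v using y by (auto simp: complex_eq_iff elim!: nonpos_Ints_cases)
    have "z * rGamma (z + 1) = rGamma z" by (rule rGamma_plus1)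
    moreover have "z + 1 = Complex (x+1) y" by (simp add: z_def complex_eq_iff)
    ultimately have "rGamma z = z * rGamma (Complex (x+1) y)" by simp
    then have "cmod (rGamma z) = cmod z * cmod (rGamma (Complex (x+1) y))"
      by (simp add: norm_mult)
    then have "ln (cmod (rGamma z)) = ln (cmod z) + ln (cmod (rGamma (Complex (x+1) y)))"
    proof -
      have "rGamma (Complex (x+1) y) \<noteq> 0" using nz by (simp add: rGamma_eq_zero_iff)
      moreover have "z \<noteq> 0" using y by (simp add: z_def complex_eq_iff)
      ultimately show ?thesis using \<open>cmod (rGamma z) = _\<close> by (simp add: ln_mult)
    qed
    moreover have "\<bar>ln (cmod z) - ln (1 + \<bar>y\<bar>)\<bar> \<le> ln 2 + ln (1 + \<bar>x\<bar>)"
    proof -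
      have lo: "\<bar>y\<bar> \<le> cmod z" using abs_Im_le_cmod[of z] by (simp add: z_def)
      have "cmod z \<le> \<bar>x\<bar> + \<bar>y\<bar>" using cmod_le[of z] by (simp add: z_def)
      also have "\<dots> \<le> (1 + \<bar>x\<bar>) * (1 + \<bar>y\<bar>)" by (simp add: algebra_simps)
      finally have "ln (cmod z) \<le> ln ((1 + \<bar>x\<bar>) * (1 + \<bar>y\<bar>))"
        using lo y by (subst ln_le_cancel_iff) (auto intro!: mult_pos_pos simp: add_pos_nonneg)
      also have "\<dots> = ln (1 + \<bar>x\<bar>) + ln (1 + \<bar>y\<bar>)" by (subst ln_mult) (auto simp: add_pos_nonneg)
      finally have "ln (cmod z) \<le> ln (1 + \<bar>x\<bar>) + ln (1 + \<bar>y\<bar>)" .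
      moreover have "ln \<bar>y\<bar> \<le> ln (cmod z)" using lo y by (subst ln_le_cancel_iff) auto
      moreover have "ln (1 + \<bar>x\<bar>) \<ge> 0" by simp
      moreover have "ln 2 > (0::real)" by simp
      ultimately show ?thesis using ln_abs_vs_ln_1_plus_abs[OF y1] by linarith
    qed
    ultimately show ?thesis by (simp add: algebra_simps z_def)
  qed
  define A where "A = (\<lambda>x y. ln (cmod (rGamma (Complex x y))) - ((1/2 - x) * ln (1 + \<bar>y\<bar>) + pi * \<bar>y\<bar> / 2))"
  have key': "\<bar>A x y - A (x+1) y\<bar> \<le> ln 2 + ln (1 + \<bar>x\<bar>)" if "1 \<le> \<bar>y\<bar>" for y
    using key[OF that] by (simp add: A_def)
  have "(\<exists>C. \<forall>y. 1 \<le> \<bar>y\<bar> \<longrightarrow> \<bar>A x y\<bar> \<le> C) \<longleftrightarrow> (\<exists>C. \<forall>y. 1 \<le> \<bar>y\<bar> \<longrightarrow> \<bar>A (x+1) y\<bar> \<le> C)"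
  proof (intro iffI; elim exE)
    fix C assume "\<forall>y. 1 \<le> \<bar>y\<bar> \<longrightarrow> \<bar>A x y\<bar> \<le> C"
    then have "\<bar>A (x+1) y\<bar> \<le> C + (ln 2 + ln (1 + \<bar>x\<bar>))" if "1 \<le> \<bar>y\<bar>" for y
      using key'[OF that] that by (smt (verit))
    then show "\<exists>C. \<forall>y. 1 \<le> \<bar>y\<bar> \<longrightarrow> \<bar>A (x+1) y\<bar> \<le> C" by blast
  next
    fix C assume "\<forall>y. 1 \<le> \<bar>y\<bar> \<longrightarrow> \<bar>A (x+1) y\<bar> \<le> C"
    then have "\<bar>A x y\<bar> \<le> C + (ln 2 + ln (1 + \<bar>x\<bar>))" if "1 \<le> \<bar>y\<bar>" for y
      using key'[OF that] that by (smt (verit))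
    then show "\<exists>C. \<forall>y. 1 \<le> \<bar>y\<bar> \<longrightarrow> \<bar>A x y\<bar> \<le> C" by blast
  qed
  then show ?thesis unfolding rGamma_line_estimate_def A_def .
qed

lemma rGamma_line_estimate: "rGamma_line_estimate x"
proof -
  have nat_shift: "rGamma_line_estimate x \<longleftrightarrow> rGamma_line_estimate (x + real n)" for x n
  proof (induction n)
    case (Suc n)
    then show ?case using rGamma_line_estimate_shift[of "x + real n"] by (simp add: add_ac)
  qed simp
  have strip: "rGamma_line_estimate (frac x)"
    using frac_lt_1[of x] by (intro rGamma_line_estimate_strip) auto
  show ?thesis
  proof (cases "\<lfloor>x\<rfloor> \<ge> 0")
    case True
    then have "frac x + real (nat \<lfloor>x\<rfloor>) = x" by (simp add: frac_def)
    then show ?thesis using strip nat_shift[of "frac x" "nat \<lfloor>x\<rfloor>"] by simp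
  next
    case False
    then have "x + real (nat (- \<lfloor>x\<rfloor>)) = frac x" by (simp add: frac_def)
    then show ?thesis using strip nat_shift[of x "nat (- \<lfloor>x\<rfloor>)"] by simp
  qed
qed

lemma continuous_bounded_outside_imp_bounded:
  fixes h :: "real \<Rightarrow> real"
  assumes "continuous_on UNIV h" "\<And>y. 1 \<le> \<bar>y\<bar> \<Longrightarrow> h y \<le> C"
  shows "\<exists>C. \<forall>y. h y \<le> C"
proof -
  have "compact (h ` {-1..1})"
    using assms(1) by (intro compact_continuous_image) (auto intro: continuous_on_subset)
  then have "bdd_above (h ` {-1..1})" by (intro bounded_imp_bdd_above compact_imp_bounded)
  then obtain D where "\<forall>u \<in> h ` {-1..1}. u \<le> D" unfolding bdd_above_def by blast
  then have D: "\<And>y. y \<in> {-1..1} \<Longrightarrow> h y \<le> D" by blast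
  have "h y \<le> max C D" for y
  proof (cases "1 \<le> \<bar>y\<bar>")
    case False
    then have "y \<in> {-1..1}" by auto
    then show ?thesis using D by (auto simp: le_max_iff_disj)
  qed (use assms(2) in \<open>auto simp: le_max_iff_disj\<close>)
  then show ?thesis by blast
qed

lemma continuous_on_Complex [continuous_intros]:
  "continuous_on S f \<Longrightarrow> continuous_on S g \<Longrightarrow> continuous_on S (\<lambda>t. Complex (f t) (g t))"
  unfolding Complex_eq by (intro continuous_intros)

text \<open>The logarithmic estimates hold for \<open>\<bar>y\<bar> \<ge> 1\<close>; continuity extends the bounds to all \<open>y\<close>.\<close>

lemma bounded_by_weight_if_logs_close:
  fixes h W :: "real \<Rightarrow> real"
  assumes cont: "continuous_on UNIV h" "continuous_on UNIV W" and W: "\<And>y. W y > 0"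
    and C: "\<And>y. 1 \<le> \<bar>y\<bar> \<Longrightarrow> h y > 0 \<and> ln (h y) - ln (W y) \<le> C"
  shows "\<exists>C. \<forall>y. h y \<le> C * W y"
proof -
  have "\<exists>D. \<forall>y. h y / W y \<le> D"
  proof (rule continuous_bounded_outside_imp_bounded)
    show "continuous_on UNIV (\<lambda>y. h y / W y)"
      using W by (intro continuous_on_divide cont) (metis less_irrefl)
    fix y :: real assume y: "1 \<le> \<bar>y\<bar>"
    have "h y / W y = exp (ln (h y) - ln (W y))" using C[OF y] W by (simp add: exp_diff)
    also have "\<dots> \<le> exp C" using C[OF y] by simp
    finally show "h y / W y \<le> exp C" .
  qed
  then show ?thesis using W by (auto simp: divide_le_eq)
qed

lemma rGamma_vertical_bound:
  "\<exists>C. \<forall>y. cmod (rGamma (Complex x y)) \<le> C * ((1 + \<bar>y\<bar>) powr (1/2 - x) * exp (pi * \<bar>y\<bar> / 2))"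
proof -
  obtain C where C: "\<And>y. 1 \<le> \<bar>y\<bar> \<Longrightarrow>
      \<bar>ln (cmod (rGamma (Complex x y))) - ((1/2 - x) * ln (1 + \<bar>y\<bar>) + pi * \<bar>y\<bar> / 2)\<bar> \<le> C"
    using rGamma_line_estimate[of x] unfolding rGamma_line_estimate_def by blast
  show ?thesis
  proof (rule bounded_by_weight_if_logs_close)
    have "continuous_on UNIV (\<lambda>y. rGamma (Complex x y))"
      by (intro continuous_on_compose2[OF continuous_on_rGamma[of UNIV]] continuous_intros) auto
    then show "continuous_on UNIV (\<lambda>y. cmod (rGamma (Complex x y)))" by (intro continuous_intros)
    show "continuous_on UNIV (\<lambda>y. (1 + \<bar>y\<bar>) powr (1/2 - x) * exp (pi * \<bar>y\<bar> / 2))"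
      by (intro continuous_intros) (auto simp: add_nonneg_eq_0_iff)
    fix y :: real assume y: "1 \<le> \<bar>y\<bar>"
    then have "Complex x y \<notin> \<int>\<^sub>\<le>\<^sub>0" by (auto simp: complex_eq_iff elim!: nonpos_Ints_cases)
    then show "cmod (rGamma (Complex x y)) > 0 \<and>
        ln (cmod (rGamma (Complex x y))) - ln ((1 + \<bar>y\<bar>) powr (1/2 - x) * exp (pi * \<bar>y\<bar> / 2)) \<le> C"
      using abs_le_D1[OF C[OF y]] by (simp add: rGamma_eq_zero_iff ln_mult ln_powr)
  qed simp
qed

lemma Gamma_vertical_bound:
  assumes "complex_of_real x \<notin> \<int>\<^sub>\<le>\<^sub>0"
  shows "\<exists>C. \<forall>y. cmod (Gamma (Complex x y)) \<le> C * ((1 + \<bar>y\<bar>) powr (x - 1/2) * exp (- (pi * \<bar>y\<bar> / 2)))"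
proof -
  obtain C where C: "\<And>y. 1 \<le> \<bar>y\<bar> \<Longrightarrow>
      \<bar>ln (cmod (rGamma (Complex x y))) - ((1/2 - x) * ln (1 + \<bar>y\<bar>) + pi * \<bar>y\<bar> / 2)\<bar> \<le> C"
    using rGamma_line_estimate[of x] unfolding rGamma_line_estimate_def by blast
  have np: "Complex x y \<notin> \<int>\<^sub>\<le>\<^sub>0" for y
    using assms by (auto simp: complex_eq_iff elim!: nonpos_Ints_cases) (metis nonpos_Ints_of_int of_real_of_int_eq)
  show ?thesis
  proof (rule bounded_by_weight_if_logs_close)
    have "continuous_on UNIV (\<lambda>y. Gamma (Complex x y))"
      by (intro continuous_on_compose2[OF continuous_on_Gamma[of "- \<int>\<^sub>\<le>\<^sub>0"]] continuous_intros) (use np in auto)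
    then show "continuous_on UNIV (\<lambda>y. cmod (Gamma (Complex x y)))" by (intro continuous_intros)
    show "continuous_on UNIV (\<lambda>y. (1 + \<bar>y\<bar>) powr (x - 1/2) * exp (- (pi * \<bar>y\<bar> / 2)))"
      by (intro continuous_intros) (auto simp: add_nonneg_eq_0_iff)
    fix y :: real assume y: "1 \<le> \<bar>y\<bar>"
    have p: "cmod (Gamma (Complex x y)) > 0" using np by (simp add: Gamma_eq_zero_iff)
    have "ln (cmod (Gamma (Complex x y))) = - ln (cmod (rGamma (Complex x y)))"
      using p by (simp add: rGamma_inverse_Gamma norm_inverse ln_inverse)
    moreover have "ln ((1 + \<bar>y\<bar>) powr (x - 1/2) * exp (- (pi * \<bar>y\<bar> / 2))) =
        - ((1/2 - x) * ln (1 + \<bar>y\<bar>) + pi * \<bar>y\<bar> / 2)"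
    proof -
      have "1 + \<bar>y\<bar> \<noteq> 0" by linarith
      then show ?thesis by (simp add: ln_mult ln_powr algebra_simps)
    qed
    ultimately show "cmod (Gamma (Complex x y)) > 0 \<and>
        ln (cmod (Gamma (Complex x y))) - ln ((1 + \<bar>y\<bar>) powr (x - 1/2) * exp (- (pi * \<bar>y\<bar> / 2))) \<le> C"
      using abs_le_D2[OF C[OF y]] p by simp
  qed simp
qed

section \<open>Growth of the integrand of the I-function\<close>

text \<open>Both exponents are tracked because both are additive under products: summed over all Gamma
  factors of the integrand they give \<open>\<Omega>\<close> and \<open>- (\<pi> / 2) \<Delta>\<close>.\<close>

definition pow_exp_bounded :: "(real \<Rightarrow> complex) \<Rightarrow> real \<Rightarrow> real \<Rightarrow> bool" where
  "pow_exp_bounded g A E \<longleftrightarrow> (\<exists>C. \<forall>\<tau>. cmod (g \<tau>) \<le> C * ((1 + \<bar>\<tau>\<bar>) powr A * exp (E * \<bar>\<tau>\<bar>)))"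

lemma pow_exp_bounded_mult:
  assumes "pow_exp_bounded g A E" "pow_exp_bounded h A' E'"
  shows "pow_exp_bounded (\<lambda>\<tau>. g \<tau> * h \<tau>) (A + A') (E + E')"
proof -
  obtain C where C: "\<And>\<tau>. cmod (g \<tau>) \<le> C * ((1 + \<bar>\<tau>\<bar>) powr A * exp (E * \<bar>\<tau>\<bar>))"
    using assms(1) unfolding pow_exp_bounded_def by blast
  obtain D where D: "\<And>\<tau>. cmod (h \<tau>) \<le> D * ((1 + \<bar>\<tau>\<bar>) powr A' * exp (E' * \<bar>\<tau>\<bar>))"
    using assms(2) unfolding pow_exp_bounded_def by blast
  have "cmod (g \<tau> * h \<tau>) \<le> C * D * ((1 + \<bar>\<tau>\<bar>) powr (A + A') * exp ((E + E') * \<bar>\<tau>\<bar>))" for \<tau>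
  proof -
    have "cmod (g \<tau> * h \<tau>) \<le> (C * ((1 + \<bar>\<tau>\<bar>) powr A * exp (E * \<bar>\<tau>\<bar>))) * (D * ((1 + \<bar>\<tau>\<bar>) powr A' * exp (E' * \<bar>\<tau>\<bar>)))"
      unfolding norm_mult by (intro mult_mono C D) (auto intro: order.trans[OF norm_ge_zero C])
    also have "\<dots> = C * D * ((1 + \<bar>\<tau>\<bar>) powr (A + A') * exp ((E + E') * \<bar>\<tau>\<bar>))"
      by (simp add: powr_add exp_add ring_distribs mult_ac)
    finally show ?thesis .
  qed
  then show ?thesis unfolding pow_exp_bounded_def by blast
qed

lemma pow_exp_bounded_prod_list:
  assumes "\<And>x. x \<in> set xs \<Longrightarrow> pow_exp_bounded (g x) (A x) (E x)"
  shows "pow_exp_bounded (\<lambda>\<tau>. \<Prod>x\<leftarrow>xs. g x \<tau>) (\<Sum>x\<leftarrow>xs. A x) (\<Sum>x\<leftarrow>xs. E x)"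
  using assms
proof (induction xs)
  case Nil
  have "1 + \<bar>\<tau>\<bar> \<noteq> 0" for \<tau> :: real by linarith
  then show ?case unfolding pow_exp_bounded_def by (intro exI[of _ 1]) simp
next
  case (Cons x xs)
  have "pow_exp_bounded (\<lambda>\<tau>. g x \<tau> * (\<Prod>x\<leftarrow>xs. g x \<tau>)) (A x + (\<Sum>x\<leftarrow>xs. A x)) (E x + (\<Sum>x\<leftarrow>xs. E x))"
    by (intro pow_exp_bounded_mult Cons) (auto intro: Cons.prems)
  then show ?case by simp
qed

text \<open>Passes from the weight in the imaginary part \<open>v + d \<tau>\<close> of the argument of a Gamma factor to the
  weight in \<open>\<tau>\<close>, which is the same for all factors.\<close>

lemma weight_affine_change:
  fixes v d s e :: real
  assumes "d \<noteq> 0"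
  shows "\<exists>K. \<forall>\<tau>. (1 + \<bar>v + d * \<tau>\<bar>) powr s * exp (e * \<bar>v + d * \<tau>\<bar>)
                  \<le> K * ((1 + \<bar>\<tau>\<bar>) powr s * exp (e * \<bar>d\<bar> * \<bar>\<tau>\<bar>))"
proof -
  define M where "M = 1 + \<bar>v\<bar> + \<bar>d\<bar>"
  define M' where "M' = 1 + (1 + \<bar>v\<bar>) / \<bar>d\<bar>"
  have M: "1 + \<bar>v + d * \<tau>\<bar> \<le> M * (1 + \<bar>\<tau>\<bar>)" for \<tau>
  proof -
    have "\<bar>v + d * \<tau>\<bar> \<le> \<bar>v\<bar> + \<bar>d\<bar> * \<bar>\<tau>\<bar>" by (metis abs_mult abs_triangle_ineq)
    moreover have "\<bar>v\<bar> * \<bar>\<tau>\<bar> \<ge> 0" by simp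
    moreover have "\<bar>d\<bar> \<ge> 0" "\<bar>\<tau>\<bar> \<ge> 0" "M * (1 + \<bar>\<tau>\<bar>) = 1 + \<bar>v\<bar> + \<bar>d\<bar> + \<bar>\<tau>\<bar> + \<bar>v\<bar> * \<bar>\<tau>\<bar> + \<bar>d\<bar> * \<bar>\<tau>\<bar>"
      by (simp_all add: M_def algebra_simps)
    ultimately show ?thesis by linarith
  qed
  have M': "1 + \<bar>\<tau>\<bar> \<le> M' * (1 + \<bar>v + d * \<tau>\<bar>)" for \<tau>
  proof -
    define y where "y = v + d * \<tau>"
    have "\<bar>d\<bar> * \<bar>\<tau>\<bar> = \<bar>y - v\<bar>" by (simp add: y_def abs_mult)
    also have "\<dots> \<le> \<bar>y\<bar> + \<bar>v\<bar>" by (rule abs_triangle_ineq4)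
    also have "\<dots> \<le> (1 + \<bar>v\<bar>) * (1 + \<bar>y\<bar>)" by (simp add: algebra_simps)
    finally have "\<bar>\<tau>\<bar> \<le> (1 + \<bar>v\<bar>) * (1 + \<bar>y\<bar>) / \<bar>d\<bar>" using assms by (simp add: field_simps)
    moreover have "M' * (1 + \<bar>y\<bar>) = 1 + \<bar>y\<bar> + (1 + \<bar>v\<bar>) * (1 + \<bar>y\<bar>) / \<bar>d\<bar>"
      unfolding M'_def by (simp add: ring_distribs add_divide_distrib)
    ultimately show ?thesis unfolding y_def[symmetric] using abs_ge_zero[of y] by linarith
  qed
  have Mp: "M > 0" "M' > 0" by (auto simp: M_def M'_def add_pos_nonneg)
  have P: "(1 + \<bar>v + d * \<tau>\<bar>) powr s \<le> (M powr s + (1/M') powr s) * (1 + \<bar>\<tau>\<bar>) powr s" for \<tau>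
  proof (cases "s \<ge> 0")
    case True
    have "(1 + \<bar>v + d * \<tau>\<bar>) powr s \<le> (M * (1 + \<bar>\<tau>\<bar>)) powr s"
      by (rule powr_mono2) (use True M in auto)
    also have "\<dots> = M powr s * (1 + \<bar>\<tau>\<bar>) powr s" using Mp by (simp add: powr_mult)
    also have "\<dots> \<le> (M powr s + (1/M') powr s) * (1 + \<bar>\<tau>\<bar>) powr s" by (intro mult_right_mono) auto
    finally show ?thesis .
  next
    case False
    have "(1 + \<bar>v + d * \<tau>\<bar>) powr s \<le> (1/M' * (1 + \<bar>\<tau>\<bar>)) powr s"
      by (rule powr_mono2') (use False M'[of \<tau>] Mp in \<open>auto simp: field_simps add_pos_nonneg\<close>)
    also have "\<dots> = (1/M') powr s * (1 + \<bar>\<tau>\<bar>) powr s" using Mp by (subst powr_mult) auto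
    also have "\<dots> \<le> (M powr s + (1/M') powr s) * (1 + \<bar>\<tau>\<bar>) powr s" by (intro mult_right_mono) auto
    finally show ?thesis .
  qed
  have Q: "exp (e * \<bar>v + d * \<tau>\<bar>) \<le> exp (\<bar>e\<bar> * \<bar>v\<bar>) * exp (e * \<bar>d\<bar> * \<bar>\<tau>\<bar>)" for \<tau>
  proof -
    have "\<bar>\<bar>v + d * \<tau>\<bar> - \<bar>d\<bar> * \<bar>\<tau>\<bar>\<bar> \<le> \<bar>v\<bar>" using abs_triangle_ineq3[of "v + d * \<tau>" "d * \<tau>"] by (simp add: abs_mult)
    then have "\<bar>e\<bar> * \<bar>\<bar>v + d * \<tau>\<bar> - \<bar>d\<bar> * \<bar>\<tau>\<bar>\<bar> \<le> \<bar>e\<bar> * \<bar>v\<bar>" by (intro mult_left_mono) auto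
    moreover have "e * (\<bar>v + d * \<tau>\<bar> - \<bar>d\<bar> * \<bar>\<tau>\<bar>) \<le> \<bar>e\<bar> * \<bar>\<bar>v + d * \<tau>\<bar> - \<bar>d\<bar> * \<bar>\<tau>\<bar>\<bar>"
      using abs_ge_self[of "e * (\<bar>v + d * \<tau>\<bar> - \<bar>d\<bar> * \<bar>\<tau>\<bar>)"] by (simp only: abs_mult)
    ultimately have "e * (\<bar>v + d * \<tau>\<bar> - \<bar>d\<bar> * \<bar>\<tau>\<bar>) \<le> \<bar>e\<bar> * \<bar>v\<bar>" by (rule order.trans[rotated])
    then have "e * \<bar>v + d * \<tau>\<bar> \<le> \<bar>e\<bar> * \<bar>v\<bar> + e * \<bar>d\<bar> * \<bar>\<tau>\<bar>" by (simp add: algebra_simps)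
    then show ?thesis unfolding exp_add[symmetric] by simp
  qed
  have "(1 + \<bar>v + d * \<tau>\<bar>) powr s * exp (e * \<bar>v + d * \<tau>\<bar>)
      \<le> ((M powr s + (1/M') powr s) * exp (\<bar>e\<bar> * \<bar>v\<bar>)) * ((1 + \<bar>\<tau>\<bar>) powr s * exp (e * \<bar>d\<bar> * \<bar>\<tau>\<bar>))" for \<tau>
    using mult_mono[OF P[of \<tau>] Q[of \<tau>]] by (simp add: mult_ac)
  then show ?thesis by blast
qed

text \<open>The exponent is real, so branches differ by factors of modulus 1.\<close>

lemma cmod_Gamma_power_branch:
  assumes "Gamma_power_branch S \<kappa> w g" "s \<in> S" "w s \<notin> \<int>\<^sub>\<le>\<^sub>0"
  shows "cmod (g s) = cmod (Gamma (w s)) powr \<kappa>"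
proof -
  obtain l where l: "exp (l s) = Gamma (w s)" "g s = exp (complex_of_real \<kappa> * l s)"
    using assms unfolding Gamma_power_branch_def by blast
  have "cmod (Gamma (w s)) = exp (Re (l s))" by (simp flip: l(1))
  then show ?thesis using l(2) by (simp add: powr_def)
qed

lemma imag_axis_i: "\<i> * of_real \<tau> \<in> imag_axis"
  by (simp add: imag_axis_def)

lemma Gamma_argument_on_axis:
  "c + complex_of_real d * (\<i> * of_real \<tau>) = Complex (Re c) (Im c + d * \<tau>)"
  by (simp add: complex_eq_iff)

lemma pow_exp_bounded_powr_affine:
  assumes "d \<noteq> 0" "\<kappa> > 0"
    and C: "\<And>y. h y \<le> C * ((1 + \<bar>y\<bar>) powr s * exp (e * \<bar>y\<bar>))"
    and h0: "\<And>y. h y \<ge> 0"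
    and g: "\<And>\<tau>. cmod (g \<tau>) \<le> h (v + d * \<tau>) powr \<kappa>"
  shows "pow_exp_bounded g (s * \<kappa>) (e * \<bar>d\<bar> * \<kappa>)"
proof -
  obtain K where K: "\<And>\<tau>. (1 + \<bar>v + d * \<tau>\<bar>) powr (s * \<kappa>) * exp (e * \<kappa> * \<bar>v + d * \<tau>\<bar>)
                  \<le> K * ((1 + \<bar>\<tau>\<bar>) powr (s * \<kappa>) * exp (e * \<kappa> * \<bar>d\<bar> * \<bar>\<tau>\<bar>))"
    using weight_affine_change[OF assms(1)] by blast
  have C0: "C \<ge> 0" using order.trans[OF h0 C[of 0]] by simp
  have "cmod (g \<tau>) \<le> (C powr \<kappa> * K) * ((1 + \<bar>\<tau>\<bar>) powr (s * \<kappa>) * exp (e * \<bar>d\<bar> * \<kappa> * \<bar>\<tau>\<bar>))" for \<tau>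
  proof -
    let ?y = "v + d * \<tau>"
    have "cmod (g \<tau>) \<le> (C * ((1 + \<bar>?y\<bar>) powr s * exp (e * \<bar>?y\<bar>))) powr \<kappa>"
      by (rule order.trans[OF g]) (intro powr_mono2 C h0, use assms in auto)
    also have "\<dots> = C powr \<kappa> * ((1 + \<bar>?y\<bar>) powr (s * \<kappa>) * exp (e * \<kappa> * \<bar>?y\<bar>))"
      using C0 by (simp add: powr_mult powr_powr exp_powr_real mult_ac)
    also have "\<dots> \<le> C powr \<kappa> * (K * ((1 + \<bar>\<tau>\<bar>) powr (s * \<kappa>) * exp (e * \<kappa> * \<bar>d\<bar> * \<bar>\<tau>\<bar>)))"
      by (intro mult_left_mono K) auto
    finally show ?thesis by (simp add: mult_ac)
  qed
  then show ?thesis unfolding pow_exp_bounded_def by blast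
qed

lemma Gamma_power_bounded:
  assumes G: "Gamma_power_family G" and "d \<noteq> 0" "\<kappa> > 0"
    and np: "\<And>s. Re s = 0 \<Longrightarrow> c + complex_of_real d * s \<notin> \<int>\<^sub>\<le>\<^sub>0"
  shows "pow_exp_bounded (\<lambda>\<tau>. G c d \<kappa> (\<i> * of_real \<tau>))
           ((Re c - 1/2) * \<kappa>) (- (pi / 2) * \<bar>d\<bar> * \<kappa>)"
proof -
  have br: "Gamma_power_branch imag_axis \<kappa> (\<lambda>s. c + complex_of_real d * s) (G c d \<kappa>)"
    using assms unfolding Gamma_power_family_def by blast
  have "complex_of_real (Re c) \<notin> \<int>\<^sub>\<le>\<^sub>0"
    using np[of "\<i> * of_real (- Im c / d)"] \<open>d \<noteq> 0\<close>
    unfolding Gamma_argument_on_axis by (simp add: complex_of_real_def)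
  from Gamma_vertical_bound[OF this] obtain C where
    C: "\<And>y. cmod (Gamma (Complex (Re c) y)) \<le> C * ((1 + \<bar>y\<bar>) powr (Re c - 1/2) * exp (- (pi * \<bar>y\<bar> / 2)))"
    by blast
  show ?thesis
  proof (rule pow_exp_bounded_powr_affine[where v = "Im c"])
    show "cmod (Gamma (Complex (Re c) y)) \<le> C * ((1 + \<bar>y\<bar>) powr (Re c - 1/2) * exp (- (pi / 2) * \<bar>y\<bar>))" for y
      using C[of y] by simp
    show "cmod (G c d \<kappa> (\<i> * of_real \<tau>)) \<le> cmod (Gamma (Complex (Re c) (Im c + d * \<tau>))) powr \<kappa>" for \<tau>
      using cmod_Gamma_power_branch[OF br imag_axis_i, of \<tau>] np[of "\<i> * of_real \<tau>"]
      by (simp add: Gamma_argument_on_axis)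
  qed (use assms in auto)
qed

text \<open>Poles on the contour do no harm to a denominator: the branch has the value 0 there, whose inverse
  is 0, just as \<open>1 / \<Gamma>\<close> vanishes at a pole of \<open>\<Gamma>\<close>.\<close>

lemma inverse_Gamma_power_bounded:
  assumes G: "Gamma_power_family G" and "d \<noteq> 0" "\<kappa> > 0"
  shows "pow_exp_bounded (\<lambda>\<tau>. inverse (G c d \<kappa> (\<i> * of_real \<tau>)))
           ((1/2 - Re c) * \<kappa>) ((pi / 2) * \<bar>d\<bar> * \<kappa>)"
proof -
  have br: "Gamma_power_branch imag_axis \<kappa> (\<lambda>s. c + complex_of_real d * s) (G c d \<kappa>)"
    using assms unfolding Gamma_power_family_def by blast
  obtain C where
    C: "\<And>y. cmod (rGamma (Complex (Re c) y)) \<le> C * ((1 + \<bar>y\<bar>) powr (1/2 - Re c) * exp (pi * \<bar>y\<bar> / 2))"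
    using rGamma_vertical_bound[of "Re c"] by blast
  show ?thesis
  proof (rule pow_exp_bounded_powr_affine[where v = "Im c"])
    show "cmod (rGamma (Complex (Re c) y)) \<le> C * ((1 + \<bar>y\<bar>) powr (1/2 - Re c) * exp ((pi / 2) * \<bar>y\<bar>))" for y
      using C[of y] by simp
    show "cmod (inverse (G c d \<kappa> (\<i> * of_real \<tau>))) \<le> cmod (rGamma (Complex (Re c) (Im c + d * \<tau>))) powr \<kappa>" for \<tau>
    proof (cases "Complex (Re c) (Im c + d * \<tau>) \<in> \<int>\<^sub>\<le>\<^sub>0")
      case True
      then have "G c d \<kappa> (\<i> * of_real \<tau>) = 0"
        using br imag_axis_i[of \<tau>] unfolding Gamma_power_branch_def Gamma_argument_on_axis[symmetric] by blast
      then show ?thesis by simp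
    next
      case False
      then show ?thesis
        using cmod_Gamma_power_branch[OF br imag_axis_i, of \<tau>]
        by (simp add: Gamma_argument_on_axis norm_inverse rGamma_inverse_Gamma inverse_powr)
    qed
  qed (use assms in auto)
qed

lemma inverse_prod_list: "inverse (\<Prod>x\<leftarrow>xs. g x) = (\<Prod>x\<leftarrow>xs. inverse (g x :: 'a :: field))"
  by (induction xs) auto

lemma sum_list_take_drop: "(\<Sum>x\<leftarrow>take m xs. g x) + (\<Sum>x\<leftarrow>drop m xs. g x) = (\<Sum>x\<leftarrow>xs. g x :: real)"
  by (metis append_take_drop_id map_append sum_list_append)

lemma pow_exp_bounded_cong:
  assumes "pow_exp_bounded g A E" "A = A'" "E = E'" shows "pow_exp_bounded g A' E'"
  using assms by simp

lemma I_chi_bounded: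
  assumes G: "Gamma_power_family G" and par: "I_parameters m n U L" and sep: "I_separated 0 m n U L"
  shows "pow_exp_bounded (\<lambda>\<tau>. I_chi G m n U L (\<i> * of_real \<tau>))
           (I_Omega U L) (- (pi / 2) * I_Delta m n U L)"
proof -
  have pL: "B > 0 \<and> \<kappa> > 0" if "(b, B, \<kappa>) \<in> set L" for b B \<kappa>
    using par that unfolding I_parameters_def by auto
  have pU: "A > 0 \<and> \<kappa> > 0" if "(a, A, \<kappa>) \<in> set U" for a A \<kappa>
    using par that unfolding I_parameters_def by auto
  note pLt = pL[OF in_set_takeD] and pLd = pL[OF in_set_dropD] and pUt = pU[OF in_set_takeD] and pUd = pU[OF in_set_dropD]
  have 1: "pow_exp_bounded (\<lambda>\<tau>. \<Prod>x\<leftarrow>take m L. case x of (b, B, \<kappa>) \<Rightarrow> G b B \<kappa> (\<i> * of_real \<tau>))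
    (\<Sum>x\<leftarrow>take m L. case x of (b, B, \<kappa>) \<Rightarrow> - ((1/2 - Re b) * \<kappa>))
    (\<Sum>x\<leftarrow>take m L. case x of (b, B, \<kappa>) \<Rightarrow> - (pi/2) * (\<kappa> * B))"
  proof (rule pow_exp_bounded_prod_list, clarify)
    fix b B \<kappa> assume x: "(b, B, \<kappa>) \<in> set (take m L)"
    have "b + complex_of_real B * s \<notin> \<int>\<^sub>\<le>\<^sub>0" if "Re s = 0" for s
      using bspec[OF conjunct1[OF sep[unfolded I_separated_def]] x] that by auto
    note bd = Gamma_power_bounded[OF G _ _ this, of \<kappa>]
    show "pow_exp_bounded (\<lambda>\<tau>. G b B \<kappa> (\<i> * of_real \<tau>)) (- ((1/2 - Re b) * \<kappa>)) (- (pi/2) * (\<kappa> * B))"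
      by (rule pow_exp_bounded_cong[OF bd]) (use pLt[OF x] in \<open>simp_all add: left_diff_distrib\<close>)
  qed
  have 2: "pow_exp_bounded (\<lambda>\<tau>. \<Prod>x\<leftarrow>take n U. case x of (a, A, \<kappa>) \<Rightarrow> G (1 - a) (- A) \<kappa> (\<i> * of_real \<tau>))
    (\<Sum>x\<leftarrow>take n U. case x of (a, A, \<kappa>) \<Rightarrow> (1/2 - Re a) * \<kappa>)
    (\<Sum>x\<leftarrow>take n U. case x of (a, A, \<kappa>) \<Rightarrow> - (pi/2) * (\<kappa> * A))"
  proof (rule pow_exp_bounded_prod_list, clarify)
    fix a A \<kappa> assume x: "(a, A, \<kappa>) \<in> set (take n U)"
    have "1 - a + complex_of_real (- A) * s \<notin> \<int>\<^sub>\<le>\<^sub>0" if "Re s = 0" for s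
      using bspec[OF conjunct2[OF sep[unfolded I_separated_def]] x] that by auto
    note bd = Gamma_power_bounded[OF G _ _ this, of \<kappa>]
    show "pow_exp_bounded (\<lambda>\<tau>. G (1 - a) (- A) \<kappa> (\<i> * of_real \<tau>)) ((1/2 - Re a) * \<kappa>) (- (pi/2) * (\<kappa> * A))"
      by (rule pow_exp_bounded_cong[OF bd]) (use pUt[OF x] in \<open>simp_all add: left_diff_distrib\<close>)
  qed
  have 3: "pow_exp_bounded (\<lambda>\<tau>. \<Prod>x\<leftarrow>drop m L. inverse (case x of (b, B, \<kappa>) \<Rightarrow> G (1 - b) (- B) \<kappa> (\<i> * of_real \<tau>)))
    (\<Sum>x\<leftarrow>drop m L. case x of (b, B, \<kappa>) \<Rightarrow> - ((1/2 - Re b) * \<kappa>))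
    (\<Sum>x\<leftarrow>drop m L. case x of (b, B, \<kappa>) \<Rightarrow> (pi/2) * (\<kappa> * B))"
  proof (rule pow_exp_bounded_prod_list, clarify)
    fix b B \<kappa> assume x: "(b, B, \<kappa>) \<in> set (drop m L)"
    note bd = inverse_Gamma_power_bounded[OF G, of "- B" \<kappa> "1 - b"]
    show "pow_exp_bounded (\<lambda>\<tau>. inverse (G (1 - b) (- B) \<kappa> (\<i> * of_real \<tau>))) (- ((1/2 - Re b) * \<kappa>)) ((pi/2) * (\<kappa> * B))"
      by (rule pow_exp_bounded_cong[OF bd]) (use pLd[OF x] in \<open>simp_all add: left_diff_distrib\<close>)
  qed
  have 4: "pow_exp_bounded (\<lambda>\<tau>. \<Prod>x\<leftarrow>drop n U. inverse (case x of (a, A, \<kappa>) \<Rightarrow> G a A \<kappa> (\<i> * of_real \<tau>)))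
    (\<Sum>x\<leftarrow>drop n U. case x of (a, A, \<kappa>) \<Rightarrow> (1/2 - Re a) * \<kappa>)
    (\<Sum>x\<leftarrow>drop n U. case x of (a, A, \<kappa>) \<Rightarrow> (pi/2) * (\<kappa> * A))"
  proof (rule pow_exp_bounded_prod_list, clarify)
    fix a A \<kappa> assume x: "(a, A, \<kappa>) \<in> set (drop n U)"
    note bd = inverse_Gamma_power_bounded[OF G, of A \<kappa> a]
    show "pow_exp_bounded (\<lambda>\<tau>. inverse (G a A \<kappa> (\<i> * of_real \<tau>))) ((1/2 - Re a) * \<kappa>) ((pi/2) * (\<kappa> * A))"
      by (rule pow_exp_bounded_cong[OF bd]) (use pUd[OF x] in \<open>simp_all add: left_diff_distrib\<close>)
  qed
  note all = pow_exp_bounded_mult[OF pow_exp_bounded_mult[OF 1 2] pow_exp_bounded_mult[OF 3 4]]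
  have neg: "(\<Sum>x\<leftarrow>xs. case x of (b, B, \<kappa>) \<Rightarrow> - ((1/2 - Re b) * \<kappa>)) = - (\<Sum>(b, B, \<kappa>)\<leftarrow>xs. (1/2 - Re b) * \<kappa>)"
    for xs :: "triple list" by (induction xs) auto
  have scl: "(\<Sum>x\<leftarrow>xs. case x of (b, B, \<kappa>) \<Rightarrow> - (pi/2) * (\<kappa> * B)) = - (pi/2) * (\<Sum>(b, B, \<kappa>)\<leftarrow>xs. \<kappa> * B)"
    "(\<Sum>x\<leftarrow>xs. case x of (b, B, \<kappa>) \<Rightarrow> (pi/2) * (\<kappa> * B)) = (pi/2) * (\<Sum>(b, B, \<kappa>)\<leftarrow>xs. \<kappa> * B)"
    for xs :: "triple list" by (induction xs) (auto simp: algebra_simps)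
  have \<Omega>: "lt + ld = l \<Longrightarrow> ut + ud = u \<Longrightarrow> - lt + ut + (- ld + ud) = u - l" for lt ld l ut ud u :: real
    by simp
  have \<Delta>: "- p * a + - p * c + (p * b + p * d) = - p * (a - b + c - d)" for p a b c d :: real
    by (simp add: algebra_simps)
  have chi: "I_chi G m n U L s =
      (\<Prod>(b, B, \<kappa>)\<leftarrow>take m L. G b B \<kappa> s) * (\<Prod>(a, A, \<kappa>)\<leftarrow>take n U. G (1 - a) (- A) \<kappa> s) *
      ((\<Prod>x\<leftarrow>drop m L. inverse (case x of (b, B, \<kappa>) \<Rightarrow> G (1 - b) (- B) \<kappa> s)) *
       (\<Prod>x\<leftarrow>drop n U. inverse (case x of (a, A, \<kappa>) \<Rightarrow> G a A \<kappa> s)))" for s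
    unfolding I_chi_def inverse_prod_list[symmetric] divide_inverse inverse_mult_distrib ..
  show ?thesis
    unfolding chi
    by (rule pow_exp_bounded_cong[OF all])
       (unfold I_Omega_def I_Delta_def neg scl, rule \<Omega>[OF sum_list_take_drop sum_list_take_drop], rule \<Delta>)
qed

text \<open>Off the zeros of the entire function \<open>1 / \<Gamma>\<close> a branch is continuous; on them it vanishes.\<close>

lemma Gamma_power_measurable:
  assumes "Gamma_power_family G" "d \<noteq> 0" "\<kappa> > 0"
  shows "(\<lambda>\<tau>. G c d \<kappa> (\<i> * of_real \<tau>)) \<in> borel_measurable borel"
proof -
  let ?w = "\<lambda>s. c + complex_of_real d * s"
  have br: "Gamma_power_branch imag_axis \<kappa> ?w (G c d \<kappa>)"
    using assms unfolding Gamma_power_family_def by blast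
  then obtain l where cont: "continuous_on {s \<in> imag_axis. ?w s \<notin> \<int>\<^sub>\<le>\<^sub>0} l"
    and l: "\<And>s. s \<in> imag_axis \<Longrightarrow> ?w s \<notin> \<int>\<^sub>\<le>\<^sub>0 \<Longrightarrow> G c d \<kappa> s = exp (complex_of_real \<kappa> * l s)"
    and z: "\<And>s. s \<in> imag_axis \<Longrightarrow> ?w s \<in> \<int>\<^sub>\<le>\<^sub>0 \<Longrightarrow> G c d \<kappa> s = 0"
    unfolding Gamma_power_branch_def by blast
  define S where "S = {\<tau>::real. rGamma (?w (\<i> * of_real \<tau>)) \<noteq> 0}"
  have S: "\<tau> \<in> S \<longleftrightarrow> ?w (\<i> * of_real \<tau>) \<notin> \<int>\<^sub>\<le>\<^sub>0" for \<tau>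
    by (simp add: S_def rGamma_eq_zero_iff)
  have "open S" unfolding S_def
    by (intro open_Collect_neq continuous_on_compose2[OF continuous_on_rGamma[of UNIV]] continuous_intros) auto
  then have "S \<in> sets borel" by simp
  moreover have "continuous_on S (\<lambda>\<tau>. exp (complex_of_real \<kappa> * l (\<i> * of_real \<tau>)))"
    by (intro continuous_intros continuous_on_compose2[OF cont]) (auto simp: S imag_axis_i)
  ultimately have "(\<lambda>\<tau>. if \<tau> \<in> S then exp (complex_of_real \<kappa> * l (\<i> * of_real \<tau>)) else 0) \<in> borel_measurable borel"
    by (intro borel_measurable_continuous_on_if) auto
  moreover have "(\<lambda>\<tau>. G c d \<kappa> (\<i> * of_real \<tau>)) =
      (\<lambda>\<tau>. if \<tau> \<in> S then exp (complex_of_real \<kappa> * l (\<i> * of_real \<tau>)) else 0)"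
    by (intro ext) (auto simp: S l z imag_axis_i)
  ultimately show ?thesis by simp
qed

lemma borel_measurable_prod_list:
  fixes g :: "'b \<Rightarrow> 'a \<Rightarrow> complex"
  assumes "\<And>x. x \<in> set xs \<Longrightarrow> g x \<in> borel_measurable M"
  shows "(\<lambda>\<tau>. \<Prod>x\<leftarrow>xs. g x \<tau>) \<in> borel_measurable M"
  using assms by (induction xs) auto

lemma I_chi_measurable:
  assumes G: "Gamma_power_family G" and par: "I_parameters m n U L"
  shows "(\<lambda>\<tau>. I_chi G m n U L (\<i> * of_real \<tau>)) \<in> borel_measurable borel"
proof -
  have pos: "\<And>b B \<kappa>. (b, B, \<kappa>) \<in> set L \<Longrightarrow> B > 0 \<and> \<kappa> > 0" "\<And>a A \<kappa>. (a, A, \<kappa>) \<in> set U \<Longrightarrow> A > 0 \<and> \<kappa> > 0"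
    using par unfolding I_parameters_def by auto
  note [dest] = in_set_takeD in_set_dropD pos
  show ?thesis unfolding I_chi_def
    by (intro borel_measurable_divide borel_measurable_times; rule borel_measurable_prod_list;
        clarsimp; rule Gamma_power_measurable[OF G]; force)
qed

text \<open>Dominated by the two translated half-line functions \<open>h (1 + x)\<close> and \<open>h (1 - x)\<close>, whose supports
  cover the real line.\<close>

lemma integrable_1_plus_abs_powr:
  assumes "s < -1"
  shows "integrable lborel (\<lambda>x::real. (1 + \<bar>x\<bar>) powr s)"
proof -
  define h where "h = (\<lambda>x::real. indicator {1..} x *\<^sub>R x powr s)"
  have "(\<lambda>x. x powr s) integrable_on {1..}"
    using has_integral_powr_to_inf[OF assms, of 1] by (auto simp: integrable_on_def)
  then have "(\<lambda>x. x powr s) absolutely_integrable_on {1..}"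
    by (rule nonnegative_absolutely_integrable_1) auto
  then have "integrable lebesgue h" unfolding h_def set_integrable_def .
  then have h: "integrable lborel h"
    by (subst (asm) integrable_completion) (auto simp: h_def)
  have "integrable lborel (\<lambda>x. h (1 + 1 * x) + h (1 + (-1) * x))"
    by (intro Bochner_Integration.integrable_add lborel_integrable_real_affine h) auto
  then show ?thesis
    by (rule Bochner_Integration.integrable_bound) (auto simp: h_def indicator_def)
qed

text \<open>For \<open>A > 0\<close>, \<open>1 + x \<le> exp (k x) / k\<close> with \<open>k\<close> so small that \<open>k A \<le> e\<close>.\<close>

lemma powr_times_exp_bounded:
  fixes A e :: real
  assumes "e > 0"
  shows "\<exists>K. \<forall>x\<ge>0. (1 + x) powr A * exp (- (e * x)) \<le> K"
proof (cases "A \<le> 0")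
  case True
  have "(1 + x) powr A * exp (- (e * x)) \<le> 1 * 1" if "x \<ge> 0" for x
    using that assms powr_mono[OF True, of "1 + x"] by (intro mult_mono) auto
  then show ?thesis by auto
next
  case False
  define k where "k = min 1 (e / A)"
  have k: "0 < k" "k \<le> 1" "k * A \<le> e" using False assms by (auto simp: k_def min_def field_simps)
  have "(1 + x) powr A * exp (- (e * x)) \<le> (1/k) powr A" if x: "x \<ge> 0" for x
  proof -
    have "k * (1 + x) \<le> 1 + k * x" using k by (simp add: algebra_simps)
    also have "\<dots> \<le> exp (k * x)" by (rule exp_ge_add_one_self)
    finally have "1 + x \<le> 1/k * exp (k * x)" using k by (simp add: field_simps)
    then have "(1 + x) powr A \<le> (1/k * exp (k * x)) powr A" using x False by (intro powr_mono2) auto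
    also have "\<dots> = (1/k) powr A * exp (k * x) powr A" using k by (subst powr_mult) auto
    also have "exp (k * x) powr A = exp (k * A * x)" by (simp add: exp_powr_real mult_ac)
    finally have "(1 + x) powr A * exp (- (e * x)) \<le> (1/k) powr A * exp (k * A * x) * exp (- (e * x))"
      by (intro mult_right_mono) auto
    also have "\<dots> = (1/k) powr A * exp (- ((e - k * A) * x))" by (simp add: exp_add[symmetric] algebra_simps)
    also have "\<dots> \<le> (1/k) powr A * 1" using k x by (intro mult_left_mono) auto
    finally show ?thesis by simp
  qed
  then show ?thesis by blast
qed

text \<open>In the interior case the exponential decay absorbs every power. On the boundary the inequality
  \<open>\<Omega> + \<nu> < -1\<close> is strict, which leaves room for an exponent slightly larger than \<open>\<nu>\<close>. The factor
  \<open>exp (\<theta> \<tau>)\<close> is the modulus of the part of \<open>z powr (- s)\<close> that depends on the argument of \<open>z\<close>.\<close>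

lemma I_integrand_weight_integrable:
  assumes G: "Gamma_power_family G" and par: "I_parameters m n U L" and sep: "I_separated 0 m n U L"
    and conv: "\<bar>\<theta>\<bar> < pi / 2 * I_Delta m n U L \<or> \<bar>\<theta>\<bar> = pi / 2 * I_Delta m n U L \<and> I_Omega U L + \<nu> < -1"
    and "p > 0"
  shows "\<exists>e>0. e \<le> p \<and> integrable lborel (\<lambda>\<tau>. I_chi G m n U L (\<i> * of_real \<tau>) *
           complex_of_real (exp (\<theta> * \<tau>) * (1 + \<bar>\<tau>\<bar>) powr (\<nu> + e)))"
proof -
  let ?X = "\<lambda>\<tau>. I_chi G m n U L (\<i> * of_real \<tau>)"
  define D where "D = pi / 2 * I_Delta m n U L"
  obtain C where C: "\<And>\<tau>. cmod (?X \<tau>) \<le> C * ((1 + \<bar>\<tau>\<bar>) powr I_Omega U L * exp (- D * \<bar>\<tau>\<bar>))"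
    using I_chi_bounded[OF G par sep] unfolding pow_exp_bounded_def D_def by auto
  have C0: "C \<ge> 0" using order.trans[OF norm_ge_zero C[of 0]] by simp
  have "\<exists>e s K. 0 < e \<and> e \<le> p \<and> s < -1 \<and> (\<forall>x\<ge>0. (1 + x) powr (I_Omega U L + \<nu> + e) * exp (- ((D - \<bar>\<theta>\<bar>) * x)) \<le> K * (1 + x) powr s)"
    using conv
  proof
    assume *: "\<bar>\<theta>\<bar> < pi / 2 * I_Delta m n U L"
    obtain K where K: "\<And>x. x \<ge> 0 \<Longrightarrow> (1 + x) powr (I_Omega U L + \<nu> + p + 2) * exp (- ((D - \<bar>\<theta>\<bar>) * x)) \<le> K"
      using powr_times_exp_bounded[of "D - \<bar>\<theta>\<bar>"] * by (auto simp: D_def)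
    have "(1 + x) powr (I_Omega U L + \<nu> + p) * exp (- ((D - \<bar>\<theta>\<bar>) * x)) \<le> K * (1 + x) powr (-2)" if x: "x \<ge> 0" for x
    proof -
      have "(1 + x) powr (I_Omega U L + \<nu> + p) = (1 + x) powr (I_Omega U L + \<nu> + p + 2) * (1 + x) powr (-2)"
        unfolding powr_add[symmetric] by simp
      then show ?thesis using mult_right_mono[OF K[OF x], of "(1 + x) powr (-2)"] by (simp add: mult_ac)
    qed
    then show ?thesis using \<open>p > 0\<close> by (intro exI[of _ p] exI[of _ "-2"] exI[of _ K]) auto
  next
    assume *: "\<bar>\<theta>\<bar> = pi / 2 * I_Delta m n U L \<and> I_Omega U L + \<nu> < -1"
    define e where "e = min p ((-1 - (I_Omega U L + \<nu>)) / 2)"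
    have "0 < e" "e \<le> p" "I_Omega U L + \<nu> + e < -1" using * \<open>p > 0\<close> by (auto simp: e_def min_def field_simps)
    then show ?thesis using *
      by (intro exI[of _ e] exI[of _ "I_Omega U L + \<nu> + e"] exI[of _ 1]) (auto simp: D_def)
  qed
  then obtain e s K where e: "0 < e" "e \<le> p" and s: "s < -1"
    and K: "\<And>x. x \<ge> 0 \<Longrightarrow> (1 + x) powr (I_Omega U L + \<nu> + e) * exp (- ((D - \<bar>\<theta>\<bar>) * x)) \<le> K * (1 + x) powr s"
    by blast
  let ?Y = "\<lambda>\<tau>. ?X \<tau> * complex_of_real (exp (\<theta> * \<tau>) * (1 + \<bar>\<tau>\<bar>) powr (\<nu> + e))"
  have "integrable lborel ?Y"
  proof (rule Bochner_Integration.integrable_bound)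
    show "integrable lborel (\<lambda>\<tau>. C * K * (1 + \<bar>\<tau>\<bar>) powr s)"
      using integrable_1_plus_abs_powr[OF s] by simp
    show "?Y \<in> borel_measurable lborel"
      using I_chi_measurable[OF G par] by simp
    have "cmod (?Y \<tau>) \<le> C * K * (1 + \<bar>\<tau>\<bar>) powr s" for \<tau>
    proof -
      have "\<theta> * \<tau> \<le> \<bar>\<theta>\<bar> * \<bar>\<tau>\<bar>" using abs_ge_self[of "\<theta> * \<tau>"] by (simp only: abs_mult)
      then have "cmod (?Y \<tau>)
        \<le> (C * ((1 + \<bar>\<tau>\<bar>) powr I_Omega U L * exp (- D * \<bar>\<tau>\<bar>))) * (exp (\<bar>\<theta>\<bar> * \<bar>\<tau>\<bar>) * (1 + \<bar>\<tau>\<bar>) powr (\<nu> + e))"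
        unfolding norm_mult norm_of_real
        by (intro mult_mono C order.trans[OF norm_ge_zero C]) (auto simp: abs_mult intro!: mult_right_mono)
      also have "\<dots> = C * ((1 + \<bar>\<tau>\<bar>) powr (I_Omega U L + \<nu> + e) * exp (- ((D - \<bar>\<theta>\<bar>) * \<bar>\<tau>\<bar>)))"
      proof -
        have "exp (- ((D - \<bar>\<theta>\<bar>) * \<bar>\<tau>\<bar>)) = exp (- D * \<bar>\<tau>\<bar>) * exp (\<bar>\<theta>\<bar> * \<bar>\<tau>\<bar>)"
          unfolding exp_add[symmetric] by (simp add: algebra_simps)
        moreover have "(1 + \<bar>\<tau>\<bar>) powr (I_Omega U L + \<nu> + e) = (1 + \<bar>\<tau>\<bar>) powr I_Omega U L * (1 + \<bar>\<tau>\<bar>) powr (\<nu> + e)"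
          unfolding powr_add[symmetric] by (simp add: add_ac)
        ultimately show ?thesis by (simp only: mult_ac)
      qed
      also have "\<dots> \<le> C * (K * (1 + \<bar>\<tau>\<bar>) powr s)" by (intro mult_left_mono K C0) auto
      finally show ?thesis by (simp add: mult_ac)
    qed
    then show "AE \<tau> in lborel. cmod (?Y \<tau>) \<le> norm (C * K * (1 + \<bar>\<tau>\<bar>) powr s)"
      by (intro AE_I2) (smt (verit) real_norm_def)
  qed
  then show ?thesis using e by blast
qed

section \<open>Gauss's summation theorem\<close>

lemma nonpos_Ints_Re: "Re z > 0 \<Longrightarrow> z \<notin> \<int>\<^sub>\<le>\<^sub>0"
  by (auto elim!: nonpos_Ints_cases)

definition hyp_coeff :: "complex \<Rightarrow> complex \<Rightarrow> complex \<Rightarrow> nat \<Rightarrow> complex" where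
  "hyp_coeff a b c n = pochhammer a n * pochhammer b n / (pochhammer c n * fact n)"

lemma pochhammer_conv_rGamma_series:
  "pochhammer z (Suc n) = rGamma_series z n * (fact n * exp (z * of_real (ln (real n))))" for z :: complex
  by (simp add: rGamma_series_def)

lemma pochhammer_nonzero: "pochhammer c n \<noteq> 0" if "c \<notin> \<int>\<^sub>\<le>\<^sub>0" for c :: complex
  using that by (auto simp: pochhammer_eq_0_iff)

text \<open>Euler's product for the Gamma function, read as asymptotics of the coefficients: the first factor
  converges unless \<open>c\<close> is a pole of \<open>\<Gamma>\<close>, and the second has modulus \<open>n powr Re (a + b - c)\<close>.\<close>

lemma hyp_coeff_Suc_conv_rGamma_series:
  "of_nat (Suc n) * hyp_coeff a b c (Suc n) =
     rGamma_series a n * rGamma_series b n / rGamma_series c n * exp ((a + b - c) * of_real (ln (real n)))"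
proof -
  have e: "exp ((a + b - c) * of_real (ln (real n))) =
      exp (a * of_real (ln (real n))) * exp (b * of_real (ln (real n))) / exp (c * of_real (ln (real n)))"
    by (simp add: exp_add exp_diff ring_distribs)
  have *: "s * (Ra * (f * Ea) * (Rb * (f * Eb)) / (Rc * (f * Ec) * (s * f))) = Ra * Rb / Rc * (Ea * Eb / Ec)"
    if "s \<noteq> 0" "f \<noteq> 0" "Ec \<noteq> 0" for s f Ra Rb Rc Ea Eb Ec :: complex
    using that by (cases "Rc = 0") (auto simp: divide_simps)
  show ?thesis
    unfolding hyp_coeff_def pochhammer_conv_rGamma_series e fact_Suc of_nat_mult
    by (rule *) (use of_nat_neq_0 in auto)
qed

lemma rGamma_series_quotient_tendsto:
  fixes a b c :: complex
  assumes "c \<notin> \<int>\<^sub>\<le>\<^sub>0"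
  shows "(\<lambda>n. rGamma_series a n * rGamma_series b n / rGamma_series c n) \<longlonglongrightarrow> rGamma a * rGamma b / rGamma c"
  by (intro tendsto_intros) (use assms in \<open>simp add: rGamma_eq_zero_iff\<close>)

lemma cmod_exp_ln_nat:
  "n > 0 \<Longrightarrow> cmod (exp (s * of_real (ln (real n)))) = real n powr Re s"
  by (simp add: powr_def)

lemma n_times_hyp_coeff_tendsto_0:
  assumes c: "c \<notin> \<int>\<^sub>\<le>\<^sub>0" and "Re (a + b - c) < 0"
  shows "(\<lambda>n. of_nat n * hyp_coeff a b c n) \<longlonglongrightarrow> 0"
proof (rule LIMSEQ_imp_Suc)
  have "(\<lambda>n. real n powr Re (a + b - c)) \<longlonglongrightarrow> 0"
    by (intro tendsto_neg_powr assms filterlim_real_sequentially)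
  moreover have "eventually (\<lambda>n. real n powr Re (a + b - c) = cmod (exp ((a + b - c) * of_real (ln (real n))))) sequentially"
    using eventually_gt_at_top[of 0] by eventually_elim (simp only: cmod_exp_ln_nat)
  ultimately have "(\<lambda>n. cmod (exp ((a + b - c) * of_real (ln (real n))))) \<longlonglongrightarrow> 0"
    by (rule Lim_transform_eventually)
  then have "(\<lambda>n. exp ((a + b - c) * of_real (ln (real n)))) \<longlonglongrightarrow> 0"
    by (simp only: tendsto_norm_zero_iff)
  then have "(\<lambda>n. rGamma_series a n * rGamma_series b n / rGamma_series c n * exp ((a + b - c) * of_real (ln (real n))))
      \<longlonglongrightarrow> rGamma a * rGamma b / rGamma c * 0"
    by (intro tendsto_mult rGamma_series_quotient_tendsto c)
  then show "(\<lambda>n. of_nat (Suc n) * hyp_coeff a b c (Suc n)) \<longlonglongrightarrow> 0"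
    unfolding hyp_coeff_Suc_conv_rGamma_series by simp
qed

lemma hyp_coeff_abs_summable:
  assumes c: "c \<notin> \<int>\<^sub>\<le>\<^sub>0" and ab: "Re (a + b - c) < 0"
  shows "summable (\<lambda>n. cmod (hyp_coeff a b c n))"
proof -
  have "Bseq (\<lambda>n. rGamma_series a n * rGamma_series b n / rGamma_series c n)"
    using rGamma_series_quotient_tendsto[OF c] by (intro convergent_imp_Bseq) (auto simp: convergent_def)
  then obtain K where K: "\<And>n. cmod (rGamma_series a n * rGamma_series b n / rGamma_series c n) \<le> K"
    unfolding Bseq_def by blast
  have "summable (\<lambda>n. cmod (hyp_coeff a b c (Suc n)))"
  proof (rule summable_comparison_test_ev)
    show "summable (\<lambda>n. K * of_nat n powr (Re (a + b - c) - 1))"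
      using ab by (intro summable_mult) (simp add: summable_real_powr_iff)
    show "eventually (\<lambda>n. norm (cmod (hyp_coeff a b c (Suc n))) \<le> K * of_nat n powr (Re (a + b - c) - 1)) sequentially"
      using eventually_gt_at_top[of 0]
    proof eventually_elim
      case (elim n)
      have "real (Suc n) * cmod (hyp_coeff a b c (Suc n)) \<le> K * real n powr Re (a + b - c)"
      proof -
        have "real (Suc n) * cmod (hyp_coeff a b c (Suc n)) = cmod (of_nat (Suc n) * hyp_coeff a b c (Suc n))"
          unfolding norm_mult norm_of_nat ..
        also have "\<dots> = cmod (rGamma_series a n * rGamma_series b n / rGamma_series c n) * real n powr Re (a + b - c)"
          unfolding hyp_coeff_Suc_conv_rGamma_series
          by (simp only: norm_mult[of "rGamma_series a n * rGamma_series b n / rGamma_series c n"] cmod_exp_ln_nat[OF elim])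
        finally show ?thesis using mult_right_mono[OF K[of n], of "real n powr Re (a + b - c)"] by simp
      qed
      then have "cmod (hyp_coeff a b c (Suc n)) \<le> K * real n powr Re (a + b - c) / real (Suc n)"
        by (simp add: field_simps)
      also have "\<dots> \<le> K * real n powr Re (a + b - c) / real n"
        using elim order.trans[OF norm_ge_zero K] by (intro divide_left_mono) auto
      also have "\<dots> = K * real n powr (Re (a + b - c) - 1)"
        using elim by (simp add: powr_diff)
      finally show ?case by simp
    qed
  qed
  then show ?thesis by (subst (asm) summable_Suc_iff)
qed

text \<open>For \<open>T n = n * hyp_coeff a b c n\<close>, the combination
  \<open>c (c - a - b) hyp_coeff a b c n - (c - a) (c - b) hyp_coeff a b (c + 1) n\<close> equals
  \<open>c (T n - T (n + 1))\<close>. So the series telescopes, and \<open>T\<close> vanishes at \<open>0\<close> and at infinity.\<close>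

lemma hyp_series_contiguous:
  assumes c: "Re c > 0" and ab: "Re (c - a - b) > 0"
  shows "c * (c - a - b) * (\<Sum>n. hyp_coeff a b c n) = (c - a) * (c - b) * (\<Sum>n. hyp_coeff a b (c + 1) n)"
proof -
  note npc = nonpos_Ints_Re
  have cz: "c + of_nat n \<noteq> 0" for n using c by (auto simp: complex_eq_iff)
  let ?u = "hyp_coeff a b c" and ?v = "hyp_coeff a b (c + 1)"
  have sc: "summable ?u" using hyp_coeff_abs_summable[of c a b] npc[OF c] ab by (auto intro: summable_norm_cancel)
  have sv: "summable ?v" using hyp_coeff_abs_summable[of "c + 1" a b] npc[of "c + 1"] c ab by (auto intro: summable_norm_cancel)
  define T where "T = (\<lambda>n. of_nat n * ?u n)"
  have T0: "T \<longlonglongrightarrow> 0" unfolding T_def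
    by (rule n_times_hyp_coeff_tendsto_0) (use npc[OF c] ab in auto)
  have pv: "c * pochhammer (c + 1) n = (c + of_nat n) * pochhammer c n" for n
    by (metis pochhammer_rec pochhammer_rec')
  have v: "?v n = ?u n * c / (c + of_nat n)" for n
  proof -
    have "pochhammer (c + 1) n = (c + of_nat n) * pochhammer c n / c" using pv[of n] cz[of 0] by (simp add: eq_divide_eq mult_ac)
    then show ?thesis by (simp add: hyp_coeff_def)
  qed
  have T: "T (Suc n) = ?u n * (a + of_nat n) * (b + of_nat n) / (c + of_nat n)" for n
    using of_nat_neq_0[of n, where 'a = complex]
    by (simp add: T_def hyp_coeff_def pochhammer_rec' mult_ac del: of_nat_Suc)
  have "c * (c - a - b) * ?u n - (c - a) * (c - b) * ?v n = - c * (T (Suc n) - T n)" for n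
  proof -
    have alg: "C * V - D * (V * c / d) = - c * (V * A * B / d - k * V)"
      if d: "d \<noteq> 0" and eq: "C * (V * d) - D * (V * c) = - c * (V * A * B - V * (k * d))" for C D V A B k d :: complex
    proof -
      have 1: "C * V = C * (V * d) / d" using d by simp
      have 2: "D * (V * c / d) = D * (V * c) / d" by simp
      have 3: "V * A * B / d - k * V = (V * A * B - V * (k * d)) / d" using d by (simp add: diff_divide_distrib)
      show ?thesis unfolding 1 2 3 diff_divide_distrib[symmetric] eq by simp
    qed
    show ?thesis unfolding T unfolding T_def v
      by (rule alg) (use cz[of n] in \<open>simp_all add: algebra_simps\<close>)
  qed
  moreover have "(\<lambda>n. c * (c - a - b) * ?u n - (c - a) * (c - b) * ?v n) sums
      (c * (c - a - b) * suminf ?u - (c - a) * (c - b) * suminf ?v)"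
    by (intro sums_diff sums_mult summable_sums sc sv)
  moreover have "(\<lambda>n. - c * (T (Suc n) - T n)) sums (- c * (0 - T 0))"
    by (intro sums_mult telescope_sums T0)
  ultimately have "c * (c - a - b) * suminf ?u - (c - a) * (c - b) * suminf ?v = - c * (0 - T 0)"
    by (simp add: sums_unique2)
  then show ?thesis by (simp add: T_def)
qed

lemma hyp_series_shift:
  assumes c: "Re c > 0" and ab: "Re (c - a - b) > 0"
  shows "pochhammer c n * pochhammer (c - a - b) n * (\<Sum>k. hyp_coeff a b c k) =
         pochhammer (c - a) n * pochhammer (c - b) n * (\<Sum>k. hyp_coeff a b (c + of_nat n) k)"
proof (induction n)
  case (Suc n)
  let ?F = "\<lambda>n. \<Sum>k. hyp_coeff a b (c + of_nat n) k"
  have step: "(c + of_nat n) * (c + of_nat n - a - b) * ?F n = (c + of_nat n - a) * (c + of_nat n - b) * ?F (Suc n)"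
    using hyp_series_contiguous[of "c + of_nat n" a b] c ab by (simp add: add_ac)
  have "pochhammer c (Suc n) * pochhammer (c - a - b) (Suc n) * ?F 0 =
     (c + of_nat n) * (c + of_nat n - a - b) * (pochhammer c n * pochhammer (c - a - b) n * ?F 0)"
    by (simp add: pochhammer_rec' diff_add_eq mult_ac)
  also have "\<dots> = (c + of_nat n) * (c + of_nat n - a - b) * (pochhammer (c - a) n * pochhammer (c - b) n * ?F n)"
    using Suc.IH by simp
  also have "\<dots> = pochhammer (c - a) n * pochhammer (c - b) n * ((c + of_nat n) * (c + of_nat n - a - b) * ?F n)"
    by (simp only: mult_ac)
  also have "\<dots> = pochhammer (c - a) n * pochhammer (c - b) n * ((c + of_nat n - a) * (c + of_nat n - b) * ?F (Suc n))"
    unfolding step ..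
  also have "\<dots> = pochhammer (c - a) (Suc n) * pochhammer (c - b) (Suc n) * ?F (Suc n)"
    by (simp add: pochhammer_rec' diff_add_eq mult_ac)
  finally show ?case by simp
qed simp

text \<open>Replacing \<open>c\<close> by \<open>c + n\<close> increases the modulus of every factor of the Pochhammer symbol in the
  denominator; keeping track of the first factor only, all terms but the initial 1 are reduced by
  \<open>\<bar>c / (c + n)\<bar>\<close>.\<close>

lemma hyp_series_shift_tendsto_1:
  assumes c: "Re c > 0" and ab: "Re (c - a - b) > 0"
  shows "(\<lambda>n. \<Sum>k. hyp_coeff a b (c + of_nat n) k) \<longlonglongrightarrow> 1"
proof -
  note npc = nonpos_Ints_Re
  have sm: "summable (\<lambda>k. cmod (hyp_coeff a b (c + of_nat n) k))" for n
    by (rule hyp_coeff_abs_summable) (use npc c ab in auto)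
  have sS: "summable (\<lambda>k. cmod (hyp_coeff a b (c + of_nat n) (Suc k)))" for n
    using sm[of n] by (subst summable_Suc_iff)
  define S where "S = (\<Sum>k. cmod (hyp_coeff a b c (Suc k)))"
  have grow: "cmod (c + of_nat j) \<le> cmod (c + of_nat n + of_nat j)" for n j
    unfolding cmod_def using c by (intro real_sqrt_le_mono add_mono) (auto intro!: power_mono)
  have bound: "cmod (hyp_coeff a b (c + of_nat n) (Suc k)) \<le> cmod c / cmod (c + of_nat n) * cmod (hyp_coeff a b c (Suc k))" for n k
  proof -
    have nz: "pochhammer z k \<noteq> 0" if "Re z > 0" for z k using that npc pochhammer_nonzero by blast
    have "cmod (pochhammer (c + 1) k) \<le> cmod (pochhammer (c + of_nat n + 1) k)"
      unfolding pochhammer_prod prod_norm[symmetric]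
      using grow[of "Suc _" n] by (intro prod_mono) (auto simp: add_ac)
    then have "cmod (pochhammer (c + of_nat n) (Suc k)) \<ge> cmod (c + of_nat n) * cmod (pochhammer (c + 1) k)"
      by (simp add: pochhammer_rec norm_mult mult_left_mono)
    moreover have cz: "c \<noteq> 0" "c + of_nat n \<noteq> 0" using c by (auto simp: complex_eq_iff)
    moreover have "pochhammer c (Suc k) = c * pochhammer (c + 1) k" by (rule pochhammer_rec)
    ultimately have le: "cmod (c + of_nat n) / cmod c * cmod (pochhammer c (Suc k)) \<le> cmod (pochhammer (c + of_nat n) (Suc k))"
      by (simp add: norm_mult)
    define P where "P = cmod (pochhammer a (Suc k) * pochhammer b (Suc k)) / fact (Suc k)"
    have "cmod (hyp_coeff a b z (Suc k)) = P / cmod (pochhammer z (Suc k))" for z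
      unfolding hyp_coeff_def P_def norm_divide norm_mult norm_fact by (simp add: mult.commute)
    moreover have "P / cmod (pochhammer (c + of_nat n) (Suc k)) \<le> P / (cmod (c + of_nat n) / cmod c * cmod (pochhammer c (Suc k)))"
      using le cz nz[OF c] nz[of "c + of_nat n"] c
      by (intro divide_left_mono mult_pos_pos) (auto simp: P_def)
    ultimately show ?thesis using cz by (simp add: mult_ac)
  qed
  have le: "cmod ((\<Sum>k. hyp_coeff a b (c + of_nat n) k) - 1) \<le> cmod c / cmod (c + of_nat n) * S" for n
  proof -
    have "(\<Sum>k. hyp_coeff a b (c + of_nat n) k) - 1 = (\<Sum>k. hyp_coeff a b (c + of_nat n) (Suc k))"
      using suminf_split_head[OF summable_norm_cancel[OF sm[of n]]] by (simp add: hyp_coeff_def)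
    also have "cmod \<dots> \<le> (\<Sum>k. cmod (hyp_coeff a b (c + of_nat n) (Suc k)))"
      by (intro summable_norm sS)
    also have "\<dots> \<le> (\<Sum>k. cmod c / cmod (c + of_nat n) * cmod (hyp_coeff a b c (Suc k)))"
      using sS[of 0] by (intro suminf_le bound summable_mult sS) simp
    also have "\<dots> = cmod c / cmod (c + of_nat n) * S"
      unfolding S_def using sS[of 0] by (intro suminf_mult) simp
    finally show ?thesis .
  qed
  have "(\<lambda>n. cmod c / cmod (c + of_nat n) * S) \<longlonglongrightarrow> 0 * S"
  proof (intro tendsto_mult tendsto_const tendsto_divide_0[OF tendsto_const] filterlim_at_top_imp_at_infinity)
    have "real n \<le> cmod (c + of_nat n)" for n
      using complex_Re_le_cmod[of "c + of_nat n"] c by simp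
    then show "filterlim (\<lambda>n. cmod (c + of_nat n)) at_top sequentially"
      by (intro filterlim_at_top_mono[OF filterlim_real_sequentially] always_eventually allI)
  qed
  then have "(\<lambda>n. (\<Sum>k. hyp_coeff a b (c + of_nat n) k) - 1) \<longlonglongrightarrow> 0"
    by (intro Lim_null_comparison[OF always_eventually[OF allI[OF le]]]) simp
  then show ?thesis by (simp add: LIM_zero_iff)
qed

text \<open>The contiguous relation moves \<open>c\<close> to \<open>c + n\<close>, where the sum tends to 1. The powers of \<open>n\<close> in
  Euler's product cancel because \<open>c + (c - a - b) = (c - a) + (c - b)\<close>, so the quotient of Pochhammer
  symbols that accumulates tends to the quotient of Gamma functions.\<close>

theorem Gauss_hypergeometric:
  assumes c: "Re c > 0" and ab: "Re (c - a - b) > 0"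
  shows "(\<lambda>n. hyp_coeff a b c n) sums (Gamma c * Gamma (c - a - b) * rGamma (c - a) * rGamma (c - b))"
proof -
  note npc = nonpos_Ints_Re
  let ?F = "\<lambda>n. \<Sum>k. hyp_coeff a b (c + of_nat n) k"
  have "?F 0 * (rGamma_series c n * rGamma_series (c - a - b) n) =
      rGamma_series (c - a) n * rGamma_series (c - b) n * ?F (Suc n)" for n
  proof -
    let ?E = "\<lambda>z. exp (z * of_real (ln (real n))) :: complex"
    have h1: "?E c * ?E (c - a - b) = ?E (c - a) * ?E (c - b)"
      unfolding exp_add[symmetric] by (simp add: algebra_simps)
    have h2: "rGamma_series c n * (fact n * ?E c) * (rGamma_series (c - a - b) n * (fact n * ?E (c - a - b))) * ?F 0 =
      rGamma_series (c - a) n * (fact n * ?E (c - a)) * (rGamma_series (c - b) n * (fact n * ?E (c - b))) * ?F (Suc n)"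
      using hyp_series_shift[OF c ab, of "Suc n"] unfolding pochhammer_conv_rGamma_series by simp
    have gen: "F0 * (r1 * r2) = r3 * r4 * F1"
      if "r1 * (f * e1) * (r2 * (f * e2)) * F0 = r3 * (f * e3) * (r4 * (f * e4)) * F1"
        "e1 * e2 = e3 * e4" "f \<noteq> 0" "e1 \<noteq> 0" "e2 \<noteq> 0" for r1 r2 r3 r4 f e1 e2 e3 e4 F0 F1 :: complex
    proof -
      have "(f * f * (e1 * e2)) * (F0 * (r1 * r2)) = (f * f * (e3 * e4)) * (r3 * r4 * F1)"
        using that(1) by (simp only: mult_ac)
      then have "(f * f * (e1 * e2)) * (F0 * (r1 * r2)) = (f * f * (e1 * e2)) * (r3 * r4 * F1)"
        by (simp only: that(2))
      then show ?thesis using that(3-5) by (simp only: mult_cancel_left mult_eq_0_iff) simp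
    qed
    show ?thesis by (rule gen[OF h2 h1]) (simp_all only: fact_nonzero exp_not_eq_zero not_False_eq_True)
  qed
  then have eq: "(\<lambda>n. ?F 0 * (rGamma_series c n * rGamma_series (c - a - b) n)) =
      (\<lambda>n. rGamma_series (c - a) n * rGamma_series (c - b) n * ?F (Suc n))" by (rule ext)
  have lim1: "(\<lambda>n. ?F 0 * (rGamma_series c n * rGamma_series (c - a - b) n)) \<longlonglongrightarrow> ?F 0 * (rGamma c * rGamma (c - a - b))"
    by (rule tendsto_mult_left tendsto_mult rGamma_series_LIMSEQ)+
  have "(\<lambda>n. rGamma_series (c - a) n * rGamma_series (c - b) n * ?F (Suc n)) \<longlonglongrightarrow> rGamma (c - a) * rGamma (c - b) * 1"
    by (rule tendsto_mult rGamma_series_LIMSEQ LIMSEQ_Suc[OF hyp_series_shift_tendsto_1[OF c ab]])+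
  from LIMSEQ_unique[OF lim1[unfolded eq] this]
  have lims: "?F 0 * (rGamma c * rGamma (c - a - b)) = rGamma (c - a) * rGamma (c - b)"
    by (simp only: mult_1_right)
  have "?F 0 = Gamma c * Gamma (c - a - b) * rGamma (c - a) * rGamma (c - b)"
  proof -
    have inv: "Gamma c * rGamma c = 1" "Gamma (c - a - b) * rGamma (c - a - b) = 1"
      using npc[OF c] npc[OF ab] by (simp_all add: rGamma_inverse_Gamma Gamma_eq_zero_iff)
    have "?F 0 = ?F 0 * ((Gamma c * rGamma c) * (Gamma (c - a - b) * rGamma (c - a - b)))"
      unfolding inv by simp
    also have "\<dots> = Gamma c * Gamma (c - a - b) * (?F 0 * (rGamma c * rGamma (c - a - b)))"
      by (simp only: mult_ac)
    finally show ?thesis unfolding lims by (simp only: mult_ac)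
  qed
  moreover have "summable (hyp_coeff a b c)"
    using hyp_coeff_abs_summable[of c a b] npc[OF c] ab by (auto intro: summable_norm_cancel)
  ultimately show ?thesis by (simp add: sums_iff)
qed

section \<open>Comparison with the binomial series\<close>

text \<open>The coefficients of \<open>(1 - z) powr (- \<eta>)\<close>.\<close>

definition binom_coeff :: "real \<Rightarrow> nat \<Rightarrow> real" where
  "binom_coeff \<eta> n = pochhammer \<eta> n / fact n"

lemma binom_coeff_nonneg: "\<eta> > 0 \<Longrightarrow> binom_coeff \<eta> n \<ge> 0"
  unfolding binom_coeff_def by (intro divide_nonneg_pos) (auto intro: less_imp_le[OF pochhammer_pos])

lemma binom_coeff_sums:
  assumes "0 \<le> z" "z < (1::real)"
  shows "(\<lambda>n. binom_coeff \<eta> n * z ^ n) sums (1 - z) powr (- \<eta>)"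
proof -
  have "(\<lambda>n. ((- \<eta>) gchoose n) * (- z) ^ n) sums (1 + (- z)) powr (- \<eta>)"
    by (rule gen_binomial_real) (use assms in auto)
  moreover have "((- \<eta>) gchoose n) * (- z) ^ n = binom_coeff \<eta> n * z ^ n" for n
  proof -
    have "(- 1) ^ n * (- z) ^ n = z ^ n" unfolding power_mult_distrib[symmetric] by simp
    then show ?thesis unfolding gbinomial_pochhammer binom_coeff_def by (simp add: mult_ac)
  qed
  ultimately show ?thesis by simp
qed

text \<open>The coefficients grow like \<open>n powr (Re (a + b - c) - 1)\<close>, those of \<open>(1 - z) powr (- \<eta>)\<close> like
  \<open>n powr (\<eta> - 1)\<close>. Comparing coefficients bounds the hypergeometric
  function and its derivative near \<open>z = 1\<close>.\<close>

lemma hyp_coeff_majorant: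
  assumes c: "c \<notin> \<int>\<^sub>\<le>\<^sub>0" and \<eta>: "\<eta> > 0" "Re (a + b - c) \<le> \<eta>"
  shows "\<exists>C. \<forall>n. cmod (hyp_coeff a b c n) \<le> C * binom_coeff \<eta> n"
proof -
  define e where "e = complex_of_real \<eta>"
  have npe: "e \<notin> \<int>\<^sub>\<le>\<^sub>0" using \<eta> by (intro nonpos_Ints_Re) (simp add: e_def)
  have npc1: "(1::complex) \<notin> \<int>\<^sub>\<le>\<^sub>0" by (intro nonpos_Ints_Re) simp
  \<comment> \<open>the majorant is itself hypergeometric, so the same asymptotics apply to it\<close>
  have he: "hyp_coeff e 1 1 n = complex_of_real (binom_coeff \<eta> n)" for n
    unfolding hyp_coeff_def binom_coeff_def e_def
    by (simp add: pochhammer_fact[symmetric] pochhammer_of_real)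
  have bpos: "binom_coeff \<eta> n > 0" for n
    unfolding binom_coeff_def using \<eta> by (intro divide_pos_pos pochhammer_pos) auto
  let ?Q = "\<lambda>n. rGamma_series a n * rGamma_series b n / rGamma_series c n"
  let ?R = "\<lambda>n. rGamma_series e n * rGamma_series 1 n / rGamma_series 1 n"
  have "rGamma e * rGamma 1 / rGamma 1 \<noteq> 0" using npe npc1 by (simp add: rGamma_eq_zero_iff)
  then have "(\<lambda>n. ?Q n / ?R n) \<longlonglongrightarrow> (rGamma a * rGamma b / rGamma c) / (rGamma e * rGamma 1 / rGamma 1)"
    by (intro tendsto_divide[OF rGamma_series_quotient_tendsto[OF c] rGamma_series_quotient_tendsto[OF npc1]])
  then have B: "Bseq (\<lambda>n. ?Q n / ?R n)" by (intro convergent_imp_Bseq) (auto simp: convergent_def)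
  have "Bseq (\<lambda>n. hyp_coeff a b c (Suc n) / hyp_coeff e 1 1 (Suc n))"
  proof (rule Bseq_eventually_mono[OF _ B])
    show "eventually (\<lambda>n. cmod (hyp_coeff a b c (Suc n) / hyp_coeff e 1 1 (Suc n)) \<le> cmod (?Q n / ?R n)) sequentially"
      using eventually_gt_at_top[of 0]
    proof eventually_elim
      case (elim n)
      have nz: "of_nat (Suc n) \<noteq> (0::complex)" by (rule of_nat_neq_0)
      have "hyp_coeff a b c (Suc n) / hyp_coeff e 1 1 (Suc n) =
        (of_nat (Suc n) * hyp_coeff a b c (Suc n)) / (of_nat (Suc n) * hyp_coeff e 1 1 (Suc n))"
        using nz by (simp del: of_nat_Suc)
      also have "\<dots> = (?Q n / ?R n) * (exp ((a + b - c) * of_real (ln (real n))) / exp ((e + 1 - 1) * of_real (ln (real n))))"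
        unfolding hyp_coeff_Suc_conv_rGamma_series by (simp only: times_divide_times_eq)
      also have "cmod \<dots> = cmod (?Q n / ?R n) * (real n powr Re (a + b - c) / real n powr \<eta>)"
        by (simp only: norm_mult[of "?Q n / ?R n"] norm_divide[of "exp _"] cmod_exp_ln_nat[OF elim]) (simp add: e_def)
      also have "\<dots> \<le> cmod (?Q n / ?R n) * 1"
        using \<eta> elim by (intro mult_left_mono) (auto intro!: divide_le_eq_1[THEN iffD2] powr_mono)
      finally show ?case by simp
    qed
  qed
  then have "Bseq (\<lambda>n. hyp_coeff a b c n / hyp_coeff e 1 1 n)" by (subst (asm) Bseq_Suc_iff)
  then obtain K where K: "\<And>n. cmod (hyp_coeff a b c n / hyp_coeff e 1 1 n) \<le> K"
    unfolding Bseq_def by blast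
  have "cmod (hyp_coeff a b c n) \<le> K * binom_coeff \<eta> n" for n
    using K[of n] bpos[of n] unfolding he by (simp add: norm_divide divide_le_eq)
  then show ?thesis by blast
qed

lemma cmod_powr_of_real: "x > 0 \<Longrightarrow> cmod (of_real x powr s) = x powr Re s"
  by (simp add: norm_powr_real_powr)

section \<open>Beta integrals with complex exponents\<close>

lemma has_integral_one_minus_powr:
  assumes p: "Re p > 0"
  shows "((\<lambda>u. of_real (1 - u) powr (p - 1)) has_integral (1 / p)) {0..1}"
proof -
  have p0: "p \<noteq> 0" using p by auto
  have "((\<lambda>u. of_real (1 - u) powr (p - 1)) has_integral
      (- (complex_of_real (1 - 1) powr p / p) - - (complex_of_real (1 - 0) powr p / p))) {0..1}"
  proof (rule fundamental_theorem_of_calculus_interior)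
    show "continuous_on {0..1} (\<lambda>u. - (of_real (1 - u) powr p / p))"
      using p p0 by (intro continuous_intros) auto
    fix u :: real assume u: "u \<in> {0<..<1}"
    have "((\<lambda>z. - ((1 - z) powr p / p)) has_field_derivative (1 - complex_of_real u) powr (p - 1)) (at (complex_of_real u))"
      using u p0 by (auto intro!: derivative_eq_intros simp: complex_nonpos_Reals_iff)
    then have "((\<lambda>u. - ((1 - complex_of_real u) powr p / p)) has_vector_derivative (1 - complex_of_real u) powr (p - 1)) (at u)"
      by (rule has_vector_derivative_real_field)
    then show "((\<lambda>u. - (of_real (1 - u) powr p / p)) has_vector_derivative of_real (1 - u) powr (p - 1)) (at u)"
      by simp
  qed simp
  then show ?thesis by simp
qed

lemma powr_add_nat:
  fixes p :: complex
  assumes "x > 0"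
  shows "of_real x powr (p + of_nat n - 1) = of_real x powr (p - 1) * complex_of_real x ^ n"
proof -
  have "p + of_nat n - 1 = (p - 1) + of_nat n" by simp
  then show ?thesis using assms by (simp only: powr_add powr_nat') (simp add: powr_nat')
qed

text \<open>Term-by-term integration: the partial sums of the series in \<open>1 - u\<close> are dominated by
  \<open>C * u powr (- \<eta>)\<close>, which together with the remaining factors is a convergent real Beta integrand.\<close>

lemma sums_beta_integral:
  assumes hb: "\<And>n. cmod (h n) \<le> C * binom_coeff \<eta> n" and \<eta>: "0 < \<eta>" "\<eta> < Re w" and p: "Re p > 0"
    and B: "\<And>n. ((\<lambda>u. of_real u powr (w - 1) * of_real (1 - u) powr (p + of_nat n - 1)) has_integral B n) {0..1}"
    and H: "\<And>u. u \<in> {0<..<1} \<Longrightarrow> H u = of_real u powr (w - 1) * of_real (1 - u) powr (p - 1) * (\<Sum>n. h n * (1 - complex_of_real u) ^ n)"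
    and S: "(\<lambda>n. h n * B n) sums V"
  shows "(H has_integral V) {0..1}"
proof -
  define f where "f = (\<lambda>k u. \<Sum>n<k. h n * (of_real u powr (w - 1) * of_real (1 - u) powr (p + of_nat n - 1)))"
  define g where "g = (\<lambda>u. C * (u powr (Re w - \<eta> - 1) * (1 - u) powr (Re p - 1)))"
  have fI: "(f k has_integral (\<Sum>n<k. h n * B n)) {0<..<1}" for k
    unfolding f_def has_integral_Icc_iff_Ioo[symmetric]
    by (intro has_integral_sum has_integral_mult_right B) auto
  have feq: "f k u = of_real u powr (w - 1) * of_real (1 - u) powr (p - 1) * (\<Sum>n<k. h n * (1 - complex_of_real u) ^ n)"
    if u: "u \<in> {0<..<1}" for k u
  proof -
    have "of_real (1 - u) powr (p + of_nat n - 1) = of_real (1 - u) powr (p - 1) * (1 - complex_of_real u) ^ n" for n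
      using powr_add_nat[of "1 - u" p n] u by simp
    then show ?thesis unfolding f_def by (simp add: sum_distrib_left mult_ac)
  qed
  have nb: "cmod (h n * (1 - complex_of_real u) ^ n) \<le> C * (binom_coeff \<eta> n * (1 - u) ^ n)" if u: "u \<in> {0<..<1}" for n u
  proof -
    have "cmod (1 - complex_of_real u) = 1 - u" using u by (metis norm_of_real of_real_1 of_real_diff abs_of_pos greaterThanLessThan_iff diff_gt_0_iff_gt)
    then have "cmod (h n * (1 - complex_of_real u) ^ n) = cmod (h n) * (1 - u) ^ n" by (simp add: norm_mult norm_power)
    also have "\<dots> \<le> (C * binom_coeff \<eta> n) * (1 - u) ^ n" using u by (intro mult_right_mono hb) auto
    finally show ?thesis by (simp add: mult_ac)
  qed
  have bs: "(\<lambda>n. C * (binom_coeff \<eta> n * (1 - u) ^ n)) sums (C * u powr (- \<eta>))" if u: "u \<in> {0<..<1}" for u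
    using sums_mult[OF binom_coeff_sums[of "1 - u" \<eta>], of C] u by simp
  have summ: "summable (\<lambda>n. h n * (1 - complex_of_real u) ^ n)" if u: "u \<in> {0<..<1}" for u
    by (rule summable_comparison_test'[OF sums_summable[OF bs[OF u]]]) (rule nb[OF u])
  have C0: "C \<ge> 0" using order.trans[OF norm_ge_zero hb[of 0]] by (simp add: binom_coeff_def)
  have fbound: "cmod (f k u) \<le> g u" if u: "u \<in> {0<..<1}" for k u
  proof -
    have "cmod (\<Sum>n<k. h n * (1 - complex_of_real u) ^ n) \<le> (\<Sum>n<k. C * (binom_coeff \<eta> n * (1 - u) ^ n))"
      by (rule sum_norm_le) (rule nb[OF u])
    also have "\<dots> \<le> C * u powr (- \<eta>)"
      unfolding sums_unique[OF bs[OF u]] using u C0 binom_coeff_nonneg[OF \<eta>(1)]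
      by (intro sum_le_suminf sums_summable[OF bs[OF u]]) auto
    finally have "cmod (f k u) \<le> u powr (Re w - 1) * (1 - u) powr (Re p - 1) * (C * u powr (- \<eta>))"
      unfolding feq[OF u] norm_mult using u
      by (intro mult_mono) (auto simp: cmod_powr_of_real simp flip: of_real_diff)
    also have "u powr (Re w - 1) * (1 - u) powr (Re p - 1) * (C * u powr (- \<eta>)) = g u"
    proof -
      have "u powr (Re w - \<eta> - 1) = u powr (Re w - 1) * u powr (- \<eta>)"
        unfolding powr_add[symmetric] by (simp add: algebra_simps)
      then show ?thesis unfolding g_def by (simp only: mult_ac)
    qed
    finally show ?thesis .
  qed
  have gint: "g integrable_on {0<..<1}"
    unfolding g_def integrable_on_Icc_iff_Ioo[symmetric]
    using integrable_Beta'[of "Re w - \<eta>" "Re p"] \<eta> p by (intro integrable_on_mult_right) auto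
  have conv: "(\<lambda>k. f k u) \<longlonglongrightarrow> H u" if u: "u \<in> {0<..<1}" for u
    unfolding feq[OF u] H[OF u] by (intro tendsto_intros summable_LIMSEQ summ u)
  have fi: "f k integrable_on {0<..<1}" for k using fI by blast
  have fint: "integral {0<..<1} (f k) = (\<Sum>n<k. h n * B n)" for k using fI by (rule integral_unique)
  have "H integrable_on {0<..<1}" and "(\<lambda>k. integral {0<..<1} (f k)) \<longlonglongrightarrow> integral {0<..<1} H"
    using dominated_convergence[of f "{0<..<1}" g H] fi gint fbound conv by blast+
  moreover have "(\<lambda>k. integral {0<..<1} (f k)) \<longlonglongrightarrow> V"
    using S unfolding fint sums_def .
  ultimately have "integral {0<..<1} H = V" by (metis LIMSEQ_unique)
  then show ?thesis using \<open>H integrable_on {0<..<1}\<close>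
    unfolding has_integral_Icc_iff_Ioo by (metis integrable_integral)
qed

text \<open>Expanding \<open>u powr (w - 1)\<close> in powers of \<open>1 - u\<close> and integrating gives the series
  \<open>\<Sum> (1 - w)\<^sub>n / (n! (p + n))\<close>, which is \<open>1 / p\<close> times a hypergeometric series at 1 with
  parameters \<open>1 - w\<close>, \<open>p\<close>; \<open>p + 1\<close>. So the Beta integral with complex exponents is a case of Gauss's
  theorem.\<close>

lemma has_integral_Beta_complex:
  assumes w: "Re w > 0" and p: "Re p > 0"
  shows "((\<lambda>u. of_real u powr (w - 1) * of_real (1 - u) powr (p - 1)) has_integral
          (Gamma w * Gamma p * rGamma (w + p))) {0..1}"
proof -
  define \<eta> where "\<eta> = max (1/2) ((1 + max 0 (1 - Re w)) / 2)"
  have \<eta>: "0 < \<eta>" "\<eta> < 1" "Re (1 - w) \<le> \<eta>" using w by (auto simp: \<eta>_def max_def field_simps)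
  have "\<exists>C. \<forall>n. cmod (hyp_coeff (1 - w) 1 1 n) \<le> C * binom_coeff \<eta> n"
    by (rule hyp_coeff_majorant) (use \<eta> nonpos_Ints_Re[of 1] in auto)
  then obtain C where C: "\<And>n. cmod (hyp_coeff (1 - w) 1 1 n) \<le> C * binom_coeff \<eta> n" by blast
  have p1: "p + of_nat n \<noteq> 0" for n using p by (auto simp: complex_eq_iff)
  have coeff: "hyp_coeff (1 - w) 1 1 n * (1 / (p + of_nat n)) = 1 / p * hyp_coeff (1 - w) p (p + 1) n" for n
  proof -
    have "p * pochhammer (p + 1) n = (p + of_nat n) * pochhammer p n" by (metis pochhammer_rec pochhammer_rec')
    moreover have "pochhammer p n \<noteq> 0" "pochhammer (p + 1) n \<noteq> 0"
      using p by (auto intro!: pochhammer_nonzero nonpos_Ints_Re simp del: pochhammer_eq_0_iff)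
    ultimately have "1 / (p + of_nat n) = pochhammer p n / (p * pochhammer (p + 1) n)"
      by simp
    then show ?thesis unfolding hyp_coeff_def by (simp add: pochhammer_fact[symmetric])
  qed
  have S: "(\<lambda>n. hyp_coeff (1 - w) 1 1 n * (1 / (p + of_nat n))) sums (Gamma w * Gamma p * rGamma (w + p))"
  proof -
    have "(\<lambda>n. hyp_coeff (1 - w) p (p + 1) n) sums
       (Gamma (p + 1) * Gamma (p + 1 - (1 - w) - p) * rGamma (p + 1 - (1 - w)) * rGamma (p + 1 - p))"
      by (rule Gauss_hypergeometric) (use w p in auto)
    from sums_mult[OF this, of "1 / p"] show ?thesis
      unfolding coeff using p1[of 0] Gamma_plus1[OF nonpos_Ints_Re[OF p]] by (simp add: add_ac mult_ac)
  qed
  show ?thesis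
  proof (rule sums_beta_integral[OF C \<eta>(1) _ p, where w = 1, OF _ _ _ S])
    show "\<eta> < Re 1" using \<eta> by simp
    show "((\<lambda>u. of_real u powr (1 - 1) * of_real (1 - u) powr (p + of_nat n - 1)) has_integral 1 / (p + of_nat n)) {0..1}" for n
    proof -
      have "((\<lambda>u. of_real (1 - u) powr (p + of_nat n - 1)) has_integral 1 / (p + of_nat n)) {0..1}"
        using p by (intro has_integral_one_minus_powr) simp
      then show ?thesis
        unfolding has_integral_Icc_iff_Ioo by (rule has_integral_eq[rotated]) auto
    qed
    show "of_real u powr (w - 1) * of_real (1 - u) powr (p - 1) =
       of_real u powr (1 - 1) * of_real (1 - u) powr (p - 1) * (\<Sum>n. hyp_coeff (1 - w) 1 1 n * (1 - complex_of_real u) ^ n)"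
      if u: "u \<in> {0<..<1}" for u
    proof -
      have "(\<lambda>n. ((w - 1) gchoose n) * (complex_of_real (u - 1)) ^ n) sums (1 + complex_of_real (u - 1)) powr (w - 1)"
        by (rule gen_binomial_complex) (use u in \<open>simp add: norm_of_real del: of_real_diff\<close>)
      moreover have "((w - 1) gchoose n) * (complex_of_real (u - 1)) ^ n = hyp_coeff (1 - w) 1 1 n * (1 - complex_of_real u) ^ n" for n
      proof -
        have "(-1) ^ n * (complex_of_real (u - 1)) ^ n = (1 - complex_of_real u) ^ n"
          unfolding power_mult_distrib[symmetric] by simp
        then show ?thesis unfolding gbinomial_pochhammer hyp_coeff_def by (simp add: pochhammer_fact[symmetric] mult_ac)
      qed
      ultimately have "(\<Sum>n. hyp_coeff (1 - w) 1 1 n * (1 - complex_of_real u) ^ n) = of_real u powr (w - 1)"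
        by (simp add: sums_iff)
      then show ?thesis using u by simp
    qed
  qed
qed

lemma hyp2F1_conv_coeff: "hyp2F1 a b c z = (\<Sum>n. hyp_coeff a b c n * z ^ n)"
  unfolding hyp2F1_def eval_fps_def hyp_coeff_def by simp

text \<open>Integration against \<open>u powr (w - 1)\<close> replaces the lower parameter \<open>c\<close> by \<open>c + w\<close> and evaluates
  the series at 1, up to Gamma factors.\<close>

theorem has_integral_hyp2F1_kernel:
  assumes c: "Re c > 0" and w: "Re w > 0" and abw: "Re (a + b - c) < Re w"
  shows "((\<lambda>u. of_real (1 - u) powr (c - 1) * hyp2F1 a b c (1 - complex_of_real u) * of_real u powr (w - 1))
     has_integral (Gamma c * Gamma w * Gamma (c + w - a - b) * rGamma (c + w - a) * rGamma (c + w - b))) {0..1}"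
proof -
  define \<eta> where "\<eta> = (Re w + max 0 (Re (a + b - c))) / 2"
  have \<eta>: "0 < \<eta>" "Re (a + b - c) \<le> \<eta>" "\<eta> < Re w" using w abw by (auto simp: \<eta>_def max_def)
  obtain C where C: "\<And>n. cmod (hyp_coeff a b c n) \<le> C * binom_coeff \<eta> n"
    using hyp_coeff_majorant[OF nonpos_Ints_Re[OF c] \<eta>(1,2)] by blast
  have S: "(\<lambda>n. hyp_coeff a b c n * (Gamma w * Gamma (c + of_nat n) * rGamma (w + (c + of_nat n)))) sums
      (Gamma c * Gamma w * Gamma (c + w - a - b) * rGamma (c + w - a) * rGamma (c + w - b))"
  proof -
    have pc: "pochhammer z n * Gamma z = Gamma (z + of_nat n)" if "Re z > 0" for z n
      using pochhammer_Gamma[OF nonpos_Ints_Re[OF that], of n] nonpos_Ints_Re[OF that] by (simp add: Gamma_eq_zero_iff)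
    have cw: "Re (c + w) > 0" using c w by simp
    have eq: "hyp_coeff a b c n * (Gamma w * Gamma (c + of_nat n) * rGamma (w + (c + of_nat n))) =
       Gamma c * Gamma w * rGamma (c + w) * hyp_coeff a b (c + w) n" for n
    proof -
      have "rGamma (w + (c + of_nat n)) = inverse (pochhammer (c + w) n * Gamma (c + w))"
        unfolding pc[OF cw] rGamma_inverse_Gamma by (simp add: add_ac)
      then show ?thesis
        using pochhammer_nonzero[OF nonpos_Ints_Re[OF c], of n]
        unfolding hyp_coeff_def pc[OF c, symmetric] rGamma_inverse_Gamma
        by (simp add: field_simps)
    qed
    have sums: "(\<lambda>n. Gamma c * Gamma w * rGamma (c + w) * hyp_coeff a b (c + w) n) sums
      (Gamma c * Gamma w * rGamma (c + w) * (Gamma (c + w) * Gamma (c + w - a - b) * rGamma (c + w - a) * rGamma (c + w - b)))"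
      by (intro sums_mult Gauss_hypergeometric cw) (use abw in simp)
    have inv: "rGamma (c + w) * Gamma (c + w) = 1"
      using nonpos_Ints_Re[OF cw] by (simp add: rGamma_inverse_Gamma Gamma_eq_zero_iff)
    have "Gamma c * Gamma w * rGamma (c + w) * (Gamma (c + w) * Gamma (c + w - a - b) * rGamma (c + w - a) * rGamma (c + w - b))
      = (rGamma (c + w) * Gamma (c + w)) * (Gamma c * Gamma w * Gamma (c + w - a - b) * rGamma (c + w - a) * rGamma (c + w - b))"
      by (simp only: mult_ac)
    then show ?thesis using sums unfolding eq by (simp only: inv mult_1_left)
  qed
  show ?thesis
  proof (rule sums_beta_integral[OF C \<eta>(1,3) c _ _ S])
    show "((\<lambda>u. of_real u powr (w - 1) * of_real (1 - u) powr (c + of_nat n - 1)) has_integral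
          Gamma w * Gamma (c + of_nat n) * rGamma (w + (c + of_nat n))) {0..1}" for n
      by (rule has_integral_Beta_complex) (use c w in auto)
  qed (simp add: hyp2F1_conv_coeff mult_ac)
qed

section \<open>The kernel of the Saigo integral\<close>

lemma eval_fps_majorant:
  fixes f :: "complex fps"
  assumes hb: "\<And>n. cmod (fps_nth f n) \<le> C * binom_coeff \<eta> n" and \<eta>: "0 < \<eta>"
  shows "fps_conv_radius f \<ge> 1"
    and "0 < u \<Longrightarrow> u < 1 \<Longrightarrow> cmod (eval_fps f (of_real (1 - u))) \<le> C * u powr (- \<eta>)"
proof -
  have bs: "(\<lambda>n. C * (binom_coeff \<eta> n * z ^ n)) sums (C * (1 - z) powr (- \<eta>))" if "0 \<le> z" "z < 1" for z
    by (intro sums_mult binom_coeff_sums that)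
  have nb: "norm (fps_nth f n * complex_of_real z ^ n) \<le> C * (binom_coeff \<eta> n * z ^ n)" if "0 \<le> z" for z n
    using mult_right_mono[OF hb[of n], of "z ^ n"] that by (simp add: norm_mult norm_power mult_ac)
  have summ: "summable (\<lambda>n. norm (fps_nth f n * complex_of_real z ^ n))" if "0 \<le> z" "z < 1" for z
    by (rule summable_comparison_test'[OF sums_summable[OF bs[OF that]]]) (use nb[OF that(1)] in simp)
  show "fps_conv_radius f \<ge> 1"
    unfolding fps_conv_radius_def
    by (rule conv_radius_geI_ex') (intro summable_norm_cancel[OF summ], auto)
  assume u: "0 < u" "u < 1"
  have "cmod (eval_fps f (of_real (1 - u))) \<le> (\<Sum>n. norm (fps_nth f n * complex_of_real (1 - u) ^ n))"
    unfolding eval_fps_def by (intro summable_norm summ) (use u in auto)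
  also have "\<dots> \<le> (\<Sum>n. C * (binom_coeff \<eta> n * (1 - u) ^ n))"
    by (intro suminf_le nb summ sums_summable[OF bs]) (use u in auto)
  also have "\<dots> = C * (1 - (1 - u)) powr (- \<eta>)"
    by (rule sums_unique[OF bs, symmetric]) (use u in auto)
  finally show "cmod (eval_fps f (of_real (1 - u))) \<le> C * u powr (- \<eta>)" by simp
qed

text \<open>Differentiation takes \<open>(1 - z) powr (- \<eta>)\<close> to \<open>\<eta> * (1 - z) powr (- (\<eta> + 1))\<close>, and this holds for
  the comparison of coefficients as well.\<close>

lemma fps_deriv_majorant:
  fixes f :: "complex fps"
  assumes "\<And>n. cmod (fps_nth f n) \<le> C * binom_coeff \<eta> n"
  shows "cmod (fps_nth (fps_deriv f) n) \<le> (C * \<eta>) * binom_coeff (\<eta> + 1) n"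
proof -
  have "cmod (fps_nth (fps_deriv f) n) = real (Suc n) * cmod (fps_nth f (Suc n))"
    by (simp only: fps_deriv_nth norm_mult norm_of_nat Suc_eq_plus1)
  also have "\<dots> \<le> real (Suc n) * (C * binom_coeff \<eta> (Suc n))"
    by (intro mult_left_mono assms) auto
  also have "real (Suc n) * binom_coeff \<eta> (Suc n) = \<eta> * binom_coeff (\<eta> + 1) n"
    unfolding binom_coeff_def by (simp add: pochhammer_rec del: of_nat_Suc)
  then have "real (Suc n) * (C * binom_coeff \<eta> (Suc n)) = (C * \<eta>) * binom_coeff (\<eta> + 1) n"
    by (metis mult.assoc mult.left_commute)
  finally show ?thesis .
qed

text \<open>The kernel of the Saigo integral over \<open>[0, x]\<close> in the variable \<open>u = t / x\<close>, up to a power of \<open>x\<close>.\<close>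

definition saigo_kernel :: "complex \<Rightarrow> complex \<Rightarrow> complex \<Rightarrow> real \<Rightarrow> complex" where
  "saigo_kernel a b c u = of_real (1 - u) powr (c - 1) * hyp2F1 a b c (1 - complex_of_real u)"

text \<open>The factor \<open>(1 - u) powr (c - 1)\<close> is responsible for the singularity at \<open>u = 1\<close> and the
  hypergeometric function for the one at \<open>u = 0\<close>; a derivative makes each worse by one power.\<close>

lemma saigo_kernel_estimates:
  assumes c: "Re c > 0" and \<eta>: "\<eta> > 0" "Re (a + b - c) \<le> \<eta>"
  shows "\<exists>k' C. (\<forall>u\<in>{0<..<1}. (saigo_kernel a b c has_vector_derivative k' u) (at u)) \<and>
    continuous_on {0<..<1} k' \<and>
    (\<forall>u\<in>{0<..<1}. cmod (saigo_kernel a b c u) \<le> C * (u powr (- \<eta>) * (1 - u) powr (Re c - 1)) \<and>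
                   cmod (k' u) \<le> C * (u powr (- \<eta> - 1) * (1 - u) powr (Re c - 2)))"
proof -
  define f where "f = fps_hypergeo [a, b] [c] (1::complex)"
  define g where "g = fps_deriv f"
  obtain C where C: "\<And>n. cmod (fps_nth f n) \<le> C * binom_coeff \<eta> n"
    using hyp_coeff_majorant[OF nonpos_Ints_Re[OF c] \<eta>] by (auto simp: f_def hyp_coeff_def)
  have C0: "C \<ge> 0" using order.trans[OF norm_ge_zero C[of 0]] by (simp add: binom_coeff_def)
  have Cg: "cmod (fps_nth g n) \<le> (C * \<eta>) * binom_coeff (\<eta> + 1) n" for n
    unfolding g_def by (rule fps_deriv_majorant[OF C])
  have rad: "fps_conv_radius f \<ge> 1" by (rule eval_fps_majorant(1)[OF C \<eta>(1)])
  have radg: "fps_conv_radius g \<ge> 1" by (rule eval_fps_majorant(1)[OF Cg]) (use \<eta> in simp)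
  have inr: "ereal (cmod (1 - complex_of_real u)) < 1" if "u \<in> {0<..<1}" for u
  proof -
    have "cmod (1 - complex_of_real u) = \<bar>1 - u\<bar>" by (metis norm_of_real of_real_1 of_real_diff)
    then show ?thesis using that by simp
  qed
  note inf = less_le_trans[OF inr rad] and ing = less_le_trans[OF inr radg]
  define k' where "k' = (\<lambda>u. - ((c - 1) * of_real (1 - u) powr (c - 1 - 1)) * eval_fps f (of_real (1 - u))
        + of_real (1 - u) powr (c - 1) * (- eval_fps g (of_real (1 - u))))"
  have der: "(saigo_kernel a b c has_vector_derivative k' u) (at u)" if u: "u \<in> {0<..<1}" for u
  proof -
    have "((\<lambda>z. (1 - z) powr (c - 1)) has_field_derivative - ((c - 1) * (1 - complex_of_real u) powr (c - 1 - 1))) (at (complex_of_real u))"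
      using u by (auto intro!: derivative_eq_intros simp: complex_nonpos_Reals_iff)
    moreover have "((\<lambda>z. eval_fps f (1 - z)) has_field_derivative - eval_fps g (1 - complex_of_real u)) (at (complex_of_real u))"
    proof -
      have "(eval_fps f has_field_derivative eval_fps g (1 - complex_of_real u)) (at (1 - complex_of_real u))"
        unfolding g_def by (rule has_field_derivative_eval_fps) (rule inf[OF u])
      moreover have "((\<lambda>z. 1 - z) has_field_derivative (-1)) (at (complex_of_real u))"
        by (auto intro!: derivative_eq_intros)
      ultimately have "((\<lambda>z. eval_fps f (1 - z)) has_field_derivative eval_fps g (1 - complex_of_real u) * (-1)) (at (complex_of_real u))"
        by (rule DERIV_chain2[where f = "eval_fps f" and g = "\<lambda>z. 1 - z"])
      then show ?thesis by simp
    qed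
    ultimately have "((\<lambda>z. (1 - z) powr (c - 1) * eval_fps f (1 - z)) has_field_derivative
       (- ((c - 1) * (1 - complex_of_real u) powr (c - 1 - 1)) * eval_fps f (1 - complex_of_real u)
        + - eval_fps g (1 - complex_of_real u) * (1 - complex_of_real u) powr (c - 1))) (at (complex_of_real u))"
      by (rule DERIV_mult'[THEN DERIV_cong]) (simp add: mult_ac) 
    from has_vector_derivative_real_field[OF this]
    show ?thesis unfolding saigo_kernel_def hyp2F1_def f_def[symmetric] k'_def by (simp add: mult_ac)
  qed
  have cont: "continuous_on {0<..<1} k'"
  proof -
    have c1: "continuous_on {0<..<1} (\<lambda>u. eval_fps h (of_real (1 - u)))" if r: "fps_conv_radius h \<ge> 1" for h :: "complex fps"
    proof (rule continuous_on_compose2[OF continuous_on_eval_fps[of h]])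
      show "(\<lambda>u. complex_of_real (1 - u)) ` {0<..<1} \<subseteq> eball 0 (fps_conv_radius h)"
        using less_le_trans[OF inr r] by (auto simp: in_eball_iff)
    qed (intro continuous_intros)
    have c2: "continuous_on {0<..<1} (\<lambda>u. of_real (1 - u) powr s)" for s :: complex
      by (intro continuous_intros) auto
    show ?thesis unfolding k'_def
      by (intro continuous_on_add continuous_on_mult continuous_on_minus continuous_on_const c1 c2 rad radg)
  qed
  define D where "D = max C (cmod (c - 1) * C + C * \<eta>)"
  have b1: "cmod (saigo_kernel a b c u) \<le> D * (u powr (- \<eta>) * (1 - u) powr (Re c - 1))" if u: "u \<in> {0<..<1}" for u
  proof -
    have "cmod (saigo_kernel a b c u) = (1 - u) powr (Re c - 1) * cmod (eval_fps f (of_real (1 - u)))"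
      unfolding saigo_kernel_def hyp2F1_def f_def[symmetric] norm_mult using u by (subst cmod_powr_of_real) auto
    also have "\<dots> \<le> (1 - u) powr (Re c - 1) * (C * u powr (- \<eta>))"
      using u by (intro mult_left_mono eval_fps_majorant(2)[OF C \<eta>(1)]) auto
    also have "\<dots> = C * (u powr (- \<eta>) * (1 - u) powr (Re c - 1))" by simp
    also have "\<dots> \<le> D * (u powr (- \<eta>) * (1 - u) powr (Re c - 1))"
      by (intro mult_right_mono) (auto simp: D_def)
    finally show ?thesis .
  qed
  have b2: "cmod (k' u) \<le> D * (u powr (- \<eta> - 1) * (1 - u) powr (Re c - 2))" if u: "u \<in> {0<..<1}" for u
  proof -
    define W where "W = u powr (- \<eta> - 1) * (1 - u) powr (Re c - 2)"
    have le1: "(1 - u) powr (Re c - 2) * u powr (- \<eta>) \<le> W"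
      unfolding W_def using u powr_mono'[of "- \<eta> - 1" "- \<eta>" u] by (subst mult.commute) (intro mult_right_mono, auto)
    have le2: "(1 - u) powr (Re c - 1) * u powr (- (\<eta> + 1)) \<le> W"
      unfolding W_def using u powr_mono'[of "Re c - 2" "Re c - 1" "1 - u"] 
      by (subst mult.commute) (auto intro!: mult_left_mono simp: minus_diff_commute)
    have "cmod (k' u) \<le> cmod (c - 1) * (1 - u) powr (Re c - 2) * cmod (eval_fps f (of_real (1 - u)))
        + (1 - u) powr (Re c - 1) * cmod (eval_fps g (of_real (1 - u)))"
      unfolding k'_def using u
      by (intro order.trans[OF norm_triangle_ineq] add_mono)
         (auto simp: norm_mult cmod_powr_of_real simp flip: of_real_diff)
    also have "\<dots> \<le> cmod (c - 1) * (1 - u) powr (Re c - 2) * (C * u powr (- \<eta>))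
        + (1 - u) powr (Re c - 1) * ((C * \<eta>) * u powr (- (\<eta> + 1)))"
      using u \<eta> by (intro add_mono mult_left_mono eval_fps_majorant(2)[OF C] eval_fps_majorant(2)[OF Cg]) auto
    also have "\<dots> = cmod (c - 1) * C * ((1 - u) powr (Re c - 2) * u powr (- \<eta>))
        + (C * \<eta>) * ((1 - u) powr (Re c - 1) * u powr (- (\<eta> + 1)))" by (simp only: mult_ac)
    also have "\<dots> \<le> cmod (c - 1) * C * W + (C * \<eta>) * W"
      using C0 \<eta> by (intro add_mono mult_left_mono le1 le2) auto
    also have "\<dots> = (cmod (c - 1) * C + C * \<eta>) * W" by (simp only: distrib_right)
    also have "\<dots> \<le> D * W" by (intro mult_right_mono) (auto simp: D_def W_def)
    finally show ?thesis by (simp only: W_def)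
  qed
  show ?thesis using der cont b1 b2 by blast
qed

section \<open>Integration by parts against a singular kernel\<close>

text \<open>Interpolates between the bounds \<open>\<bar>t\<bar>\<close> and \<open>2\<close>.\<close>

lemma cmod_exp_i_minus_1_le:
  assumes "0 < \<delta>" "\<delta> \<le> 1"
  shows "cmod (exp (\<i> * of_real t) - 1) \<le> 2 * \<bar>t\<bar> powr \<delta>"
proof (cases "\<bar>t\<bar> \<le> 1")
  case True
  have "cmod (exp (\<i> * of_real t) - 1) \<le> \<bar>t\<bar>"
    using abs_sin_x_le_abs_x[of "t / 2"] unfolding dist_exp_i_1 by simp
  also have "\<bar>t\<bar> \<le> \<bar>t\<bar> powr \<delta>"
  proof (cases "t = 0")
    case False
    then show ?thesis using powr_mono'[of \<delta> 1 "\<bar>t\<bar>"] True assms by simp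
  qed simp
  also have "\<dots> \<le> 2 * \<bar>t\<bar> powr \<delta>" by simp
  finally show ?thesis .
next
  case False
  have "cmod (exp (\<i> * of_real t) - 1) \<le> 2 * 1" unfolding dist_exp_i_1 by (intro mult_left_mono abs_sin_le_one) auto
  also have "1 \<le> \<bar>t\<bar> powr \<delta>" using False assms by (intro ge_one_powr_ge_zero) auto
  finally show ?thesis by simp
qed

text \<open>The inequality \<open>ln x \<le> x - 1\<close> at \<open>x = u powr (- \<kappa>)\<close>. It keeps the simple zero of \<open>ln\<close> at \<open>u = 1\<close>,
  while the price at \<open>u = 0\<close> is an arbitrarily small power.\<close>

lemma minus_ln_le:
  assumes u: "0 < u" "u < (1::real)" and \<kappa>: "0 < \<kappa>" "\<kappa> \<le> 1"
  shows "\<bar>ln u\<bar> \<le> 1 / \<kappa> * u powr (- \<kappa>) * (1 - u)"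
proof -
  define v where "v = u powr \<kappa>"
  have v: "v > 0" using u by (simp add: v_def)
  have "u \<le> v" using powr_mono'[of \<kappa> 1 u] u \<kappa> by (simp add: v_def)
  have "\<kappa> * \<bar>ln u\<bar> = ln (1 / v)" using u by (simp add: v_def ln_div ln_powr abs_if)
  also have "\<dots> \<le> 1 / v - 1" using v by (intro ln_le_minus_one) auto
  also have "\<dots> = (1 / v) * (1 - v)" using v by (simp add: field_simps)
  also have "\<dots> \<le> (1 / v) * (1 - u)" using v \<open>u \<le> v\<close> by (intro mult_left_mono) auto
  also have "1 / v = u powr (- \<kappa>)" by (simp add: v_def powr_minus divide_inverse)
  finally show ?thesis using \<kappa> by (simp add: field_simps)
qed

text \<open>The two powers differ by the factor \<open>exp (\<i> * Im w * ln u)\<close>. The zero at \<open>u = 1\<close> of order \<open>\<delta>\<close> is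
  paid for by a factor \<open>\<bar>Im w\<bar> powr \<delta>\<close>.\<close>

lemma powr_diff_real_part_le:
  assumes u: "0 < u" "u < 1" and \<kappa>: "0 < \<kappa>" "\<kappa> \<le> 1" and \<delta>: "0 < \<delta>" "\<delta> \<le> 1"
  shows "cmod (of_real u powr w - of_real u powr complex_of_real (Re w))
     \<le> (2 * (1 / \<kappa>) powr \<delta>) * \<bar>Im w\<bar> powr \<delta> * (u powr (Re w - \<kappa> * \<delta>) * (1 - u) powr \<delta>)"
proof -
  have "of_real u powr w = of_real u powr complex_of_real (Re w) * exp (\<i> * of_real (Im w * ln u))"
    using u unfolding powr_def by (simp add: exp_add[symmetric] complex_eq_iff) (simp add: Ln_of_real Re_exp Im_exp exp_add)
  then have "of_real u powr w - of_real u powr complex_of_real (Re w) =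
      of_real u powr complex_of_real (Re w) * (exp (\<i> * of_real (Im w * ln u)) - 1)"
    by (simp add: algebra_simps)
  then have "cmod (of_real u powr w - of_real u powr complex_of_real (Re w)) =
      u powr Re w * cmod (exp (\<i> * of_real (Im w * ln u)) - 1)"
    using u by (simp only: norm_mult cmod_powr_of_real) simp
  also have "\<dots> \<le> u powr Re w * (2 * \<bar>Im w * ln u\<bar> powr \<delta>)"
    by (intro mult_left_mono cmod_exp_i_minus_1_le \<delta>) auto
  also have "\<bar>Im w * ln u\<bar> powr \<delta> \<le> (\<bar>Im w\<bar> * (1 / \<kappa> * u powr (- \<kappa>) * (1 - u))) powr \<delta>"
    unfolding abs_mult using \<delta> by (intro powr_mono2 mult_left_mono minus_ln_le u \<kappa>) auto
  also have "\<dots> = \<bar>Im w\<bar> powr \<delta> * ((1 / \<kappa>) powr \<delta> * u powr (- \<kappa> * \<delta>) * (1 - u) powr \<delta>)"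
    using u \<kappa> by (simp only: powr_mult powr_powr) 
  finally have "cmod (of_real u powr w - of_real u powr complex_of_real (Re w)) \<le>
      u powr Re w * (2 * (\<bar>Im w\<bar> powr \<delta> * ((1 / \<kappa>) powr \<delta> * u powr (- \<kappa> * \<delta>) * (1 - u) powr \<delta>)))"
    using u by (simp add: mult_left_mono)
  also have "u powr (Re w - \<kappa> * \<delta>) = u powr Re w * u powr (- \<kappa> * \<delta>)" unfolding powr_add[symmetric] by simp
  then have "u powr Re w * (2 * (\<bar>Im w\<bar> powr \<delta> * ((1 / \<kappa>) powr \<delta> * u powr (- \<kappa> * \<delta>) * (1 - u) powr \<delta>))) =
    (2 * (1 / \<kappa>) powr \<delta>) * \<bar>Im w\<bar> powr \<delta> * (u powr (Re w - \<kappa> * \<delta>) * (1 - u) powr \<delta>)"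
    by (simp only: mult_ac)
  finally show ?thesis .
qed

text \<open>The bound makes \<open>k * E\<close> continuous on the closed interval with the value 0 at both ends, so its
  derivative has a gauge integral, which is 0. Neither of the two terms need be integrable on its
  own.\<close>

lemma has_integral_singular_by_parts:
  fixes k E k' E' :: "real \<Rightarrow> complex"
  assumes k: "\<And>u. u \<in> {0<..<1} \<Longrightarrow> (k has_vector_derivative k' u) (at u)"
    and E: "\<And>u. u \<in> {0<..<1} \<Longrightarrow> (E has_vector_derivative E' u) (at u)"
    and bound: "\<And>u. u \<in> {0<..<1} \<Longrightarrow> cmod (k u * E u) \<le> C * (u powr s * (1 - u) powr t)"
    and st: "s > 0" "t > 0"
  shows "((\<lambda>u. k u * E' u + k' u * E u) has_integral 0) {0..1}"
proof -
  define \<Phi> where "\<Phi> = (\<lambda>u. if u \<in> {0<..<1} then k u * E u else 0)"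
  define g where "g = (\<lambda>u::real. C * (u powr s * (1 - u) powr t))"
  have der: "(\<Phi> has_vector_derivative (k u * E' u + k' u * E u)) (at u)" if u: "u \<in> {0<..<1}" for u
  proof (rule has_vector_derivative_transform_within_open[OF has_vector_derivative_mult[OF k[OF u] E[OF u]]])
    show "open {0<..<1::real}" by simp
  qed (use u in \<open>auto simp: \<Phi>_def\<close>)
  have gcont: "continuous_on {0..1} g" unfolding g_def using st
    by (intro continuous_on_mult continuous_on_const continuous_on_powr' continuous_on_id continuous_on_diff) auto
  have gb: "cmod (\<Phi> u) \<le> g u" if "u \<in> {0..1}" for u
    using bound[of u] that st by (cases "u \<in> {0<..<1}") (auto simp: \<Phi>_def g_def)
  have "continuous_on {0..1} \<Phi>"
    unfolding continuous_on_def
  proof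
    fix x :: real assume x: "x \<in> {0..1}"
    show "(\<Phi> \<longlongrightarrow> \<Phi> x) (at x within {0..1})"
    proof (cases "x \<in> {0<..<1}")
      case True
      then show ?thesis
        using has_vector_derivative_continuous[OF der[OF True]] by (auto simp: continuous_at intro: tendsto_within_subset)
    next
      case False
      then have "\<Phi> x = 0" "g x = 0" using x st by (auto simp: \<Phi>_def g_def)
      moreover have "(g \<longlongrightarrow> g x) (at x within {0..1})" using gcont x by (simp add: continuous_on_def)
      moreover have "eventually (\<lambda>u. cmod (\<Phi> u) \<le> g u) (at x within {0..1})"
        unfolding eventually_at_filter by (intro always_eventually) (auto intro: gb)
      ultimately show ?thesis by (simp add: Lim_null_comparison)
    qed
  qed
  from fundamental_theorem_of_calculus_interior[OF _ this der]
  have "((\<lambda>u. k u * E' u + k' u * E u) has_integral (\<Phi> 1 - \<Phi> 0)) {0..1}" by simp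
  then show ?thesis by (simp add: \<Phi>_def)
qed

lemma has_vector_derivative_powr_of_real:
  fixes w :: complex
  assumes "u > 0"
  shows "((\<lambda>u. of_real u powr w) has_vector_derivative (w * of_real u powr (w - 1))) (at u)"
proof -
  have "((\<lambda>z. z powr w) has_field_derivative (w * of_real u powr (w - 1))) (at (complex_of_real u))"
    using assms by (intro has_field_derivative_powr) (simp add: complex_nonpos_Reals_iff)
  then show ?thesis by (rule has_vector_derivative_real_field)
qed

lemma integrable_product:
  fixes A :: "real \<Rightarrow> real" and g :: "real \<Rightarrow> real"
  assumes A: "integrable lborel A" and g: "integrable lborel g"
  shows "integrable (lborel \<Otimes>\<^sub>M lborel) (\<lambda>(x, y). A x * g y)"
proof (rule lborel_pair.Fubini_integrable)
  have [measurable]: "A \<in> borel_measurable lborel" "g \<in> borel_measurable lborel" using A g by auto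
  show "(\<lambda>(x, y). A x * g y) \<in> borel_measurable (lborel \<Otimes>\<^sub>M lborel)" by measurable
  show "integrable lborel (\<lambda>x. \<integral>y. norm (case (x, y) of (x, y) \<Rightarrow> A x * g y) \<partial>lborel)"
    using A by (simp add: abs_mult)
  show "AE x in lborel. integrable lborel (\<lambda>y. case (x, y) of (x, y) \<Rightarrow> A x * g y)"
    using g by simp
qed

text \<open>Let \<open>E u = H u - u powr r * \<integral> q\<close>, which is the superposition of the differences
  \<open>u powr w - u powr r\<close>. Integration by parts turns \<open>k * E'\<close> into \<open>- k' * E\<close>, where the integrand has
  an absolutely convergent double integral, so that Fubini applies. The inner integrals are found by
  the same integration by parts, now for a single power. All irregularity of \<open>H'\<close> is confined to
  \<open>(k * E)'\<close>, which has a gauge integral because it is a derivative.\<close>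

theorem has_integral_kernel_times_derivative:
  fixes k k' H H' :: "real \<Rightarrow> complex" and q :: "real \<Rightarrow> complex" and y :: "real \<Rightarrow> real" and B :: "complex \<Rightarrow> complex"
  assumes k: "\<And>u. u \<in> {0<..<1} \<Longrightarrow> (k has_vector_derivative k' u) (at u)"
    and k'c: "continuous_on {0<..<1} k'"
    and kb: "\<And>u. u \<in> {0<..<1} \<Longrightarrow> cmod (k u) \<le> C * (u powr (- \<eta>) * (1 - u) powr (p - 1))"
    and kb': "\<And>u. u \<in> {0<..<1} \<Longrightarrow> cmod (k' u) \<le> C * (u powr (- \<eta> - 1) * (1 - u) powr (p - 2))"
    and \<eta>: "0 < \<eta>" "\<eta> < r" and p: "p > 0"
    and B: "\<And>w. Re w = r \<Longrightarrow> ((\<lambda>u. k u * of_real u powr (w - 1)) has_integral B w) {0..1}"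
    and y [measurable]: "y \<in> borel_measurable borel"
    and \<delta>: "0 < \<delta>" "\<delta> \<le> 1" "1 - p < \<delta>"
    and q: "integrable lborel q" and q\<delta>: "integrable lborel (\<lambda>\<tau>. q \<tau> * complex_of_real (\<bar>y \<tau>\<bar> powr \<delta>))"
    and H: "\<And>u. u \<in> {0<..<1} \<Longrightarrow> H u = (LINT \<tau>|lborel. q \<tau> * of_real u powr (Complex r (y \<tau>)))"
    and H': "\<And>u. u \<in> {0<..<1} \<Longrightarrow> (H has_vector_derivative H' u) (at u)"
  shows "((\<lambda>u. k u * H' u) has_integral (LINT \<tau>|lborel. q \<tau> * (Complex r (y \<tau>) * B (Complex r (y \<tau>))))) {0..1}"
proof -
  define w where "w = (\<lambda>\<tau>. Complex r (y \<tau>))"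
  define R where "R = complex_of_real r"
  have wr: "Re (w \<tau>) = r" "Im (w \<tau>) = y \<tau>" and Rr: "Re R = r" "Im R = 0" for \<tau> by (simp_all add: w_def R_def)
  have qm [measurable]: "q \<in> borel_measurable borel" using q by auto
  \<comment> \<open>small enough for the loss at \<open>u = 0\<close> to stay below \<open>r - \<eta>\<close>\<close>
  define \<kappa> where "\<kappa> = min 1 ((r - \<eta>) / (2 * \<delta>))"
  have \<kappa>: "0 < \<kappa>" "\<kappa> \<le> 1" using \<eta> \<delta> by (auto simp: \<kappa>_def)
  have "\<kappa> * \<delta> \<le> (r - \<eta>) / (2 * \<delta>) * \<delta>" using \<delta> by (intro mult_right_mono) (auto simp: \<kappa>_def)
  then have "\<kappa> * \<delta> \<le> (r - \<eta>) / 2" using \<delta> by simp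
  then have s: "r - \<kappa> * \<delta> - \<eta> > 0" using \<eta> by (simp add: field_simps)
  define K where "K = 2 * (1 / \<kappa>) powr \<delta>"
  define s where "s = r - \<kappa> * \<delta>"
  define e where "e = (\<lambda>\<tau> u. of_real u powr w \<tau> - of_real u powr R)"
  have eb: "cmod (e \<tau> u) \<le> K * \<bar>y \<tau>\<bar> powr \<delta> * (u powr s * (1 - u) powr \<delta>)" if "u \<in> {0<..<1}" for \<tau> u
    using powr_diff_real_part_le[of u \<kappa> \<delta> "w \<tau>"] that \<kappa> \<delta> by (simp add: e_def wr R_def K_def s_def)
  have C0: "C \<ge> 0"
  proof (rule ccontr)
    assume "\<not> C \<ge> 0"
    then have "C * ((1/2) powr (- \<eta>) * (1 - 1/2) powr (p - 1)) < 0" by (intro mult_neg_pos) auto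
    then show False using order.trans[OF norm_ge_zero kb[of "1/2"]] by auto
  qed
  have K0: "K \<ge> 0" by (simp add: K_def)
  have der_pow: "((\<lambda>u. of_real u powr v) has_vector_derivative (v * of_real u powr (v - 1))) (at u)"
    if "u \<in> {0<..<1}" for u and v :: complex using that by (intro has_vector_derivative_powr_of_real) auto
  have kE_bound: "cmod (k u * E) \<le> (C * D) * (u powr (s - \<eta>) * (1 - u) powr (p - 1 + \<delta>))"
    and k'E_bound: "cmod (k' u * E) \<le> (C * D) * (u powr (s - \<eta> - 1) * (1 - u) powr (p + \<delta> - 1 - 1))"
    if u: "u \<in> {0<..<1}" and E: "cmod E \<le> D * (u powr s * (1 - u) powr \<delta>)" for u E D
  proof -
    have "cmod (k u * E) \<le> (C * (u powr (- \<eta>) * (1 - u) powr (p - 1))) * (D * (u powr s * (1 - u) powr \<delta>))"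
      unfolding norm_mult using C0 by (intro mult_mono kb u E) auto
    also have "\<dots> = (C * D) * ((u powr s * u powr (- \<eta>)) * ((1 - u) powr (p - 1) * (1 - u) powr \<delta>))" by (simp only: mult_ac)
    also have "\<dots> = (C * D) * (u powr (s - \<eta>) * (1 - u) powr (p - 1 + \<delta>))" unfolding powr_add[symmetric] by simp
    finally show "cmod (k u * E) \<le> (C * D) * (u powr (s - \<eta>) * (1 - u) powr (p - 1 + \<delta>))" .
    have "cmod (k' u * E) \<le> (C * (u powr (- \<eta> - 1) * (1 - u) powr (p - 2))) * (D * (u powr s * (1 - u) powr \<delta>))"
      unfolding norm_mult using C0 by (intro mult_mono kb' u E) auto
    also have "\<dots> = (C * D) * ((u powr s * u powr (- \<eta> - 1)) * ((1 - u) powr (p - 2) * (1 - u) powr \<delta>))" by (simp only: mult_ac)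
    also have "\<dots> = (C * D) * (u powr (s - \<eta> - 1) * (1 - u) powr (p + \<delta> - 1 - 1))" unfolding powr_add[symmetric] by (simp add: algebra_simps)
    finally show "cmod (k' u * E) \<le> (C * D) * (u powr (s - \<eta> - 1) * (1 - u) powr (p + \<delta> - 1 - 1))" .
  qed
  \<comment> \<open>integration by parts for a single power evaluates the inner integrals of the double integral below\<close>
  have single: "((\<lambda>u. k' u * e \<tau> u) has_integral (R * B R - w \<tau> * B (w \<tau>))) {0..1}" for \<tau>
  proof -
    define e' where "e' = (\<lambda>u. w \<tau> * of_real u powr (w \<tau> - 1) - R * of_real u powr (R - 1))"
    have "((\<lambda>u. k u * e' u + k' u * e \<tau> u) has_integral 0) {0..1}"
    proof (rule has_integral_singular_by_parts[OF k])
      show "(e \<tau> has_vector_derivative e' u) (at u)" if "u \<in> {0<..<1}" for u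
        unfolding e_def e'_def by (intro has_vector_derivative_diff der_pow that)
      show "cmod (k u * e \<tau> u) \<le> (C * (K * \<bar>y \<tau>\<bar> powr \<delta>)) * (u powr (s - \<eta>) * (1 - u) powr (p - 1 + \<delta>))" if "u \<in> {0<..<1}" for u
        by (rule kE_bound[OF that eb[OF that]])
    qed (use s \<delta> in \<open>auto simp: s_def\<close>)
    moreover have "((\<lambda>u. w \<tau> * (k u * of_real u powr (w \<tau> - 1)) - R * (k u * of_real u powr (R - 1)))
        has_integral (w \<tau> * B (w \<tau>) - R * B R)) {0..1}"
      by (intro has_integral_diff has_integral_mult_right B wr Rr)
    ultimately have "((\<lambda>u. (k u * e' u + k' u * e \<tau> u) - (w \<tau> * (k u * of_real u powr (w \<tau> - 1)) - R * (k u * of_real u powr (R - 1))))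
        has_integral (0 - (w \<tau> * B (w \<tau>) - R * B R))) {0..1}"
      by (rule has_integral_diff)
    moreover have "(k u * e' u + k' u * e \<tau> u) - (w \<tau> * (k u * of_real u powr (w \<tau> - 1)) - R * (k u * of_real u powr (R - 1)))
       = k' u * e \<tau> u" for u by (simp add: e'_def algebra_simps)
    ultimately show ?thesis by simp
  qed
  define A where "A = (\<lambda>\<tau>. cmod (q \<tau> * complex_of_real (\<bar>y \<tau>\<bar> powr \<delta>)))"
  have A: "integrable lborel A" unfolding A_def by (rule integrable_norm[OF q\<delta>])
  define H1 where "H1 = (LINT \<tau>|lborel. q \<tau>)"
  define E where "E = (\<lambda>u. H u - of_real u powr R * H1)"
  define E' where "E' = (\<lambda>u. H' u - R * of_real u powr (R - 1) * H1)"
  have qw: "integrable lborel (\<lambda>\<tau>. q \<tau> * of_real u powr w \<tau>)" if u: "u \<in> {0<..<1}" for u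
  proof (rule Bochner_Integration.integrable_bound[OF integrable_scaleR_right[of "u powr r", OF q]])
    have "(\<lambda>\<tau>. q \<tau> * exp (Complex r (y \<tau>) * complex_of_real (ln u))) \<in> borel_measurable borel"
      unfolding Complex_eq by measurable
    moreover have "of_real u powr w \<tau> = exp (Complex r (y \<tau>) * complex_of_real (ln u))" for \<tau>
      using u by (simp add: powr_def w_def Ln_of_real)
    ultimately show "(\<lambda>\<tau>. q \<tau> * of_real u powr w \<tau>) \<in> borel_measurable lborel" by simp
    show "AE \<tau> in lborel. cmod (q \<tau> * of_real u powr w \<tau>) \<le> norm (u powr r *\<^sub>R q \<tau>)"
      using u by (intro AE_I2) (simp add: norm_mult cmod_powr_of_real wr)
  qed
  have Eint: "E u = (LINT \<tau>|lborel. q \<tau> * e \<tau> u)" if u: "u \<in> {0<..<1}" for u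
  proof -
    have Hw: "H u = (LINT \<tau>|lborel. q \<tau> * of_real u powr w \<tau>)"
      using H[OF u] by (simp add: w_def)
    have "(LINT \<tau>|lborel. q \<tau> * e \<tau> u) = (LINT \<tau>|lborel. q \<tau> * of_real u powr w \<tau> - q \<tau> * of_real u powr R)"
      by (simp add: e_def right_diff_distrib)
    also have "\<dots> = H u - (LINT \<tau>|lborel. q \<tau> * of_real u powr R)"
      unfolding Hw using q by (intro Bochner_Integration.integral_diff qw u) auto
    finally show ?thesis by (simp add: E_def H1_def mult.commute)
  qed
  have Ebound: "cmod (E u) \<le> (K * integral\<^sup>L lborel A) * (u powr s * (1 - u) powr \<delta>)" if u: "u \<in> {0<..<1}" for u
  proof -
    have "cmod (E u) \<le> (LINT \<tau>|lborel. (K * (u powr s * (1 - u) powr \<delta>)) * A \<tau>)"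
      unfolding Eint[OF u]
    proof (rule Bochner_Integration.integral_norm_bound_integral)
      show "integrable lborel (\<lambda>\<tau>. q \<tau> * e \<tau> u)"
        unfolding e_def right_diff_distrib using q by (intro Bochner_Integration.integrable_diff qw u) auto
      show "integrable lborel (\<lambda>\<tau>. (K * (u powr s * (1 - u) powr \<delta>)) * A \<tau>)" using A by simp
      show "cmod (q \<tau> * e \<tau> u) \<le> (K * (u powr s * (1 - u) powr \<delta>)) * A \<tau>" for \<tau>
        using mult_left_mono[OF eb[OF u, of \<tau>], of "cmod (q \<tau>)"]
        by (simp add: norm_mult A_def mult_ac)
    qed
    then show ?thesis by (simp add: mult_ac)
  qed
  have EE': "((\<lambda>u. k u * E' u + k' u * E u) has_integral 0) {0..1}"
  proof (rule has_integral_singular_by_parts[OF k])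
    show "(E has_vector_derivative E' u) (at u)" if "u \<in> {0<..<1}" for u
      unfolding E_def E'_def by (intro has_vector_derivative_diff has_vector_derivative_mult_left der_pow H' that)
    show "cmod (k u * E u) \<le> (C * (K * integral\<^sup>L lborel A)) * (u powr (s - \<eta>) * (1 - u) powr (p - 1 + \<delta>))" if "u \<in> {0<..<1}" for u
      by (rule kE_bound[OF that Ebound[OF that]])
  qed (use s \<delta> in \<open>auto simp: s_def\<close>)
  \<comment> \<open>\<open>F\<close> is dominated by the product of an integrable function of \<open>\<tau>\<close> and a Beta integrand in \<open>u\<close>\<close>
  define g where "g = (\<lambda>u. indicator {0..1} u *\<^sub>R (u powr (s - \<eta> - 1) * (1 - u) powr (p + \<delta> - 1 - 1)))"
  have g: "integrable lborel g"
    using integrable_Beta[of "s - \<eta>" "p + \<delta> - 1"] s \<delta> unfolding g_def set_integrable_def by (simp add: s_def)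
  define F where "F = (\<lambda>\<tau> u. q \<tau> * (indicator {0<..<1} u *\<^sub>R (k' u * e \<tau> u)))"
  have Fb: "cmod (F \<tau> u) \<le> C * K * (A \<tau> * g u)" for \<tau> u
  proof (cases "u \<in> {0<..<1}")
    case True
    have "cmod (F \<tau> u) = cmod (q \<tau>) * cmod (k' u * e \<tau> u)" using True by (simp add: F_def norm_mult)
    also have "\<dots> \<le> cmod (q \<tau>) * ((C * (K * \<bar>y \<tau>\<bar> powr \<delta>)) * (u powr (s - \<eta> - 1) * (1 - u) powr (p + \<delta> - 1 - 1)))"
      by (intro mult_left_mono k'E_bound[OF True eb[OF True]]) auto
    also have "\<dots> = C * K * (A \<tau> * g u)" using True by (simp add: A_def g_def norm_mult mult_ac)
    finally show ?thesis .
  qed (use C0 K0 in \<open>auto simp: F_def A_def g_def\<close>)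
  have Fm: "case_prod F \<in> borel_measurable (lborel \<Otimes>\<^sub>M lborel)"
  proof -
    have [measurable]: "(\<lambda>u. indicator {0<..<1} u *\<^sub>R k' u) \<in> borel_measurable borel"
      by (intro borel_measurable_continuous_on_indicator k'c) simp
    have "(\<lambda>(\<tau>, u). q \<tau> * ((indicator {0<..<1} u *\<^sub>R k' u) * (exp (Complex r (y \<tau>) * complex_of_real (ln u)) - exp (R * complex_of_real (ln u)))))
        \<in> borel_measurable (lborel \<Otimes>\<^sub>M lborel)"
      unfolding Complex_eq by measurable
    also have "(\<lambda>(\<tau>, u). q \<tau> * ((indicator {0<..<1} u *\<^sub>R k' u) * (exp (Complex r (y \<tau>) * complex_of_real (ln u)) - exp (R * complex_of_real (ln u))))) = case_prod F"
      by (auto simp: fun_eq_iff F_def e_def indicator_def powr_def w_def Ln_of_real)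
    finally show ?thesis .
  qed
  have Fint: "integrable (lborel \<Otimes>\<^sub>M lborel) (case_prod F)"
  proof (rule Bochner_Integration.integrable_bound[OF _ Fm])
    show "integrable (lborel \<Otimes>\<^sub>M lborel) (\<lambda>x. C * K * (case x of (\<tau>, u) \<Rightarrow> A \<tau> * g u))"
      by (intro integrable_mult_right integrable_product A g)
    show "AE x in lborel \<Otimes>\<^sub>M lborel. cmod (case_prod F x) \<le> norm (C * K * (case x of (\<tau>, u) \<Rightarrow> A \<tau> * g u))"
      by (intro AE_I2) (auto intro: order.trans[OF Fb])
  qed
  have inner1: "(LINT u|lborel. F \<tau> u) = q \<tau> * (R * B R - w \<tau> * B (w \<tau>))" for \<tau>
  proof -
    have "set_integrable lborel {0<..<1} (\<lambda>u. k' u * e \<tau> u)"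
      unfolding set_integrable_def
    proof (rule Bochner_Integration.integrable_bound)
      show "integrable lborel (\<lambda>u. C * (K * \<bar>y \<tau>\<bar> powr \<delta>) * g u)" using g by simp
      have "continuous_on {0<..<1} (\<lambda>u. k' u * e \<tau> u)"
        unfolding e_def by (intro continuous_intros k'c) auto
      then have "(\<lambda>u. indicator {0<..<1} u *\<^sub>R (k' u * e \<tau> u)) \<in> borel_measurable borel"
        by (rule borel_measurable_continuous_on_indicator[rotated]) simp
      then show "(\<lambda>u. indicator {0<..<1} u *\<^sub>R (k' u * e \<tau> u)) \<in> borel_measurable lborel"
        by simp
      show "AE u in lborel. norm (indicator {0<..<1} u *\<^sub>R (k' u * e \<tau> u)) \<le> norm (C * (K * \<bar>y \<tau>\<bar> powr \<delta>) * g u)"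
      proof (intro AE_I2)
        fix u
        show "norm (indicator {0<..<1} u *\<^sub>R (k' u * e \<tau> u)) \<le> norm (C * (K * \<bar>y \<tau>\<bar> powr \<delta>) * g u)"
        proof (cases "u \<in> {0<..<1}")
          case True
          have "norm (indicator {0<..<1} u *\<^sub>R (k' u * e \<tau> u)) \<le> C * (K * \<bar>y \<tau>\<bar> powr \<delta>) * g u"
            using k'E_bound[OF True eb[OF True, of \<tau>]] True by (simp add: g_def)
          then show ?thesis by simp
        qed simp
      qed
    qed
    then have "(LINT u:{0<..<1}|lborel. k' u * e \<tau> u) = integral {0<..<1} (\<lambda>u. k' u * e \<tau> u)"
      by (rule set_borel_integral_eq_integral)
    also have "\<dots> = R * B R - w \<tau> * B (w \<tau>)"
      using single[of \<tau>] unfolding has_integral_Icc_iff_Ioo by (rule integral_unique)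
    finally have "(LINT u|lborel. indicator {0<..<1} u *\<^sub>R (k' u * e \<tau> u)) = R * B R - w \<tau> * B (w \<tau>)"
      unfolding set_lebesgue_integral_def .
    then show ?thesis unfolding F_def integral_mult_right_zero by simp
  qed
  have inner2: "(LINT \<tau>|lborel. F \<tau> u) = indicator {0<..<1} u *\<^sub>R (k' u * E u)" for u
  proof (cases "u \<in> {0<..<1}")
    case True
    have "F \<tau> u = k' u * (q \<tau> * e \<tau> u)" for \<tau> using True by (simp add: F_def mult_ac)
    then show ?thesis using True Eint[OF True] by simp
  qed (simp add: F_def)
  have i1: "integrable lborel (\<lambda>\<tau>. q \<tau> * (R * B R - w \<tau> * B (w \<tau>)))"
    using lborel_pair.integrable_fst'[OF Fint] by (simp add: inner1)
  have i2: "integrable lborel (\<lambda>u. indicator {0<..<1} u *\<^sub>R (k' u * E u))"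
    using lborel_pair.integrable_snd[OF Fint] by (simp add: inner2)
  have "(LINT u|lborel. indicator {0<..<1} u *\<^sub>R (k' u * E u)) = (LINT \<tau>|lborel. q \<tau> * (R * B R - w \<tau> * B (w \<tau>)))"
    using lborel_pair.Fubini_integral[OF Fint] by (simp add: inner1 inner2)
  moreover have "((\<lambda>u. k' u * E u) has_integral (LINT u|lborel. indicator {0<..<1} u *\<^sub>R (k' u * E u))) {0..1}"
    unfolding has_integral_Icc_iff_Ioo
    using set_borel_integral_eq_integral[of "{0<..<1}" "\<lambda>u. k' u * E u"] i2
    unfolding set_integrable_def set_lebesgue_integral_def by (simp add: has_integral_iff)
  ultimately have k'E: "((\<lambda>u. k' u * E u) has_integral (LINT \<tau>|lborel. q \<tau> * (R * B R - w \<tau> * B (w \<tau>)))) {0..1}"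
    by simp
  have kR: "((\<lambda>u. (k u * of_real u powr (R - 1)) * (R * H1)) has_integral (B R * (R * H1))) {0..1}"
    by (intro has_integral_mult_left B Rr)
  have "((\<lambda>u. (k u * E' u + k' u * E u) - k' u * E u + (k u * of_real u powr (R - 1)) * (R * H1)) has_integral
      (0 - (LINT \<tau>|lborel. q \<tau> * (R * B R - w \<tau> * B (w \<tau>))) + B R * (R * H1))) {0..1}"
    by (intro has_integral_add has_integral_diff EE' k'E kR)
  moreover have "(k u * E' u + k' u * E u) - k' u * E u + (k u * of_real u powr (R - 1)) * (R * H1) = k u * H' u" for u
    by (simp add: E'_def algebra_simps)
  moreover have "0 - (LINT \<tau>|lborel. q \<tau> * (R * B R - w \<tau> * B (w \<tau>))) + B R * (R * H1) = (LINT \<tau>|lborel. q \<tau> * (w \<tau> * B (w \<tau>)))"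
  proof -
    have "(LINT \<tau>|lborel. q \<tau> * (w \<tau> * B (w \<tau>))) =
      (LINT \<tau>|lborel. q \<tau> * (B R * R) - q \<tau> * (R * B R - w \<tau> * B (w \<tau>)))"
      by (simp add: algebra_simps)
    also have "\<dots> = (LINT \<tau>|lborel. q \<tau> * (B R * R)) - (LINT \<tau>|lborel. q \<tau> * (R * B R - w \<tau> * B (w \<tau>)))"
      using q by (intro Bochner_Integration.integral_diff i1) simp
    finally show ?thesis by (simp add: H1_def mult_ac)
  qed
  ultimately show ?thesis by (simp add: w_def)
qed

section \<open>Differentiation under the integral sign\<close>

text \<open>The mean value inequality. Adding the values at both ends covers increasing and decreasing
  powers alike.\<close>

lemma cmod_powr_diff_le:
  assumes a: "0 < a" and x: "x \<in> {a..b}" and y: "y \<in> {a..b}"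
  shows "cmod (of_real x powr v - of_real y powr v)
     \<le> cmod v * (a powr (Re v - 1) + b powr (Re v - 1)) * \<bar>x - y\<bar>"
proof -
  have "a \<le> b" using x by simp
  define S where "S = closed_segment (complex_of_real a) (complex_of_real b)"
  have S: "S = complex_of_real ` {a..b}"
    unfolding S_def closed_segment_of_real closed_segment_eq_real_ivl using \<open>a \<le> b\<close> by simp
  have "cmod (of_real x powr v - of_real y powr v)
     \<le> cmod v * (a powr (Re v - 1) + b powr (Re v - 1)) * cmod (complex_of_real x - complex_of_real y)"
  proof (rule field_differentiable_bound[where S = S and f' = "\<lambda>z. v * z powr (v - 1)"])
    show "convex S" unfolding S_def by (rule convex_closed_segment)
    show "complex_of_real x \<in> S" "complex_of_real y \<in> S" using x y S by auto
    fix z assume "z \<in> S"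
    then obtain s where s: "z = complex_of_real s" "s \<in> {a..b}" using S by auto
    then have sp: "s > 0" using a by simp
    show "((\<lambda>z. z powr v) has_field_derivative v * z powr (v - 1)) (at z within S)"
      by (rule has_field_derivative_at_within, rule has_field_derivative_powr)
         (use s sp in \<open>simp add: complex_nonpos_Reals_iff\<close>)
    have "s powr (Re v - 1) \<le> a powr (Re v - 1) + b powr (Re v - 1)"
    proof (cases "Re v - 1 \<ge> 0")
      case True
      then have "s powr (Re v - 1) \<le> b powr (Re v - 1)" using s sp by (intro powr_mono2) auto
      then show ?thesis by (simp add: add_increasing)
    next
      case False
      then have "s powr (Re v - 1) \<le> a powr (Re v - 1)" using s sp a by (intro powr_mono2') auto
      then show ?thesis by (simp add: add_increasing2)
    qed
    then show "cmod (v * z powr (v - 1)) \<le> cmod v * (a powr (Re v - 1) + b powr (Re v - 1))"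
      unfolding norm_mult s(1) using sp by (intro mult_left_mono) (simp_all add: cmod_powr_of_real)
  qed
  also have "cmod (complex_of_real x - complex_of_real y) = \<bar>x - y\<bar>"
    by (metis norm_of_real of_real_diff)
  finally show ?thesis .
qed

lemma powr_measurable_exponent:
  fixes v :: "real \<Rightarrow> complex"
  assumes [measurable]: "v \<in> borel_measurable borel" and "t > 0"
  shows "(\<lambda>\<tau>. of_real t powr v \<tau>) \<in> borel_measurable borel"
proof -
  have "(\<lambda>\<tau>. exp (v \<tau> * complex_of_real (ln t))) \<in> borel_measurable borel" by measurable
  moreover have "of_real t powr v \<tau> = exp (v \<tau> * complex_of_real (ln t))" for \<tau>
    using \<open>t > 0\<close> by (simp add: powr_def Ln_of_real)
  ultimately show ?thesis by simp
qed

lemma integrable_mult_powr: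
  fixes c v :: "real \<Rightarrow> complex"
  assumes c: "integrable lborel c" and v: "v \<in> borel_measurable borel" and r: "\<And>\<tau>. Re (v \<tau>) = r" and t: "t > 0"
  shows "integrable lborel (\<lambda>\<tau>. c \<tau> * of_real t powr v \<tau>)"
proof (rule Bochner_Integration.integrable_bound[OF integrable_scaleR_right[of "t powr r", OF c]])
  have [measurable]: "c \<in> borel_measurable borel" using c by auto
  have [measurable]: "(\<lambda>\<tau>. of_real t powr v \<tau>) \<in> borel_measurable borel" by (rule powr_measurable_exponent[OF v t])
  show "(\<lambda>\<tau>. c \<tau> * of_real t powr v \<tau>) \<in> borel_measurable lborel" by measurable
  show "AE \<tau> in lborel. norm (c \<tau> * of_real t powr v \<tau>) \<le> norm (t powr r *\<^sub>R c \<tau>)"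
    using t by (intro AE_I2) (simp add: norm_mult cmod_powr_of_real r)
qed

text \<open>Dominated convergence for the difference quotients, along sequences that stay in
  \<open>[t / 2, 2 t]\<close>. The real part of the exponent is constant, so one multiple of \<open>\<bar>c * v\<bar>\<close> bounds all
  quotients.\<close>

lemma has_vector_derivative_powr_integral:
  fixes c v :: "real \<Rightarrow> complex"
  assumes c: "integrable lborel c" and cv: "integrable lborel (\<lambda>\<tau>. c \<tau> * v \<tau>)"
    and v: "v \<in> borel_measurable borel" and r: "\<And>\<tau>. Re (v \<tau>) = r" and t: "t > 0"
  shows "((\<lambda>t. LINT \<tau>|lborel. c \<tau> * of_real t powr v \<tau>) has_vector_derivative
          (LINT \<tau>|lborel. c \<tau> * v \<tau> * of_real t powr (v \<tau> - 1))) (at t)"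
proof -
  let ?F = "\<lambda>t. LINT \<tau>|lborel. c \<tau> * of_real t powr v \<tau>"
  let ?D = "LINT \<tau>|lborel. c \<tau> * v \<tau> * of_real t powr (v \<tau> - 1)"
  have v1: "(\<lambda>\<tau>. v \<tau> - 1) \<in> borel_measurable borel" using v by simp
  have cm [measurable]: "c \<in> borel_measurable borel" "v \<in> borel_measurable borel" using c v by auto
  have Dint: "integrable lborel (\<lambda>\<tau>. c \<tau> * v \<tau> * of_real t powr (v \<tau> - 1))"
    by (rule integrable_mult_powr[OF cv v1 _ t, of "r - 1"]) (simp add: r)
  have "((\<lambda>x. norm ((?F x - ?F t) - (x - t) *\<^sub>R ?D) / norm (x - t)) \<longlongrightarrow> 0) (at t)"
    unfolding tendsto_at_iff_sequentially comp_def
  proof (intro allI impI)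
    fix X :: "nat \<Rightarrow> real" assume X0: "\<forall>i. X i \<in> UNIV - {t}" and Xlim: "X \<longlonglongrightarrow> t"
    have "eventually (\<lambda>i. X i \<in> {t/2<..<2*t}) sequentially"
      using Xlim t by (intro topological_tendstoD) auto
    then obtain i0 where i0: "\<And>i. i \<ge> i0 \<Longrightarrow> X i \<in> {t/2<..<2*t}" by (auto simp: eventually_sequentially)
    define Z where "Z = (\<lambda>i. X (i + i0))"
    have Z: "Z i \<in> {t/2..2*t}" "Z i \<noteq> t" "Z i > 0" for i using i0[of "i + i0"] X0 t by (auto simp: Z_def)
    have Zlim: "Z \<longlonglongrightarrow> t" unfolding Z_def by (rule LIMSEQ_ignore_initial_segment[OF Xlim])
    define d where "d = (\<lambda>i \<tau>. of_real (Z i) powr v \<tau> - of_real t powr v \<tau>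
        - (Z i - t) *\<^sub>R (v \<tau> * of_real t powr (v \<tau> - 1)))"
    define s where "s = (\<lambda>i \<tau>. c \<tau> * (d i \<tau> / complex_of_real (Z i - t)))"
    define M where "M = (t/2) powr (r - 1) + (2*t) powr (r - 1) + t powr (r - 1)"
    have pm: "(\<lambda>\<tau>. of_real x powr v \<tau>) \<in> borel_measurable borel" "(\<lambda>\<tau>. of_real x powr (v \<tau> - 1)) \<in> borel_measurable borel" if "x > 0" for x
      using powr_measurable_exponent[OF v that] powr_measurable_exponent[OF v1 that] by auto
    have lim0: "(\<lambda>i. integral\<^sup>L lborel (s i)) \<longlonglongrightarrow> integral\<^sup>L lborel (\<lambda>\<tau>::real. 0)"
    proof (rule integral_dominated_convergence)
      show "integrable lborel (\<lambda>\<tau>. M * cmod (c \<tau> * v \<tau>))" using integrable_norm[OF cv] by simp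
      note [measurable] = pm[OF Z(3)] pm[OF t]
      show "s i \<in> borel_measurable lborel" for i unfolding s_def d_def by measurable
      show "AE \<tau> in lborel. (\<lambda>i. s i \<tau>) \<longlonglongrightarrow> 0"
      proof (intro AE_I2)
        fix \<tau>
        have "((\<lambda>u. of_real u powr v \<tau>) has_vector_derivative (v \<tau> * of_real t powr (v \<tau> - 1))) (at t)"
          by (rule has_vector_derivative_powr_of_real[OF t])
        then have "((\<lambda>x. norm ((of_real x powr v \<tau> - of_real t powr v \<tau>) - (x - t) *\<^sub>R (v \<tau> * of_real t powr (v \<tau> - 1))) / norm (x - t)) \<longlongrightarrow> 0) (at t)"
          unfolding has_vector_derivative_def has_derivative_iff_norm by blast
        then have "(\<lambda>i. norm (d i \<tau>) / norm (Z i - t)) \<longlonglongrightarrow> 0"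
          unfolding tendsto_at_iff_sequentially comp_def d_def using Z(2) Zlim by auto
        then have "(\<lambda>i. norm (d i \<tau> / complex_of_real (Z i - t))) \<longlonglongrightarrow> 0"
          unfolding norm_divide norm_of_real real_norm_def .
        then have "(\<lambda>i. d i \<tau> / complex_of_real (Z i - t)) \<longlonglongrightarrow> 0"
          by (rule tendsto_norm_zero_cancel)
        then show "(\<lambda>i. s i \<tau>) \<longlonglongrightarrow> 0" unfolding s_def by (rule tendsto_mult_right_zero)
      qed
      show "AE \<tau> in lborel. norm (s i \<tau>) \<le> M * cmod (c \<tau> * v \<tau>)" for i
      proof (intro AE_I2)
        fix \<tau>
        have pos: "\<bar>Z i - t\<bar> > 0" using Z(2) by simp
        have "cmod (of_real (Z i) powr v \<tau> - of_real t powr v \<tau>)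
            \<le> cmod (v \<tau>) * ((t/2) powr (r - 1) + (2*t) powr (r - 1)) * \<bar>Z i - t\<bar>"
          using cmod_powr_diff_le[of "t/2" "Z i" "2*t" t "v \<tau>"] Z(1)[of i] t by (simp add: r)
        moreover have "cmod ((Z i - t) *\<^sub>R (v \<tau> * of_real t powr (v \<tau> - 1))) = cmod (v \<tau>) * t powr (r - 1) * \<bar>Z i - t\<bar>"
          using t by (simp add: norm_mult cmod_powr_of_real r)
        ultimately have "cmod (d i \<tau>) \<le>
            cmod (v \<tau>) * ((t/2) powr (r - 1) + (2*t) powr (r - 1)) * \<bar>Z i - t\<bar> + cmod (v \<tau>) * t powr (r - 1) * \<bar>Z i - t\<bar>"
        proof -
          have gen: "norm x \<le> a \<Longrightarrow> norm y = b \<Longrightarrow> norm (x - y) \<le> a + b" for x y :: complex and a b :: real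
            using norm_triangle_ineq4[of x y] by linarith
          assume "cmod (of_real (Z i) powr v \<tau> - of_real t powr v \<tau>)
            \<le> cmod (v \<tau>) * ((t/2) powr (r - 1) + (2*t) powr (r - 1)) * \<bar>Z i - t\<bar>"
            "cmod ((Z i - t) *\<^sub>R (v \<tau> * of_real t powr (v \<tau> - 1))) = cmod (v \<tau>) * t powr (r - 1) * \<bar>Z i - t\<bar>"
          then show ?thesis unfolding d_def by (rule gen)
        qed
        also have "\<dots> = cmod (v \<tau>) * M * \<bar>Z i - t\<bar>" by (simp add: M_def algebra_simps)
        finally have "cmod (d i \<tau>) / \<bar>Z i - t\<bar> \<le> cmod (v \<tau>) * M"
          using pos by (simp only: pos_divide_le_eq)
        from mult_left_mono[OF this, of "cmod (c \<tau>)"]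
        show "norm (s i \<tau>) \<le> M * cmod (c \<tau> * v \<tau>)"
          unfolding s_def norm_mult norm_divide norm_of_real by (simp add: mult_ac)
      qed
    qed simp
    have "norm ((?F (Z i) - ?F t) - (Z i - t) *\<^sub>R ?D) / norm (Z i - t) = norm (integral\<^sup>L lborel (s i))" for i
    proof -
      note ints = integrable_mult_powr[OF c v r Z(3)[of i]] integrable_mult_powr[OF c v r t]
      have "(?F (Z i) - ?F t) - (Z i - t) *\<^sub>R ?D =
         (LINT \<tau>|lborel. (c \<tau> * of_real (Z i) powr v \<tau> - c \<tau> * of_real t powr v \<tau>)
           - (Z i - t) *\<^sub>R (c \<tau> * v \<tau> * of_real t powr (v \<tau> - 1)))"
        using ints Dint by simp
      also have "\<dots> = (LINT \<tau>|lborel. complex_of_real (Z i - t) * s i \<tau>)"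
        using Z(2)[of i] by (intro Bochner_Integration.integral_cong refl) (simp add: s_def d_def scaleR_conv_of_real field_simps)
      finally have "(?F (Z i) - ?F t) - (Z i - t) *\<^sub>R ?D = complex_of_real (Z i - t) * integral\<^sup>L lborel (s i)"
        by (simp only: integral_mult_right_zero)
      then show ?thesis using Z(2)[of i] by (simp only: norm_mult norm_of_real real_norm_def) simp
    qed
    then have "(\<lambda>i. norm ((?F (Z i) - ?F t) - (Z i - t) *\<^sub>R ?D) / norm (Z i - t)) \<longlonglongrightarrow> 0"
      using tendsto_norm[OF lim0] by simp
    then show "(\<lambda>i. norm ((?F (X i) - ?F t) - (X i - t) *\<^sub>R ?D) / norm (X i - t)) \<longlonglongrightarrow> 0"
      unfolding Z_def by (rule LIMSEQ_offset)
  qed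
  then show ?thesis
    unfolding has_vector_derivative_def has_derivative_iff_norm by (auto intro: bounded_linear_scaleR_left)
qed

text \<open>The factors produced by \<open>k\<close> differentiations of \<open>t powr (w + N - 1)\<close> are
  \<open>w + N - 1, \<dots>, w + N - k\<close>, in rising order a Pochhammer symbol.\<close>

lemma nth_deriv_powr_integral:
  fixes c w :: "real \<Rightarrow> complex" and N k :: nat
  assumes w: "w \<in> borel_measurable borel" and r: "\<And>\<tau>. Re (w \<tau>) = r"
    and int: "\<And>j. j \<le> k \<Longrightarrow> integrable lborel (\<lambda>\<tau>. c \<tau> * pochhammer (w \<tau> + of_nat N - of_nat j) j)"
    and f: "\<And>t. t > 0 \<Longrightarrow> f t = (LINT \<tau>|lborel. c \<tau> * of_real t powr (w \<tau> + of_nat N - 1))"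
    and t: "t > 0"
  shows "nth_deriv k f t = (LINT \<tau>|lborel. c \<tau> * pochhammer (w \<tau> + of_nat N - of_nat k) k *
            of_real t powr (w \<tau> + of_nat N - 1 - of_nat k))"
  using int t
proof (induction k arbitrary: t)
  case 0
  then show ?case using f by (simp add: nth_deriv_def)
next
  case (Suc k)
  let ?c = "\<lambda>\<tau>. c \<tau> * pochhammer (w \<tau> + of_nat N - of_nat k) k"
  let ?v = "\<lambda>\<tau>. w \<tau> + of_nat N - 1 - of_nat k"
  have IH: "nth_deriv k f t = (LINT \<tau>|lborel. ?c \<tau> * of_real t powr ?v \<tau>)" if "t > 0" for t
    using Suc.IH Suc.prems(1) that by simp
  have poch: "?c \<tau> * ?v \<tau> = c \<tau> * pochhammer (w \<tau> + of_nat N - of_nat (Suc k)) (Suc k)" for \<tau>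
  proof -
    have "w \<tau> + of_nat N - of_nat (Suc k) + 1 = w \<tau> + of_nat N - of_nat k" by simp
    then show ?thesis by (simp add: pochhammer_rec algebra_simps)
  qed
  have vm: "?v \<in> borel_measurable borel" using w by simp
  have "((\<lambda>t. LINT \<tau>|lborel. ?c \<tau> * of_real t powr ?v \<tau>) has_vector_derivative
          (LINT \<tau>|lborel. ?c \<tau> * ?v \<tau> * of_real t powr (?v \<tau> - 1))) (at t)"
  proof (rule has_vector_derivative_powr_integral[OF _ _ vm _ Suc.prems(2)])
    show "integrable lborel ?c" by (rule Suc.prems(1)) simp
    show "integrable lborel (\<lambda>\<tau>. ?c \<tau> * ?v \<tau>)" unfolding poch by (rule Suc.prems(1)) simp
    show "Re (?v \<tau>) = r + real N - 1 - real k" for \<tau> by (simp add: r)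
  qed
  then have "(nth_deriv k f has_vector_derivative (LINT \<tau>|lborel. ?c \<tau> * ?v \<tau> * of_real t powr (?v \<tau> - 1))) (at t)"
    by (rule has_vector_derivative_transform_within_open[where S = "{0<..}"]) (use IH Suc.prems(2) in auto)
  then have "vector_derivative (nth_deriv k f) (at t) = (LINT \<tau>|lborel. ?c \<tau> * ?v \<tau> * of_real t powr (?v \<tau> - 1))"
    by (rule vector_derivative_at)
  moreover have "nth_deriv (Suc k) f t = vector_derivative (nth_deriv k f) (at t)" by (simp add: nth_deriv_def)
  moreover have "?v \<tau> - 1 = w \<tau> + of_nat N - 1 - of_nat (Suc k)" for \<tau> by simp
  ultimately show ?case unfolding poch by simp
qed

lemma pochhammer_polynomial_bound:
  fixes z :: "real \<Rightarrow> complex"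
  assumes z: "\<And>\<tau>. cmod (z \<tau>) \<le> K * (1 + \<bar>\<tau>\<bar>)"
  shows "\<exists>M\<ge>0. \<forall>\<tau>. cmod (pochhammer (z \<tau>) j) \<le> M * (1 + \<bar>\<tau>\<bar>) ^ j"
proof (induction j)
  case 0
  show ?case by (intro exI[of _ 1]) simp
next
  case (Suc j)
  then obtain M where M: "M \<ge> 0" "\<And>\<tau>. cmod (pochhammer (z \<tau>) j) \<le> M * (1 + \<bar>\<tau>\<bar>) ^ j" by blast
  have K0: "K \<ge> 0" using order.trans[OF norm_ge_zero z[of 0]] by simp
  have "cmod (pochhammer (z \<tau>) (Suc j)) \<le> ((K + real j) * M) * (1 + \<bar>\<tau>\<bar>) ^ Suc j" for \<tau>
  proof -
    have "cmod (z \<tau> + of_nat j) \<le> cmod (z \<tau>) + real j" using norm_triangle_ineq[of "z \<tau>" "of_nat j"] by simp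
    also have "\<dots> \<le> K * (1 + \<bar>\<tau>\<bar>) + real j * (1 + \<bar>\<tau>\<bar>)"
      using z[of \<tau>] by (intro add_mono) (auto simp: mult_le_cancel_left1)
    also have "\<dots> = (K + real j) * (1 + \<bar>\<tau>\<bar>)" by (simp only: distrib_right)
    finally have "cmod (z \<tau> + of_nat j) * cmod (pochhammer (z \<tau>) j) \<le> ((K + real j) * (1 + \<bar>\<tau>\<bar>)) * (M * (1 + \<bar>\<tau>\<bar>) ^ j)"
      using K0 by (intro mult_mono M) auto
    then show ?thesis by (simp add: pochhammer_rec' norm_mult mult_ac)
  qed
  then show ?case using M(1) K0 by (intro exI[of _ "(K + real j) * M"]) auto
qed

section \<open>The Saigo integral of the derivative of a superposition of powers\<close>

text \<open>The Saigo integral takes \<open>t powr (w - 1)\<close> to this multiple of \<open>x powr (w - \<beta> - 1)\<close>.\<close>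

definition saigo_multiplier :: "complex \<Rightarrow> complex \<Rightarrow> complex \<Rightarrow> complex \<Rightarrow> complex" where
  "saigo_multiplier \<alpha> \<beta> \<gamma> w =
     Gamma w * Gamma (w + \<gamma> - \<beta>) * rGamma (w - \<beta>) * rGamma (w + \<alpha> + \<gamma>)"

text \<open>The substitution \<open>t = x u\<close> reduces this to the interval \<open>[0, 1]\<close>; the powers of \<open>x\<close> are moved
  into the density \<open>q\<close>.\<close>

theorem saigo_of_derivative_of_superposition:
  fixes \<alpha> \<beta> \<gamma> :: complex and q :: "real \<Rightarrow> complex" and y :: "real \<Rightarrow> real" and F g :: "real \<Rightarrow> complex"
  assumes \<alpha>: "Re \<alpha> > 0" and r: "r > max 0 (Re (\<beta> - \<gamma>))" and x: "x > 0"
    and y: "y \<in> borel_measurable borel"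
    and \<delta>: "0 < \<delta>" "\<delta> \<le> 1" "1 - Re \<alpha> < \<delta>"
    and q: "integrable lborel q" and q\<delta>: "integrable lborel (\<lambda>\<tau>. q \<tau> * complex_of_real (\<bar>y \<tau>\<bar> powr \<delta>))"
    and F: "\<And>t. t > 0 \<Longrightarrow> F t = (LINT \<tau>|lborel. q \<tau> * of_real t powr (Complex r (y \<tau>)))"
    and g: "\<And>t. t > 0 \<Longrightarrow> (F has_vector_derivative g t) (at t)"
  shows "saigo_integrand \<alpha> \<beta> \<gamma> g x integrable_on {0..x}"
    and "saigo \<alpha> \<beta> \<gamma> g x = (LINT \<tau>|lborel. q \<tau> * (Complex r (y \<tau>) * saigo_multiplier \<alpha> \<beta> \<gamma> (Complex r (y \<tau>))) *
            of_real x powr (Complex r (y \<tau>) - \<beta> - 1))"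
proof -
  define V where "V = saigo_multiplier \<alpha> \<beta> \<gamma>"
  define k where "k = saigo_kernel (\<alpha> + \<beta>) (- \<gamma>) \<alpha>"
  define w where "w = (\<lambda>\<tau>. Complex r (y \<tau>))"
  define q' where "q' = (\<lambda>\<tau>. q \<tau> * of_real x powr w \<tau>)"
  define H where "H = (\<lambda>u. F (x * u))"
  define H' where "H' = (\<lambda>u. x *\<^sub>R g (x * u))"
  \<comment> \<open>midway between the exponent of the kernel at \<open>u = 0\<close> and the one that \<open>u powr r\<close> can absorb\<close>
  define \<eta> where "\<eta> = (r + max 0 (Re (\<beta> - \<gamma>))) / 2"
  have \<eta>: "0 < \<eta>" "Re ((\<alpha> + \<beta>) + (- \<gamma>) - \<alpha>) \<le> \<eta>" "\<eta> < r" using r by (auto simp: \<eta>_def max_def)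
  have wr: "Re (w \<tau>) = r" for \<tau> by (simp add: w_def)
  have wm: "w \<in> borel_measurable borel" using y unfolding w_def Complex_eq by simp
  obtain k' C where
    k: "\<And>u. u \<in> {0<..<1} \<Longrightarrow> (k has_vector_derivative k' u) (at u)" and k'c: "continuous_on {0<..<1} k'"
    and kb: "\<And>u. u \<in> {0<..<1} \<Longrightarrow> cmod (k u) \<le> C * (u powr (- \<eta>) * (1 - u) powr (Re \<alpha> - 1))"
    and kb': "\<And>u. u \<in> {0<..<1} \<Longrightarrow> cmod (k' u) \<le> C * (u powr (- \<eta> - 1) * (1 - u) powr (Re \<alpha> - 2))"
    using saigo_kernel_estimates[OF \<alpha> \<eta>(1,2)] unfolding k_def by blast
  have B: "((\<lambda>u. k u * of_real u powr (v - 1)) has_integral Gamma \<alpha> * V v) {0..1}" if v: "Re v = r" for v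
  proof -
    have "((\<lambda>u. of_real (1 - u) powr (\<alpha> - 1) * hyp2F1 (\<alpha> + \<beta>) (- \<gamma>) \<alpha> (1 - complex_of_real u) * of_real u powr (v - 1))
     has_integral (Gamma \<alpha> * Gamma v * Gamma (\<alpha> + v - (\<alpha> + \<beta>) - (- \<gamma>)) * rGamma (\<alpha> + v - (\<alpha> + \<beta>)) * rGamma (\<alpha> + v - (- \<gamma>)))) {0..1}"
      by (rule has_integral_hyp2F1_kernel[OF \<alpha>]) (use v r in auto)
    moreover have "\<alpha> + v - (\<alpha> + \<beta>) - (- \<gamma>) = v + \<gamma> - \<beta>" "\<alpha> + v - (\<alpha> + \<beta>) = v - \<beta>" "\<alpha> + v - (- \<gamma>) = v + \<alpha> + \<gamma>" by simp_all
    ultimately show ?thesis unfolding k_def saigo_kernel_def V_def saigo_multiplier_def by (simp only: mult.assoc)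
  qed
  have q': "integrable lborel q'" unfolding q'_def by (rule integrable_mult_powr[OF q wm wr x])
  have q'\<delta>: "integrable lborel (\<lambda>\<tau>. q' \<tau> * complex_of_real (\<bar>y \<tau>\<bar> powr \<delta>))"
    using integrable_mult_powr[OF q\<delta> wm wr x] unfolding q'_def by (simp only: mult_ac)
  have HI: "H u = (LINT \<tau>|lborel. q' \<tau> * of_real u powr (Complex r (y \<tau>)))" if u: "u \<in> {0<..<1}" for u
  proof -
    have "of_real (x * u) powr v = of_real x powr v * of_real u powr v" for v :: complex
      using x u by (simp add: powr_times_real)
    then show ?thesis using F[of "x * u"] x u unfolding H_def q'_def w_def by (simp add: mult.assoc)
  qed
  have Hd: "(H has_vector_derivative H' u) (at u)" if u: "u \<in> {0<..<1}" for u
  proof -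
    have "((\<lambda>u. x * u) has_vector_derivative x) (at u)"
      by (auto intro!: derivative_eq_intros)
    moreover have "(F has_vector_derivative g (x * u)) (at (x * u))" using g x u by simp
    ultimately have "(F \<circ> (\<lambda>u. x * u) has_vector_derivative x *\<^sub>R g (x * u)) (at u)"
      by (rule vector_diff_chain_at)
    then show ?thesis by (simp add: H_def H'_def comp_def)
  qed
  define J where "J = (LINT \<tau>|lborel. q' \<tau> * (w \<tau> * (Gamma \<alpha> * V (w \<tau>))))"
  have J: "((\<lambda>u. k u * H' u) has_integral J) {0..1}"
    unfolding J_def w_def
    by (rule has_integral_kernel_times_derivative[OF k k'c kb kb' \<eta>(1,3) \<alpha> B y \<delta> q' q'\<delta> HI Hd])
  have main: "(saigo_integrand \<alpha> \<beta> \<gamma> g x has_integral of_real x powr (\<alpha> - 1) * J) {0..x}"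
  proof -
    have "((\<lambda>u. (of_real x powr (\<alpha> - 1) / complex_of_real x) * (k u * H' u)) has_integral (of_real x powr (\<alpha> - 1) / complex_of_real x) * J) {0..1}"
      by (intro has_integral_mult_right J)
    then have "((\<lambda>u. saigo_integrand \<alpha> \<beta> \<gamma> g x (x * u)) has_integral (of_real x powr (\<alpha> - 1) / complex_of_real x) * J) {0..1}"
      unfolding has_integral_Icc_iff_Ioo
    proof (rule has_integral_eq[rotated])
      fix u :: real assume u: "u \<in> {0<..<1}"
      have "complex_of_real (x - x * u) powr (\<alpha> - 1) = of_real x powr (\<alpha> - 1) * of_real (1 - u) powr (\<alpha> - 1)"
      proof -
        have "complex_of_real (x - x * u) = complex_of_real x * complex_of_real (1 - u)" by (simp add: algebra_simps)
        then show ?thesis using x u by (simp only: powr_times_real) (simp add: powr_times_real)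
      qed
      moreover have "complex_of_real (x * u / x) = complex_of_real u" using x by simp
      ultimately show "(of_real x powr (\<alpha> - 1) / complex_of_real x) * (k u * H' u) = saigo_integrand \<alpha> \<beta> \<gamma> g x (x * u)"
        using x unfolding saigo_integrand_def k_def saigo_kernel_def H'_def scaleR_conv_of_real
        by (simp only: mult_ac) simp
    qed
    moreover have "(\<lambda>t. t / x) ` {0..x} = {0..1::real}"
    proof (intro equalityI subsetI)
      fix u :: real assume "u \<in> {0..1}"
      then have "u = (x * u) / x" "x * u \<in> {0..x}" using x by (auto simp: mult_le_cancel_left1)
      then show "u \<in> (\<lambda>t. t / x) ` {0..x}" by (rule image_eqI)
    qed (use x in auto)
    ultimately have "((\<lambda>u. saigo_integrand \<alpha> \<beta> \<gamma> g x (x * u)) has_integral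
        (of_real x powr (\<alpha> - 1) / complex_of_real x) * J) ((\<lambda>t. t / x) ` {0..x})"
      by (simp only:)
    then have "(saigo_integrand \<alpha> \<beta> \<gamma> g x has_integral
        \<bar>x\<bar> *\<^sub>R ((of_real x powr (\<alpha> - 1) / complex_of_real x) * J)) {0..x}"
      by (rule has_integral_stretch_real_iff[THEN iffD1, rotated]) (use x in simp)
    moreover have "\<bar>x\<bar> *\<^sub>R ((of_real x powr (\<alpha> - 1) / complex_of_real x) * J) = of_real x powr (\<alpha> - 1) * J"
      using x by (simp add: scaleR_conv_of_real)
    ultimately show ?thesis by (simp only:)
  qed
  then show "saigo_integrand \<alpha> \<beta> \<gamma> g x integrable_on {0..x}" by blast
  have G0: "Gamma \<alpha> \<noteq> 0" using nonpos_Ints_Re[OF \<alpha>] by (simp add: Gamma_eq_zero_iff)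
  have "saigo \<alpha> \<beta> \<gamma> g x = of_real x powr (- \<alpha> - \<beta>) / Gamma \<alpha> * (of_real x powr (\<alpha> - 1) * J)"
    unfolding saigo_def integral_unique[OF main] ..
  also have "\<dots> = (of_real x powr (- \<alpha> - \<beta>) * of_real x powr (\<alpha> - 1) / Gamma \<alpha>) * J" by simp
  also have "of_real x powr (- \<alpha> - \<beta>) * of_real x powr (\<alpha> - 1) = of_real x powr (- \<beta> - 1)"
  proof -
    have "- \<alpha> - \<beta> + (\<alpha> - 1) = - \<beta> - 1" by simp
    then show ?thesis by (simp only: powr_add[symmetric])
  qed
  also have "(of_real x powr (- \<beta> - 1) / Gamma \<alpha>) * J =
      (LINT \<tau>|lborel. (of_real x powr (- \<beta> - 1) / Gamma \<alpha>) * (q' \<tau> * (w \<tau> * (Gamma \<alpha> * V (w \<tau>)))))"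
    unfolding J_def by (simp only: integral_mult_right_zero)
  also have "\<dots> = (LINT \<tau>|lborel. q \<tau> * (w \<tau> * V (w \<tau>)) * of_real x powr (w \<tau> - \<beta> - 1))"
  proof (intro Bochner_Integration.integral_cong refl)
    fix \<tau>
    have "w \<tau> - \<beta> - 1 = w \<tau> + (- \<beta> - 1)" by simp
    then have "of_real x powr (w \<tau> - \<beta> - 1) = of_real x powr w \<tau> * of_real x powr (- \<beta> - 1)"
      by (simp only: powr_add)
    then show "(of_real x powr (- \<beta> - 1) / Gamma \<alpha>) * (q' \<tau> * (w \<tau> * (Gamma \<alpha> * V (w \<tau>)))) =
        q \<tau> * (w \<tau> * V (w \<tau>)) * of_real x powr (w \<tau> - \<beta> - 1)"
      using G0 unfolding q'_def by simp
  qed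
  finally show "saigo \<alpha> \<beta> \<gamma> g x = (LINT \<tau>|lborel. q \<tau> * (Complex r (y \<tau>) * saigo_multiplier \<alpha> \<beta> \<gamma> (Complex r (y \<tau>))) *
            of_real x powr (Complex r (y \<tau>) - \<beta> - 1))"
    by (simp only: w_def V_def)
qed

section \<open>The generalized Caputo derivative of the I-function\<close>

text \<open>This includes poles, where both sides are 0.\<close>

lemma Gamma_power_one:
  assumes "Gamma_power_family G" "d \<noteq> 0" "s \<in> imag_axis"
  shows "G c d 1 s = Gamma (c + complex_of_real d * s)"
proof -
  have br: "Gamma_power_branch imag_axis 1 (\<lambda>s. c + complex_of_real d * s) (G c d 1)"
    using assms unfolding Gamma_power_family_def by auto
  show ?thesis
  proof (cases "c + complex_of_real d * s \<in> \<int>\<^sub>\<le>\<^sub>0")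
    case True
    then show ?thesis using br assms(3) unfolding Gamma_power_branch_def by (auto simp: Gamma_eq_zero_iff)
  next
    case False
    then show ?thesis using br assms(3) unfolding Gamma_power_branch_def by auto
  qed
qed

lemma I_chi_adjoin_triples:
  assumes "m \<le> length L" "n \<le> length U"
  shows "I_chi G m (n + 2) ([(a1, A1, \<kappa>1), (a2, A2, \<kappa>2)] @ U) (L @ [(b1, B1, \<nu>1), (b2, B2, \<nu>2)]) s =
    I_chi G m n U L s * (G (1 - a1) (- A1) \<kappa>1 s * G (1 - a2) (- A2) \<kappa>2 s *
      inverse (G (1 - b1) (- B1) \<nu>1 s) * inverse (G (1 - b2) (- B2) \<nu>2 s))"
  using assms by (simp add: I_chi_def divide_inverse mult_ac)

lemma I_Delta_adjoin_triples:
  assumes "m \<le> length L" "n \<le> length U"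
  shows "I_Delta m (n + 2) ([(a1, \<mu>, 1), (a2, \<mu>, 1)] @ U) (L @ [(b1, \<mu>, 1), (b2, \<mu>, 1)]) = I_Delta m n U L"
  using assms by (simp add: I_Delta_def)

text \<open>In the application the last term is \<open>Re \<alpha>\<close>.\<close>

lemma I_Omega_adjoin_triples:
  "I_Omega ([(a1, \<mu>, 1), (a2, \<mu>, 1)] @ U) (L @ [(b1, \<mu>, 1), (b2, \<mu>, 1)]) =
     I_Omega U L + Re (b1 + b2 - a1 - a2)"
  by (simp add: I_Omega_def)

text \<open>The density \<open>c\<close> in \<open>I(a t\<^sup>\<mu>) = \<integral> c \<tau> * t powr (- \<i> \<mu> \<tau>) d\<tau>\<close>.\<close>

definition I_density ::
    "(complex \<Rightarrow> real \<Rightarrow> real \<Rightarrow> complex \<Rightarrow> complex) \<Rightarrow>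
     nat \<Rightarrow> nat \<Rightarrow> triple list \<Rightarrow> triple list \<Rightarrow> real \<Rightarrow> complex \<Rightarrow> real \<Rightarrow> complex" where
  "I_density G m n U L \<theta> a \<tau> = 1 / (2 * complex_of_real pi) * I_chi G m n U L (\<i> * of_real \<tau>) *
     exp (- (\<i> * of_real \<tau>) * (complex_of_real (ln (cmod a)) + \<i> * of_real \<theta>))"

lemma cmod_I_density:
  "cmod (I_density G m n U L \<theta> a \<tau>) = 1 / (2 * pi) * (cmod (I_chi G m n U L (\<i> * of_real \<tau>)) * exp (\<theta> * \<tau>))"
  unfolding I_density_def by (simp add: norm_mult norm_divide mult.commute)

lemma I_fun_conv_density:
  assumes "a \<noteq> 0" "t > 0"
  shows "I_fun G m n U L \<theta> (a * complex_of_real (t powr \<mu>)) =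
    (LINT \<tau>|lborel. I_density G m n U L \<theta> a \<tau> * of_real t powr (- (\<i> * of_real (\<mu> * \<tau>))))"
proof -
  have ln: "ln (cmod (a * complex_of_real (t powr \<mu>))) = ln (cmod a) + \<mu> * ln t"
    using assms by (simp add: norm_mult ln_mult ln_powr)
  have e: "exp (- (\<i> * of_real \<tau>) * (complex_of_real (ln (cmod a) + \<mu> * ln t) + \<i> * of_real \<theta>)) =
     exp (- (\<i> * of_real \<tau>) * (complex_of_real (ln (cmod a)) + \<i> * of_real \<theta>)) *
     of_real t powr (- (\<i> * of_real (\<mu> * \<tau>)))" for \<tau>
    using assms(2) by (simp add: powr_def Ln_of_real exp_add[symmetric] algebra_simps)
  have "I_fun G m n U L \<theta> (a * complex_of_real (t powr \<mu>)) =
    (LINT \<tau>|lborel. 1 / (2 * complex_of_real pi * \<i>) * (I_chi G m n U L (\<i> * of_real \<tau>) *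
        (exp (- (\<i> * of_real \<tau>) * (complex_of_real (ln (cmod a)) + \<i> * of_real \<theta>)) *
     of_real t powr (- (\<i> * of_real (\<mu> * \<tau>)))) * \<i>))"
    unfolding I_fun_def ln e by (simp only: integral_mult_right_zero)
  also have "\<dots> = (LINT \<tau>|lborel. I_density G m n U L \<theta> a \<tau> * of_real t powr (- (\<i> * of_real (\<mu> * \<tau>))))"
    by (intro Bochner_Integration.integral_cong refl) (simp add: I_density_def)
  finally show ?thesis .
qed

lemma I_density_mult_integrable:
  assumes G: "Gamma_power_family G" and par: "I_parameters m n U L"
    and int: "integrable lborel (\<lambda>\<tau>. I_chi G m n U L (\<i> * of_real \<tau>) *
           complex_of_real (exp (\<theta> * \<tau>) * (1 + \<bar>\<tau>\<bar>) powr s))"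
    and X [measurable]: "X \<in> borel_measurable borel" and K: "\<And>\<tau>. cmod (X \<tau>) \<le> K * (1 + \<bar>\<tau>\<bar>) powr s"
  shows "integrable lborel (\<lambda>\<tau>. I_density G m n U L \<theta> a \<tau> * X \<tau>)"
proof (rule Bochner_Integration.integrable_bound[OF integrable_scaleR_right[of "K / (2 * pi)", OF int]])
  let ?g = "\<lambda>\<tau>. (K / (2 * pi)) *\<^sub>R (I_chi G m n U L (\<i> * of_real \<tau>) *
           complex_of_real (exp (\<theta> * \<tau>) * (1 + \<bar>\<tau>\<bar>) powr s))"
  note [measurable] = I_chi_measurable[OF G par]
  have "I_density G m n U L \<theta> a \<in> borel_measurable borel" unfolding I_density_def[abs_def] by measurable
  then show "(\<lambda>\<tau>. I_density G m n U L \<theta> a \<tau> * X \<tau>) \<in> borel_measurable lborel" by simp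
  have K0: "K \<ge> 0" using order.trans[OF norm_ge_zero K[of 0]] by simp
  have "cmod (I_density G m n U L \<theta> a \<tau> * X \<tau>) \<le> norm (?g \<tau>)" for \<tau>
  proof -
    have "cmod (I_density G m n U L \<theta> a \<tau> * X \<tau>) \<le>
      1 / (2 * pi) * (cmod (I_chi G m n U L (\<i> * of_real \<tau>)) * exp (\<theta> * \<tau>)) * (K * (1 + \<bar>\<tau>\<bar>) powr s)"
      unfolding norm_mult cmod_I_density by (intro mult_left_mono K) auto
    also have "\<dots> = norm (?g \<tau>)"
      using K0 by (simp add: norm_mult)
    finally show ?thesis .
  qed
  then show "AE \<tau> in lborel. cmod (I_density G m n U L \<theta> a \<tau> * X \<tau>) \<le> norm (?g \<tau>)"
    by (rule AE_I2)
qed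

theorem corollary5p1:
  fixes \<alpha> \<beta> \<gamma> \<rho> a :: complex and \<mu> \<theta> :: real and m n N :: nat
    and U L U' L' :: "triple list"
    and G :: "complex \<Rightarrow> real \<Rightarrow> real \<Rightarrow> complex \<Rightarrow> complex"
    and f :: "real \<Rightarrow> complex"
  assumes "Re \<alpha> > 0"
    and "a \<noteq> 0" and "a = complex_of_real (cmod a) * cis \<theta>"
    and "N = nat \<lfloor>Re \<alpha>\<rfloor> + 1"
    and "\<mu> > 0"
    and "Re \<rho> - real N > max 0 (Re (- \<alpha> - \<beta> - \<gamma>))"
    and "Gamma_power_family G"
    and U': "U' = [(1 - \<rho>, \<mu>, 1), (1 - \<alpha> - \<beta> - \<gamma> - \<rho> + of_nat N, \<mu>, 1)] @ U"
    and L': "L' = L @ [(1 - \<beta> - \<rho>, \<mu>, 1), (1 - \<gamma> - \<rho> + of_nat N, \<mu>, 1)]"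
    and "I_admissible m n U L \<theta>"
    and "I_admissible m (n + 2) U' L' \<theta>"
    and f: "f = (\<lambda>t. complex_of_real t powr (\<rho> - 1) *
                    I_fun G m n U L \<theta> (a * complex_of_real (t powr \<mu>)))"
    and "times_differentiable_on N f {0<..}"
  shows "\<forall>x>0. caputo_exists \<alpha> \<beta> \<gamma> f x \<and>
           caputo \<alpha> \<beta> \<gamma> f x =
             complex_of_real x powr (\<beta> + \<rho> - 1) *
             I_fun G m (n + 2) U' L' \<theta> (a * complex_of_real (x powr \<mu>))"
proof (intro allI impI conjI)
  fix x :: real assume x: "x > 0"
  note G = \<open>Gamma_power_family G\<close> and a0 = \<open>a \<noteq> 0\<close>
  have par: "I_parameters m n U L" and sep: "I_separated 0 m n U L"
    and mL: "m \<le> length L" and nU: "n \<le> length U"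
    using \<open>I_admissible m n U L \<theta>\<close> by (auto simp: I_admissible_def I_parameters_def)
  define r where "r = Re \<rho> - real N"
  define y where "y = (\<lambda>\<tau>. Im \<rho> - \<mu> * \<tau>)"
  define w where "w = (\<lambda>\<tau>. Complex r (y \<tau>))"
  have w: "w \<tau> = \<rho> - of_nat N - \<i> * of_real (\<mu> * \<tau>)" for \<tau>
    by (simp add: w_def r_def y_def complex_eq_iff)
  have rpos: "r > 0" and rpos': "r > Re (- \<alpha> - \<beta> - \<gamma>)" using assms(6) by (auto simp: r_def)
  have ym: "y \<in> borel_measurable borel" unfolding y_def by simp
  have wm [measurable]: "w \<in> borel_measurable borel" using ym unfolding w_def Complex_eq by simp
  have wr: "Re (w \<tau>) = r" for \<tau> by (simp add: w_def)
  have N1: "N = Suc (N - 1)" using assms(4) by simp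
  have Nf: "real (N - 1) = of_int \<lfloor>Re \<alpha>\<rfloor>" using assms(1,4) by simp
  \<comment> \<open>\<open>p\<close> is the real part of the order of the Saigo integral, so its kernel is singular like \<open>(1 - u) powr (p - 1)\<close>\<close>
  define p where "p = real N - Re \<alpha>"
  have p: "0 < p" "p \<le> 1" using Nf N1 unfolding p_def by linarith+
  have conv: "\<bar>\<theta>\<bar> < pi / 2 * I_Delta m n U L \<or> \<bar>\<theta>\<bar> = pi / 2 * I_Delta m n U L \<and> I_Omega U L + Re \<alpha> < -1"
  proof -
    have "I_Delta m (n + 2) U' L' = I_Delta m n U L" unfolding U' L' by (rule I_Delta_adjoin_triples[OF mL nU])
    moreover have "I_Omega U' L' = I_Omega U L + Re \<alpha>" unfolding U' L' I_Omega_adjoin_triples by simp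
    ultimately show ?thesis
      using \<open>I_admissible m (n + 2) U' L' \<theta>\<close> unfolding I_admissible_def I_abs_conv_def by auto
  qed
  obtain e where e: "0 < e" "e \<le> p" and int: "integrable lborel (\<lambda>\<tau>. I_chi G m n U L (\<i> * of_real \<tau>) *
           complex_of_real (exp (\<theta> * \<tau>) * (1 + \<bar>\<tau>\<bar>) powr (Re \<alpha> + e)))"
    using I_integrand_weight_integrable[OF G par sep conv p(1)] by blast
  define c where "c = I_density G m n U L \<theta> a"
  note cint = I_density_mult_integrable[OF G par int, of _ _ a, folded c_def]
  \<comment> \<open>the total growth \<open>\<bar>\<tau>\<bar> powr (N - 1 + \<delta>)\<close> is then exactly the one controlled by \<open>int\<close>\<close>
  define \<delta> where "\<delta> = 1 - p + e"
  have \<delta>: "0 < \<delta>" "\<delta> \<le> 1" "1 - p < \<delta>" using e p by (auto simp: \<delta>_def)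
  have "real (N - 1) = real N - 1" using N1 by simp
  then have Nd: "real (N - 1) + \<delta> = Re \<alpha> + e" by (simp add: \<delta>_def p_def)
  define D where "D = \<bar>r\<bar> + \<bar>Im \<rho>\<bar> + \<bar>\<mu>\<bar>"
  have yD: "\<bar>y \<tau>\<bar> \<le> D * (1 + \<bar>\<tau>\<bar>)" for \<tau>
  proof -
    have "\<bar>y \<tau>\<bar> \<le> \<bar>Im \<rho>\<bar> + \<bar>\<mu>\<bar> * \<bar>\<tau>\<bar>" unfolding y_def abs_mult[symmetric] by (rule abs_triangle_ineq4)
    also have "\<dots> \<le> D + D * \<bar>\<tau>\<bar>" unfolding D_def by (intro add_mono mult_right_mono) auto
    finally show ?thesis by (simp add: distrib_left)
  qed
  have rD: "\<bar>r\<bar> \<le> D" by (simp add: D_def)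
  have wD: "cmod (w \<tau> + of_nat N - of_nat j) \<le> (D + D + real N + real j) * (1 + \<bar>\<tau>\<bar>)" for \<tau> j
  proof -
    have "cmod (w \<tau>) \<le> D + D * (1 + \<bar>\<tau>\<bar>)" using cmod_le[of "w \<tau>"] yD[of \<tau>] rD by (simp add: w_def)
    moreover have "cmod (w \<tau> + of_nat N - of_nat j) \<le> cmod (w \<tau>) + real N + real j"
      using norm_triangle_ineq4[of "w \<tau> + of_nat N" "of_nat j"] norm_triangle_ineq[of "w \<tau>" "of_nat N"] by simp
    moreover have "D + real N + real j \<le> (D + real N + real j) * (1 + \<bar>\<tau>\<bar>)"
      using mult_left_mono[of 1 "1 + \<bar>\<tau>\<bar>" "D + real N + real j"] rD by simp
    moreover have "(D + D + real N + real j) * (1 + \<bar>\<tau>\<bar>) = D * (1 + \<bar>\<tau>\<bar>) + (D + real N + real j) * (1 + \<bar>\<tau>\<bar>)"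
      by (simp only: distrib_right add.assoc)
    ultimately show ?thesis by linarith
  qed
  define P where "P = (\<lambda>j \<tau>. pochhammer (w \<tau> + of_nat N - of_nat j) j)"
  have Pint: "integrable lborel (\<lambda>\<tau>. c \<tau> * P j \<tau>)"
    and Pint\<delta>: "integrable lborel (\<lambda>\<tau>. c \<tau> * (P j \<tau> * complex_of_real (\<bar>y \<tau>\<bar> powr \<delta>)))"
    if j: "j \<le> N - 1" for j
  proof -
    obtain M where M: "M \<ge> 0" "\<And>\<tau>. cmod (P j \<tau>) \<le> M * (1 + \<bar>\<tau>\<bar>) ^ j"
      using pochhammer_polynomial_bound[where z = "\<lambda>\<tau>. w \<tau> + of_nat N - of_nat j", OF wD] unfolding P_def by blast
    have pm: "(\<lambda>\<tau>. P j \<tau>) \<in> borel_measurable borel"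
      unfolding P_def pochhammer_prod by measurable
    have M': "cmod (P j \<tau>) \<le> M * (1 + \<bar>\<tau>\<bar>) powr real (N - 1)" for \<tau>
    proof -
      have "(1 + \<bar>\<tau>\<bar>) ^ j \<le> (1 + \<bar>\<tau>\<bar>) ^ (N - 1)" using j by (intro power_increasing) auto
      also have "\<dots> = (1 + \<bar>\<tau>\<bar>) powr real (N - 1)" by (subst powr_realpow) auto
      finally show ?thesis using order.trans[OF M(2) mult_left_mono[OF _ M(1)]] by blast
    qed
    show "integrable lborel (\<lambda>\<tau>. c \<tau> * P j \<tau>)"
    proof (rule cint[OF pm])
      fix \<tau>
      have "(1 + \<bar>\<tau>\<bar>) powr real (N - 1) \<le> (1 + \<bar>\<tau>\<bar>) powr (Re \<alpha> + e)"
        using Nd \<delta> by (intro powr_mono) auto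
      then show "cmod (P j \<tau>) \<le> M * (1 + \<bar>\<tau>\<bar>) powr (Re \<alpha> + e)"
        using order.trans[OF M' mult_left_mono[OF _ M(1)]] by blast
    qed
    show "integrable lborel (\<lambda>\<tau>. c \<tau> * (P j \<tau> * complex_of_real (\<bar>y \<tau>\<bar> powr \<delta>)))"
    proof (rule cint)
      show "(\<lambda>\<tau>. P j \<tau> * complex_of_real (\<bar>y \<tau>\<bar> powr \<delta>)) \<in> borel_measurable borel"
        using pm ym by measurable
      fix \<tau>
      have "\<bar>y \<tau>\<bar> powr \<delta> \<le> (D * (1 + \<bar>\<tau>\<bar>)) powr \<delta>" using yD \<delta> by (intro powr_mono2) auto
      also have "\<dots> = D powr \<delta> * (1 + \<bar>\<tau>\<bar>) powr \<delta>" by (simp add: powr_mult D_def)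
      finally have "cmod (P j \<tau> * complex_of_real (\<bar>y \<tau>\<bar> powr \<delta>)) \<le>
         (M * (1 + \<bar>\<tau>\<bar>) powr real (N - 1)) * (D powr \<delta> * (1 + \<bar>\<tau>\<bar>) powr \<delta>)"
        unfolding norm_mult norm_of_real using M(1) by (intro mult_mono M') auto
      also have "\<dots> = M * D powr \<delta> * ((1 + \<bar>\<tau>\<bar>) powr real (N - 1) * (1 + \<bar>\<tau>\<bar>) powr \<delta>)" by (simp only: mult_ac)
      also have "\<dots> = M * D powr \<delta> * (1 + \<bar>\<tau>\<bar>) powr (Re \<alpha> + e)" unfolding powr_add[symmetric] Nd ..
      finally show "cmod (P j \<tau> * complex_of_real (\<bar>y \<tau>\<bar> powr \<delta>)) \<le> M * D powr \<delta> * (1 + \<bar>\<tau>\<bar>) powr (Re \<alpha> + e)" .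
    qed
  qed
  have fI: "f t = (LINT \<tau>|lborel. c \<tau> * of_real t powr (w \<tau> + of_nat N - 1))" if t: "t > 0" for t
  proof -
    have "f t = (LINT \<tau>|lborel. of_real t powr (\<rho> - 1) * (c \<tau> * of_real t powr (- (\<i> * of_real (\<mu> * \<tau>)))))"
      unfolding f c_def I_fun_conv_density[OF a0 t] by (simp only: integral_mult_right_zero)
    also have "\<dots> = (LINT \<tau>|lborel. c \<tau> * of_real t powr (w \<tau> + of_nat N - 1))"
    proof (intro Bochner_Integration.integral_cong refl)
      fix \<tau>
      have "w \<tau> + of_nat N - 1 = (\<rho> - 1) + - (\<i> * of_real (\<mu> * \<tau>))" by (simp add: w)
      then show "of_real t powr (\<rho> - 1) * (c \<tau> * of_real t powr (- (\<i> * of_real (\<mu> * \<tau>)))) =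
          c \<tau> * of_real t powr (w \<tau> + of_nat N - 1)"
        by (simp only: powr_add mult_ac)
    qed
    finally show ?thesis .
  qed
  \<comment> \<open>the density of the derivative of order \<open>N - 1\<close>\<close>
  define q where "q = (\<lambda>\<tau>. c \<tau> * pochhammer (w \<tau> + 1) (N - 1))"
  have wN: "w \<tau> + of_nat N - of_nat (N - 1) = w \<tau> + 1" "w \<tau> + of_nat N - 1 - of_nat (N - 1) = w \<tau>" for \<tau>
    using arg_cong[OF N1, of "of_nat :: nat \<Rightarrow> complex"] by simp_all
  have FI: "nth_deriv (N - 1) f t = (LINT \<tau>|lborel. q \<tau> * of_real t powr (Complex r (y \<tau>)))" if t: "t > 0" for t
    using nth_deriv_powr_integral[OF wm wr, of "N - 1" c N f t, OF Pint[unfolded P_def] fI t] unfolding wN q_def by (simp add: w_def)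
  have Fd: "(nth_deriv (N - 1) f has_vector_derivative nth_deriv N f t) (at t)" if t: "t > 0" for t
  proof -
    have "nth_deriv (N - 1) f differentiable (at t)"
      using \<open>times_differentiable_on N f {0<..}\<close> N1 t unfolding times_differentiable_on_def by auto
    moreover have "nth_deriv N f t = vector_derivative (nth_deriv (N - 1) f) (at t)"
      by (subst N1) (simp add: nth_deriv_def)
    ultimately show ?thesis by (simp add: vector_derivative_works)
  qed
  have qi: "integrable lborel q" using Pint[of "N - 1"] unfolding q_def P_def wN by simp
  have qi\<delta>: "integrable lborel (\<lambda>\<tau>. q \<tau> * complex_of_real (\<bar>y \<tau>\<bar> powr \<delta>))"
    using Pint\<delta>[of "N - 1"] unfolding q_def P_def wN by (simp add: mult.assoc)
  have ord: "caputo_order \<alpha> = N" using assms(4) by (simp add: caputo_order_def)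
  have \<alpha>': "Re (- \<alpha> + of_nat N) > 0" using p by (simp add: p_def)
  have rr: "r > max 0 (Re ((- \<beta> - of_nat N) - (\<alpha> + \<gamma> - of_nat N)))" using rpos rpos' by simp
  have \<delta>': "1 - Re (- \<alpha> + of_nat N) < \<delta>" using \<delta>(3) by (simp add: p_def)
  note S = saigo_of_derivative_of_superposition[OF \<alpha>' rr x ym \<delta>(1,2) \<delta>' qi qi\<delta> FI Fd]
  have S2: "saigo (- \<alpha> + of_nat N) (- \<beta> - of_nat N) (\<alpha> + \<gamma> - of_nat N) (nth_deriv N f) x =
    (LINT \<tau>|lborel. q \<tau> * (Complex r (y \<tau>) * saigo_multiplier (- \<alpha> + of_nat N) (- \<beta> - of_nat N) (\<alpha> + \<gamma> - of_nat N) (Complex r (y \<tau>))) *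
      of_real x powr (Complex r (y \<tau>) - (- \<beta> - of_nat N) - 1))"
    by (rule S(2))
  show "caputo_exists \<alpha> \<beta> \<gamma> f x"
    unfolding caputo_exists_def ord Let_def by (rule S(1))
  show "caputo \<alpha> \<beta> \<gamma> f x = of_real x powr (\<beta> + \<rho> - 1) *
             I_fun G m (n + 2) U' L' \<theta> (a * complex_of_real (x powr \<mu>))"
  proof -
    have "of_real x powr (\<beta> + \<rho> - 1) * I_fun G m (n + 2) U' L' \<theta> (a * complex_of_real (x powr \<mu>)) =
       (LINT \<tau>|lborel. of_real x powr (\<beta> + \<rho> - 1) * (I_density G m (n + 2) U' L' \<theta> a \<tau> *
          of_real x powr (- (\<i> * of_real (\<mu> * \<tau>)))))"
      unfolding I_fun_conv_density[OF a0 x] by (simp only: integral_mult_right_zero)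
    also have "\<dots> = caputo \<alpha> \<beta> \<gamma> f x"
      unfolding caputo_def ord Let_def S2
    proof (intro Bochner_Integration.integral_cong refl)
      fix \<tau>
      define s where "s = \<i> * of_real \<tau>"
      have sI: "s \<in> imag_axis" unfolding s_def by (rule imag_axis_i)
      have \<mu>0: "- \<mu> \<noteq> 0" using \<open>\<mu> > 0\<close> by simp
      have ws: "w \<tau> = \<rho> - of_nat N - complex_of_real \<mu> * s" by (simp add: w s_def)
      have chi: "I_chi G m (n + 2) U' L' s = I_chi G m n U L s * (Gamma (w \<tau> + of_nat N) * Gamma (w \<tau> + \<alpha> + \<beta> + \<gamma>) *
          rGamma (w \<tau> + \<beta> + of_nat N) * rGamma (w \<tau> + \<gamma>))"
      proof -
        have "I_chi G m (n + 2) U' L' s = I_chi G m n U L s *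
          (G (1 - (1 - \<rho>)) (- \<mu>) 1 s * G (1 - (1 - \<alpha> - \<beta> - \<gamma> - \<rho> + of_nat N)) (- \<mu>) 1 s *
           inverse (G (1 - (1 - \<beta> - \<rho>)) (- \<mu>) 1 s) * inverse (G (1 - (1 - \<gamma> - \<rho> + of_nat N)) (- \<mu>) 1 s))"
          unfolding U' L' by (rule I_chi_adjoin_triples[OF mL nU])
        moreover have "1 - (1 - \<rho>) + complex_of_real (- \<mu>) * s = w \<tau> + of_nat N"
          "1 - (1 - \<alpha> - \<beta> - \<gamma> - \<rho> + of_nat N) + complex_of_real (- \<mu>) * s = w \<tau> + \<alpha> + \<beta> + \<gamma>"
          "1 - (1 - \<beta> - \<rho>) + complex_of_real (- \<mu>) * s = w \<tau> + \<beta> + of_nat N"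
          "1 - (1 - \<gamma> - \<rho> + of_nat N) + complex_of_real (- \<mu>) * s = w \<tau> + \<gamma>"
          by (simp_all add: ws)
        ultimately show ?thesis
          unfolding rGamma_inverse_Gamma by (simp only: Gamma_power_one[OF G \<mu>0 sI])
      qed
      have dens: "I_density G m (n + 2) U' L' \<theta> a \<tau> = c \<tau> * (Gamma (w \<tau> + of_nat N) * Gamma (w \<tau> + \<alpha> + \<beta> + \<gamma>) *
          rGamma (w \<tau> + \<beta> + of_nat N) * rGamma (w \<tau> + \<gamma>))"
        unfolding c_def I_density_def s_def[symmetric] chi by (simp only: mult_ac)
      have wnp: "w \<tau> \<notin> \<int>\<^sub>\<le>\<^sub>0" using rpos wr by (intro nonpos_Ints_Re) simp
      \<comment> \<open>the derivative left out of \<open>q\<close> supplies the factor \<open>w \<tau>\<close> missing in \<open>\<Gamma> (w + N) / \<Gamma> w\<close>\<close>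
      have "pochhammer (w \<tau>) N = w \<tau> * pochhammer (w \<tau> + 1) (N - 1)"
        using N1 pochhammer_rec[of "w \<tau>" "N - 1"] by simp
      moreover have "pochhammer (w \<tau>) N * Gamma (w \<tau>) = Gamma (w \<tau> + of_nat N)"
        using pochhammer_Gamma[OF wnp, of N] wnp by (simp add: Gamma_eq_zero_iff)
      ultimately have poch: "pochhammer (w \<tau> + 1) (N - 1) * w \<tau> * Gamma (w \<tau>) = Gamma (w \<tau> + of_nat N)"
        by (simp only: mult_ac)
      have args: "w \<tau> + (\<alpha> + \<gamma> - of_nat N) - (- \<beta> - of_nat N) = w \<tau> + \<alpha> + \<beta> + \<gamma>"
        "w \<tau> - (- \<beta> - of_nat N) = w \<tau> + \<beta> + of_nat N"
        "w \<tau> + (- \<alpha> + of_nat N) + (\<alpha> + \<gamma> - of_nat N) = w \<tau> + \<gamma>"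
        by simp_all
      have "w \<tau> - (- \<beta> - of_nat N) - 1 = (\<beta> + \<rho> - 1) + - (\<i> * of_real (\<mu> * \<tau>))"
        by (simp add: w)
      then have pw: "of_real x powr (w \<tau> - (- \<beta> - of_nat N) - 1) =
          of_real x powr (\<beta> + \<rho> - 1) * of_real x powr (- (\<i> * of_real (\<mu> * \<tau>)))"
        by (simp only: powr_add)
      have "of_real x powr (\<beta> + \<rho> - 1) * (I_density G m (n + 2) U' L' \<theta> a \<tau> * of_real x powr (- (\<i> * of_real (\<mu> * \<tau>)))) =
        q \<tau> * (w \<tau> * saigo_multiplier (- \<alpha> + of_nat N) (- \<beta> - of_nat N) (\<alpha> + \<gamma> - of_nat N) (w \<tau>)) *
          of_real x powr (w \<tau> - (- \<beta> - of_nat N) - 1)"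
        unfolding pw saigo_multiplier_def unfolding args dens q_def poch[symmetric] by (simp only: mult_ac)
      then show "of_real x powr (\<beta> + \<rho> - 1) * (I_density G m (n + 2) U' L' \<theta> a \<tau> * of_real x powr (- (\<i> * of_real (\<mu> * \<tau>)))) =
        q \<tau> * (Complex r (y \<tau>) * saigo_multiplier (- \<alpha> + of_nat N) (- \<beta> - of_nat N) (\<alpha> + \<gamma> - of_nat N) (Complex r (y \<tau>))) *
          of_real x powr (Complex r (y \<tau>) - (- \<beta> - of_nat N) - 1)"
        by (simp only: w_def)
    qed
    finally show ?thesis by simp
  qed
qed

end
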